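(* Let $\Sigma=\Sigma_{0,p}$ be a punctured sphere with $p\geqslant 3$ punctures. Let $n\in\mathbb Z$ and $s\in\{\pm1\}^p$. Then the space $\mathcal R_n^s(\Sigma)$ of type-preserving representations with relative Euler class $n$ and sign $s$ is non-empty if and only if the pair $(n,s)$ satisfies one of the following conditions: (1) $\chi(\Sigma)+p_+(s)\leqslant n\leqslant-\chi(\Sigma)-p_-(s)$; (2) $n=0$, and either $p_-(s)=1$ or $p_+(s)=1$; (3) $n=1$ and $p_-(s)=0$, or $n=-1$ and $p_+(s)=0$. Moreover, each non-empty $\mathcal R_n^s(\Sigma)$ above is connected.
   Context: $\Sigma_{0,p}$ is the sphere with $p$ points removed; $\chi(\Sigma_{0,p})=2-p$. Its fundamental group is $\pi_1(\Sigma)=\langle c_1,\dots,c_p\mid c_1\cdots c_p\rangle$, where $c_1,\dots,c_p$ are the preferred peripheral elements ($c_i$ represented by a loop freely homotopic to a circle around the $i$-th puncture). A non-trivial element $\pm A\in\mathrm{PSL}(2,\mathbb R)$ is hyperbolic, parabolic, or elliptic if $|\mathrm{tr}(A)|>2$, $=2$, or $<2$ respectively. A parabolic element is positive if it is $\mathrm{PSL}(2,\mathbb R)$-conjugate to $\pm\begin{bmatrix}1&1\\0&1\end{bmatrix}$ and negative if it is conjugate to $\pm\begin{bmatrix}1&-1\\0&1\end{bmatrix}$. A representation $\phi:\pi_1(\Sigma)\to\mathrm{PSL}(2,\mathbb R)$ is type-preserving if every $\phi(c_i)$ is parabolic. Its sign $s(\phi)\in\{\pm1\}^p$ has $i$-th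 component $+1$ if $\phi(c_i)$ is positive and $-1$ if $\phi(c_i)$ is negative. For $s\in\{\pm1\}^p$, $p_+(s)$ and $p_-(s)$ are the numbers of components equal to $+1$ and $-1$. Relative Euler class: let $\widetilde{\mathrm{SL}}(2,\mathbb R)$ be the universal covering group of $\mathrm{PSL}(2,\mathbb R)$, with exponential map $\widetilde{\exp}$, and let $z=\widetilde{\exp}\begin{bmatrix}0&\pi\\-\pi&0\end{bmatrix}$, a generator of the center. A parabolic element of $\mathrm{PSL}(2,\mathbb R)$ has a unique lift lying in the image of $\widetilde{\exp}$; let $\widetilde{\phi(c_i)}$ be this lift of $\phi(c_i)$. Then $e(\phi)=n$ is the integer with $\widetilde{\phi(c_1)}\cdots\widetilde{\phi(c_p)}=z^n$. $\mathcal R_n^s(\Sigma)$ is the set of type-preserving $\phi$ with $e(\phi)=n$ and $s(\phi)=s$, with the subspace topology from $\mathrm{Hom}(\pi_1(\Sigma),\mathrm{PSL}(2,\mathbb R))$ with the compact-open topology (equivalently pointwise convergence on generators). *)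

theory Defs
  imports "HOL-Analysis.Analysis" "HOL-Algebra.Coset"
begin

section \<open>The group $\mathrm{PSL}(2,\mathbb R)$ and its topology\<close>

definition SL2R :: "(real^2^2) monoid" where
  "SL2R = \<lparr>carrier = {A. det A = 1}, mult = (**), one = mat 1\<rparr>"

definition PSL2R :: "(real^2^2) set monoid" where
  "PSL2R = SL2R Mod {mat 1, - mat 1}"

text \<open>The coset \<^term>\<open>psl A\<close> is the set consisting of \<^term>\<open>A\<close> and \<^term>\<open>- A\<close>.\<close>

definition psl :: "real^2^2 \<Rightarrow> (real^2^2) set" where
  "psl A = {mat 1, - mat 1} #>\<^bsub>SL2R\<^esub> A"

text \<open>The quotient topology: the preimage of a set of cosets under \<^const>\<open>psl\<close> is its union.\<close>

definition PSL2R_topology :: "(real^2^2) set topology" where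
  "PSL2R_topology =
     topology (\<lambda>U. U \<subseteq> carrier PSL2R \<and> openin (top_of_set (carrier SL2R)) (\<Union>U))"

lemma group_SL2R: "group SL2R"
proof (rule groupI)
  fix x assume x: "x \<in> carrier SL2R"
  then have "invertible x"
    by (simp add: SL2R_def invertible_det_nz)
  then obtain y where y: "x ** y = mat 1" "y ** x = mat 1"
    unfolding invertible_def by blast
  have "det x * det y = 1"
    using y(1) by (simp flip: det_mul)
  with x have "det y = 1"
    by (simp add: SL2R_def)
  with y show "\<exists>y\<in>carrier SL2R. y \<otimes>\<^bsub>SL2R\<^esub> x = \<one>\<^bsub>SL2R\<^esub>"
    by (auto simp: SL2R_def)
qed (auto simp: SL2R_def det_mul matrix_mul_assoc)

lemma matrix_mult_uminus:
  fixes A B :: "real^2^2"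
  shows "(- A) ** B = - (A ** B)" and "A ** (- B) = - (A ** B)"
  by (simp_all add: vec_eq_iff matrix_matrix_mult_def sum_negf)

lemma normal_center_SL2R: "{mat 1, - mat 1} \<lhd> SL2R"
proof -
  interpret group SL2R by (rule group_SL2R)
  have det: "det (- mat 1 :: real^2^2) = 1"
    by (simp add: det_2 mat_def)
  have neg: "- mat 1 \<in> carrier SL2R"
    using det by (simp add: SL2R_def)
  have sub: "subgroup {mat 1, - mat 1} SL2R"
  proof (rule subgroupI)
    fix a assume a: "a \<in> {mat 1, - mat 1 :: real^2^2}"
    then have "a \<otimes>\<^bsub>SL2R\<^esub> a = \<one>\<^bsub>SL2R\<^esub>"
      by (auto simp: SL2R_def matrix_mult_uminus)
    moreover have "a \<in> carrier SL2R"
      using a neg by (auto simp: SL2R_def)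
    ultimately have "inv\<^bsub>SL2R\<^esub> a = a"
      using inv_equality by blast
    with a show "inv\<^bsub>SL2R\<^esub> a \<in> {mat 1, - mat 1}" by simp
  qed (use det in \<open>auto simp: SL2R_def matrix_mult_uminus\<close>)
  show ?thesis
  proof (rule normalI[OF sub], rule ballI)
    fix x
    show "{mat 1, - mat 1} #>\<^bsub>SL2R\<^esub> x = x <#\<^bsub>SL2R\<^esub> {mat 1, - mat 1}"
      by (auto simp: r_coset_def l_coset_def SL2R_def matrix_mult_uminus)
  qed
qed

lemma group_PSL2R: "group PSL2R"
  unfolding PSL2R_def by (rule normal.factorgroup_is_group[OF normal_center_SL2R])

lemma psl_eq: "psl A = {A, - A}"
  by (auto simp: psl_def r_coset_def SL2R_def matrix_mult_uminus)

lemma carrier_PSL2R: "carrier PSL2R = psl ` carrier SL2R"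
  by (auto simp: PSL2R_def carrier_FactGroup psl_def)

lemma mem_PSL2R:
  assumes "x \<in> carrier PSL2R" "A \<in> x"
  shows "x = psl A"
  using assms by (auto simp: carrier_PSL2R psl_eq)

lemma openin_PSL2R_topology:
  "openin PSL2R_topology U \<longleftrightarrow>
     U \<subseteq> carrier PSL2R \<and> openin (top_of_set (carrier SL2R)) (\<Union>U)"
proof -
  have "istopology (\<lambda>U. U \<subseteq> carrier PSL2R \<and> openin (top_of_set (carrier SL2R)) (\<Union>U))"
    unfolding istopology_def
  proof (intro conjI allI impI; (elim conjE)?)
    fix S T :: "(real^2^2) set set"
    assume *: "S \<subseteq> carrier PSL2R" "T \<subseteq> carrier PSL2R"
      "openin (top_of_set (carrier SL2R)) (\<Union>S)" "openin (top_of_set (carrier SL2R)) (\<Union>T)"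
    have "\<Union>(S \<inter> T) = \<Union>S \<inter> \<Union>T"
    proof (intro equalityI subsetI)
      fix A assume "A \<in> \<Union>S \<inter> \<Union>T"
      then obtain x y where xy: "x \<in> S" "A \<in> x" "y \<in> T" "A \<in> y" by blast
      then have "x = psl A" "y = psl A"
        using *(1,2) mem_PSL2R by (meson subsetD)+
      with xy show "A \<in> \<Union>(S \<inter> T)" by blast
    qed blast
    moreover have "openin (top_of_set (carrier SL2R)) (\<Union>S \<inter> \<Union>T)"
      using *(3,4) by (rule openin_Int)
    ultimately show "openin (top_of_set (carrier SL2R)) (\<Union>(S \<inter> T))"
      by simp
  next
    fix \<K> :: "(real^2^2) set set set"
    assume *: "\<forall>K\<in>\<K>. K \<subseteq> carrier PSL2R \<and> openin (top_of_set (carrier SL2R)) (\<Union>K)"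
    have "\<Union>(\<Union>\<K>) = \<Union>(Union ` \<K>)" by blast
    moreover have "openin (top_of_set (carrier SL2R)) (\<Union>(Union ` \<K>))"
      by (rule openin_Union) (use * in blast)
    ultimately show "openin (top_of_set (carrier SL2R)) (\<Union>(\<Union>\<K>))"
      by simp
  qed blast+
  then show ?thesis
    by (simp add: PSL2R_topology_def topology_inverse')
qed

lemma topspace_PSL2R_topology: "topspace PSL2R_topology = carrier PSL2R"
proof
  show "topspace PSL2R_topology \<subseteq> carrier PSL2R"
    using openin_PSL2R_topology openin_topspace by blast
  have "A \<in> carrier SL2R \<longleftrightarrow> - A \<in> carrier SL2R" for A
    by (simp add: SL2R_def det_2)
  then have "\<Union>(carrier PSL2R) = carrier SL2R"
    by (auto simp: carrier_PSL2R psl_eq)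
  then have "openin PSL2R_topology (carrier PSL2R)"
    using openin_topspace[of "top_of_set (carrier SL2R)"] by (simp add: openin_PSL2R_topology)
  then show "carrier PSL2R \<subseteq> topspace PSL2R_topology"
    by (rule openin_subset)
qed

section \<open>Parabolic elements\<close>

text \<open>The absolute value of the trace does not depend on the representative of the coset.\<close>

definition parabolic :: "(real^2^2) set \<Rightarrow> bool" where
  "parabolic x \<longleftrightarrow> x \<in> carrier PSL2R \<and> x \<noteq> \<one>\<^bsub>PSL2R\<^esub> \<and> (\<forall>A\<in>x. \<bar>trace A\<bar> = 2)"

definition PSL2R_conjugate :: "(real^2^2) set \<Rightarrow> (real^2^2) set \<Rightarrow> bool" where
  "PSL2R_conjugate x y \<longleftrightarrow>
     (\<exists>g\<in>carrier PSL2R. x = g \<otimes>\<^bsub>PSL2R\<^esub> y \<otimes>\<^bsub>PSL2R\<^esub> inv\<^bsub>PSL2R\<^esub> g)"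

definition positive_parabolic :: "(real^2^2) set \<Rightarrow> bool" where
  "positive_parabolic x \<longleftrightarrow>
     parabolic x \<and> PSL2R_conjugate x (psl (vector [vector [1, 1], vector [0, 1]]))"

definition negative_parabolic :: "(real^2^2) set \<Rightarrow> bool" where
  "negative_parabolic x \<longleftrightarrow>
     parabolic x \<and> PSL2R_conjugate x (psl (vector [vector [1, - 1], vector [0, 1]]))"

definition parabolic_sign :: "(real^2^2) set \<Rightarrow> int" where
  "parabolic_sign x =
     (if positive_parabolic x then 1 else if negative_parabolic x then - 1 else undefined)"

section \<open>The universal covering group of $\mathrm{PSL}(2,\mathbb R)$\<close>

text \<open>
  The universal cover of a topological group (connected, locally path-connected and semilocally
  simply connected), realised as usual by paths starting at the identity modulo homotopy relative
  to the endpoints, with pointwise multiplication. Paths are functions on the reals of which only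
  the restriction to the unit interval matters: functions agreeing there are homotopic.
\<close>

definition based_paths :: "('a, 'b) monoid_scheme \<Rightarrow> 'a topology \<Rightarrow> (real \<Rightarrow> 'a) set" where
  "based_paths G T = {g. pathin T g \<and> g 0 = \<one>\<^bsub>G\<^esub>}"

definition path_class :: "'a topology \<Rightarrow> (real \<Rightarrow> 'a) \<Rightarrow> (real \<Rightarrow> 'a) set" where
  "path_class T g =
     {h. homotopic_with (\<lambda>r. r 0 = g 0 \<and> r 1 = g 1) (top_of_set {0..1}) T g h}"

definition universal_cover :: "('a, 'b) monoid_scheme \<Rightarrow> 'a topology \<Rightarrow> (real \<Rightarrow> 'a) set monoid" where
  "universal_cover G T =
     \<lparr>carrier = path_class T ` based_paths G T,
      mult = (\<lambda>P Q. \<Union>g\<in>P. \<Union>h\<in>Q. path_class T (\<lambda>t. g t \<otimes>\<^bsub>G\<^esub> h t)),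
      one = path_class T (\<lambda>t. \<one>\<^bsub>G\<^esub>)\<rparr>"

definition cover_proj :: "(real \<Rightarrow> 'a) set \<Rightarrow> 'a" where
  "cover_proj P = the_elem ((\<lambda>g. g 1) ` P)"

definition SL2R_tilde :: "(real \<Rightarrow> (real^2^2) set) set monoid" where
  "SL2R_tilde = universal_cover PSL2R PSL2R_topology"

definition mat_exp :: "real^'n^'n \<Rightarrow> real^'n^'n" where
  "mat_exp A = (\<Sum>k. (1 / fact k) *\<^sub>R (((**) A ^^ k) (mat 1)))"

definition sl2R :: "(real^2^2) set" where
  "sl2R = {X. trace X = 0}"

text \<open>
  The exponential map of the covering group sends \<^term>\<open>X\<close> to the endpoint of the lift of the
  one-parameter subgroup generated by \<^term>\<open>X\<close>, i.e. to the class of that path.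
\<close>

definition exp_tilde :: "real^2^2 \<Rightarrow> (real \<Rightarrow> (real^2^2) set) set" where
  "exp_tilde X = path_class PSL2R_topology (\<lambda>t. psl (mat_exp (t *\<^sub>R X)))"

definition z_tilde :: "(real \<Rightarrow> (real^2^2) set) set" where
  "z_tilde = exp_tilde (vector [vector [0, pi], vector [- pi, 0]])"

definition exp_lift :: "(real^2^2) set \<Rightarrow> (real \<Rightarrow> (real^2^2) set) set" where
  "exp_lift x = (THE y. y \<in> exp_tilde ` sl2R \<and> cover_proj y = x)"

section \<open>The fundamental group of the punctured sphere\<close>

text \<open>
  Groups given by generators and relators. A word is a list of letters \<^term>\<open>(a, b)\<close>, standing for
  the generator \<^term>\<open>a\<close> if \<^term>\<open>b\<close> is true and for its inverse otherwise.
\<close>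

inductive word_eq :: "'a set \<Rightarrow> ('a \<times> bool) list set \<Rightarrow> ('a \<times> bool) list \<Rightarrow> ('a \<times> bool) list \<Rightarrow> bool"
  for I R where
  refl: "w \<in> lists (I \<times> UNIV) \<Longrightarrow> word_eq I R w w"
| sym: "word_eq I R v w \<Longrightarrow> word_eq I R w v"
| trans: "word_eq I R u v \<Longrightarrow> word_eq I R v w \<Longrightarrow> word_eq I R u w"
| cancel: "u \<in> lists (I \<times> UNIV) \<Longrightarrow> v \<in> lists (I \<times> UNIV) \<Longrightarrow> a \<in> I \<Longrightarrow>
    word_eq I R (u @ [(a, b), (a, \<not> b)] @ v) (u @ v)"
| relator: "u \<in> lists (I \<times> UNIV) \<Longrightarrow> v \<in> lists (I \<times> UNIV) \<Longrightarrow>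
    r \<in> R \<Longrightarrow> r \<in> lists (I \<times> UNIV) \<Longrightarrow> word_eq I R (u @ r @ v) (u @ v)"

definition word_class :: "'a set \<Rightarrow> ('a \<times> bool) list set \<Rightarrow> ('a \<times> bool) list \<Rightarrow> ('a \<times> bool) list set" where
  "word_class I R w = {v. word_eq I R w v}"

definition presented_group :: "'a set \<Rightarrow> ('a \<times> bool) list set \<Rightarrow> ('a \<times> bool) list set monoid" where
  "presented_group I R =
     \<lparr>carrier = word_class I R ` lists (I \<times> UNIV),
      mult = (\<lambda>P Q. \<Union>u\<in>P. \<Union>v\<in>Q. word_class I R (u @ v)),
      one = word_class I R []\<rparr>"

definition sphere_relators :: "nat \<Rightarrow> (nat \<times> bool) list set" where
  "sphere_relators p = {map (\<lambda>i. (i, True)) [1..<p+1]}"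

definition sphere_pi1 :: "nat \<Rightarrow> (nat \<times> bool) list set monoid" where
  "sphere_pi1 p = presented_group {1..p} (sphere_relators p)"

definition peripheral :: "nat \<Rightarrow> nat \<Rightarrow> (nat \<times> bool) list set" where
  "peripheral p i = word_class {1..p} (sphere_relators p) [(i, True)]"

definition sphere_euler_char :: "nat \<Rightarrow> int" where
  "sphere_euler_char p = 2 - int p"

section \<open>Spaces of type-preserving representations\<close>

text \<open>
  Homomorphisms are normalised to be \<^const>\<open>undefined\<close> outside the carrier. As the fundamental
  group is discrete, the compact-open topology is the topology of pointwise convergence.
\<close>

definition rep_set :: "nat \<Rightarrow> ((nat \<times> bool) list set \<Rightarrow> (real^2^2) set) set" where
  "rep_set p = hom (sphere_pi1 p) PSL2R \<inter> extensional (carrier (sphere_pi1 p))"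

definition rep_topology :: "nat \<Rightarrow> ((nat \<times> bool) list set \<Rightarrow> (real^2^2) set) topology" where
  "rep_topology p =
     subtopology (product_topology (\<lambda>_. PSL2R_topology) (carrier (sphere_pi1 p))) (rep_set p)"

definition type_preserving :: "nat \<Rightarrow> ((nat \<times> bool) list set \<Rightarrow> (real^2^2) set) \<Rightarrow> bool" where
  "type_preserving p \<phi> \<longleftrightarrow> \<phi> \<in> rep_set p \<and> (\<forall>i\<in>{1..p}. parabolic (\<phi> (peripheral p i)))"

definition rep_sign :: "nat \<Rightarrow> ((nat \<times> bool) list set \<Rightarrow> (real^2^2) set) \<Rightarrow> nat \<Rightarrow> int" where
  "rep_sign p \<phi> = (\<lambda>i\<in>{1..p}. parabolic_sign (\<phi> (peripheral p i)))"

definition rel_euler_class :: "nat \<Rightarrow> ((nat \<times> bool) list set \<Rightarrow> (real^2^2) set) \<Rightarrow> int" where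
  "rel_euler_class p \<phi> =
     (THE n::int. foldr (\<otimes>\<^bsub>SL2R_tilde\<^esub>) (map (\<lambda>i. exp_lift (\<phi> (peripheral p i))) [1..<p+1])
                        \<one>\<^bsub>SL2R_tilde\<^esub>
                    = z_tilde [^]\<^bsub>SL2R_tilde\<^esub> n)"

definition rep_space :: "nat \<Rightarrow> int \<Rightarrow> (nat \<Rightarrow> int) \<Rightarrow> ((nat \<times> bool) list set \<Rightarrow> (real^2^2) set) set" where
  "rep_space p n s = {\<phi>. type_preserving p \<phi> \<and> rel_euler_class p \<phi> = n \<and> rep_sign p \<phi> = s}"

definition p_plus :: "nat \<Rightarrow> (nat \<Rightarrow> int) \<Rightarrow> nat" where
  "p_plus p s = card {i \<in> {1..p}. s i = 1}"

definition p_minus :: "nat \<Rightarrow> (nat \<Rightarrow> int) \<Rightarrow> nat" where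
  "p_minus p s = card {i \<in> {1..p}. s i = - 1}"

end

theory Submission
  imports Defs
begin

text \<open>
  Identify the plane with the complex numbers. A parabolic element has a unique lift
  \<open>x \<mapsto> x + s det(v, x) v\<close> of trace \<open>2\<close>, where \<open>s\<close> is its sign and \<open>\<nu> = v\<^sup>2\<close>
  ranges over the nonzero complex numbers. So a representation is a tuple of numbers \<open>\<nu> \<noteq> 0\<close>
  whose transvections compose to \<open>\<plusminus>1\<close>. Such a tuple moves any vector \<open>x \<noteq> 0\<close> along a polygon
  that closes up to sign; each step fixes the vertex or turns it by an angle in \<open>(-\<pi>, \<pi>)\<close> of
  sign \<open>s\<close>, and the turning angles add up to \<open>\<pi>\<close> times the relative Euler class \<open>n\<close>.

  Conversely, a polygon without fixed vertices determines the transvections along it, and a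
  polygon closed up to sign comes from a representation exactly if one further real number, the
  total shear, vanishes. If all signs agree, start at the eigenvector of the last transvection;
  if two cyclically adjacent signs differ, rotate them to the end and start at an eigenvector of
  the product of the others. In terms of angles and reciprocal lengths, the end of the polygon is
  then determined by the shear condition, and the remaining parameters are constrained
  essentially by the signs, the size and the sum of the angles. Hence they form a connected set,
  and it is nonempty exactly for the expected \<open>n\<close>.

  A configuration is a limit of such generic ones unless all \<open>\<nu>\<close> are positive multiples of one
  number. These parallel configurations have \<open>n = 0\<close> and form a connected set; if one sign occurs
  exactly once they are all there is in Euler class \<open>0\<close>, and otherwise one of them is a limit of
  generic configurations.
\<close>

section \<open>Transvections of the plane\<close>

text \<open>The Euler class is found by shrinking all \<open>\<nu>\<close> to \<open>0\<close>
  together: this path is the product of the canonical lifts, and along it the logarithm of the image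
  of a vector ends at the sum of the turning angles. The obstacle is the shear. With equal signs the
  last transvection must have a positive coefficient. This positivity survives deformation because
  every edge contribution, times the common sign, stays above its chord on the way to unit lengths,
  where it is positive. With mixed signs this argument fails. A cancelling pair at the end avoids
  it: the other transvections then have an eigenvalue of modulus greater than \<open>1\<close>,
  which makes the shear equation solvable for the apex of the pair, and the remaining conditions are
  convex. The pair also explains the bounds. Its two angles cancel, so only \<open>p - 2\<close>
  angles count, and \<open>n\<close> lies strictly between minus the number of negative signs and
  the number of positive signs among them. Both counts are one less than for all generators, which
  gives condition (1). With equal signs \<open>p - 1\<close> angles count, which adds the values
  \<open>n = \<plusminus>1\<close> of condition (3).\<close>

text \<open>The transvection \<open>x + s det(v, x) v\<close> with \<open>v\<^sup>2 = \<nu>\<close>; it depends only on \<open>\<nu>\<close>, not on the choice of the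
  square root \<open>v\<close>.\<close>

definition transv :: "real \<Rightarrow> complex \<Rightarrow> complex \<Rightarrow> complex" where
  "transv s \<nu> x = x + of_real s * ((\<nu> * cnj x - of_real (cmod \<nu>) * x) / (2 * \<i>))"

lemma transv_add: "transv s \<nu> (x + y) = transv s \<nu> x + transv s \<nu> y"
  by (simp add: transv_def field_simps)

lemma transv_scale: "transv s \<nu> (of_real a * x) = of_real a * transv s \<nu> x"
  by (simp add: transv_def field_simps)

lemma Re_transv: "Re (transv s \<nu> x) = Re x + s * (Im \<nu> * Re x - (cmod \<nu> + Re \<nu>) * Im x) / 2"
  by (simp add: transv_def Re_divide algebra_simps add_divide_distrib diff_divide_distrib)

lemma Im_transv: "Im (transv s \<nu> x) = Im x + s * ((cmod \<nu> - Re \<nu>) * Re x - Im \<nu> * Im x) / 2"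
  by (simp add: transv_def Im_divide algebra_simps add_divide_distrib diff_divide_distrib)

lemma cmod_sq: "cmod \<nu> * cmod \<nu> = Re \<nu> * Re \<nu> + Im \<nu> * Im \<nu>"
  using cmod_power2[of \<nu>] by (simp add: power2_eq_square)

lemma transv_inverse [simp]: "transv (- s) \<nu> (transv s \<nu> x) = x"
proof (rule complex_eqI)
  show "Re (transv (- s) \<nu> (transv s \<nu> x)) = Re x"
    using cmod_sq[of \<nu>] by (simp add: Re_transv Im_transv field_simps)
  show "Im (transv (- s) \<nu> (transv s \<nu> x)) = Im x"
    using cmod_sq[of \<nu>] by (simp add: Re_transv Im_transv field_simps)
qed

lemma transv_inverse' [simp]: "transv s \<nu> (transv (- s) \<nu> x) = x"
  using transv_inverse[of "- s" \<nu> x] by simp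

lemma transv_eq_iff: "transv s \<nu> x = y \<longleftrightarrow> x = transv (- s) \<nu> y"
  by (metis transv_inverse transv_inverse')

section \<open>The area form and the sign of a turn\<close>

definition wedge :: "complex \<Rightarrow> complex \<Rightarrow> real" where
  "wedge x y = Re x * Im y - Im x * Re y"

lemma wedge_add_right: "wedge x (y + z) = wedge x y + wedge x z"
  and wedge_add_left: "wedge (y + z) x = wedge y x + wedge z x"
  and wedge_diff_right: "wedge x (y - z) = wedge x y - wedge x z"
  and wedge_diff_left: "wedge (y - z) x = wedge y x - wedge z x"
  and wedge_scale_right: "wedge x (of_real a * y) = a * wedge x y"
  and wedge_scale_left: "wedge (of_real a * x) y = a * wedge x y"
  and wedge_self [simp]: "wedge x x = 0"
  by (simp_all add: wedge_def algebra_simps)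

lemma wedge_commute: "wedge x y = - wedge y x"
  by (simp add: wedge_def)

lemma wedge_eq_Im: "wedge x y = Im (y * cnj x)"
  by (simp add: wedge_def algebra_simps)

lemma wedge_eq_Im_divide: "wedge x y = (cmod x)\<^sup>2 * Im (y / x)"
proof (cases "x = 0")
  case False
  have "wedge x (q * x) = (cmod x)\<^sup>2 * Im q" for q
    by (simp add: wedge_def cmod_sq power2_eq_square algebra_simps)
  from this[of "y / x"] False show ?thesis by simp
qed (simp add: wedge_def)

lemma wedge_transv: "wedge (transv s \<nu> x) (transv s \<nu> y) = wedge x y"
  using cmod_sq[of \<nu>] by (simp add: wedge_def Re_transv Im_transv field_simps)

lemma transv_square: "transv s (w\<^sup>2) x = x + of_real (s * wedge x w) * w"
proof (rule complex_eqI)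
  have "cmod (w\<^sup>2) = Re w * Re w + Im w * Im w"
    by (simp add: norm_mult power2_eq_square cmod_sq)
  then show "Re (transv s (w\<^sup>2) x) = Re (x + of_real (s * wedge x w) * w)"
    and "Im (transv s (w\<^sup>2) x) = Im (x + of_real (s * wedge x w) * w)"
    by (simp_all add: Re_transv Im_transv wedge_def power2_eq_square field_simps)
qed

lemma transv_csqrt: "transv s \<nu> x = x + of_real (s * wedge x (csqrt \<nu>)) * csqrt \<nu>"
  by (metis power2_csqrt transv_square)

text \<open>The square is the reason why a transvection never turns a vector against its
  sign.\<close>

lemma wedge_transv_self: "wedge x (transv s \<nu> x) = s * (wedge x (csqrt \<nu>))\<^sup>2"
  by (simp add: transv_csqrt wedge_add_right wedge_scale_right power2_eq_square del: of_real_mult)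

lemma transv_eq_0 [simp]: "transv s \<nu> x = 0 \<longleftrightarrow> x = 0"
  by (metis add_cancel_right_right transv_add transv_inverse)

lemma transv_fixed_or_turned:
  assumes "s * s = 1"
  shows "transv s \<nu> x = x \<or> s * wedge x (transv s \<nu> x) > 0"
proof (cases "wedge x (csqrt \<nu>) = 0")
  case True
  then show ?thesis by (simp add: transv_csqrt)
next
  case False
  have "s * wedge x (transv s \<nu> x) = (s * s) * (wedge x (csqrt \<nu>))\<^sup>2"
    by (simp add: wedge_transv_self mult.assoc)
  with False assms show ?thesis by simp
qed

lemma transv_fixed_iff:
  assumes "s \<noteq> 0"
  shows "transv s \<nu> x = x \<longleftrightarrow> \<nu> * cnj x = of_real (cmod \<nu>) * x"
  using assms by (simp add: transv_def)

text \<open>The only \<open>\<nu>\<close> whose transvection of sign \<open>s\<close> takes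
  \<open>x\<close> to \<open>y\<close>: the displacement is along a square root of
  \<open>\<nu>\<close>, and the denominator normalises it. It is meaningful when
  \<open>s * wedge x y\<close> is positive.\<close>

definition step :: "real \<Rightarrow> complex \<Rightarrow> complex \<Rightarrow> complex" where
  "step s x y = (y - x)\<^sup>2 / of_real (s * wedge x y)"

lemma transv_step:
  assumes "s * wedge x y > 0" "s * s = 1"
  shows "transv s (step s x y) x = y"
proof -
  define D where "D = s * wedge x y"
  have D: "D > 0" "s * wedge x (y - x) = D"
    using assms by (simp_all add: D_def wedge_diff_right)
  define w where "w = of_real (1 / sqrt D) * (y - x)"
  have "step s x y = w\<^sup>2"
    using D by (simp add: step_def w_def power_divide D_def[symmetric] flip: of_real_power)
  moreover have "s * wedge x w = D / sqrt D"
    unfolding w_def wedge_scale_right using D(2) by (simp add: mult.left_commute)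
  ultimately show ?thesis
    using D(1) by (simp add: transv_square real_div_sqrt) (simp add: w_def)
qed

lemma step_nonzero: "s * wedge x y > 0 \<Longrightarrow> step s x y \<noteq> 0"
  by (auto simp: step_def)

lemma step_transv:
  assumes "transv s \<nu> x \<noteq> x" "s * s = 1"
  shows "step s x (transv s \<nu> x) = \<nu>"
proof -
  define w where "w = csqrt \<nu>"
  have y: "transv s \<nu> x = x + of_real (s * wedge x w) * w"
    by (simp add: transv_csqrt w_def)
  have nz: "wedge x w \<noteq> 0"
    using assms(1) unfolding y by auto
  have "s * wedge x (transv s \<nu> x) = (s * s) * (wedge x w)\<^sup>2"
    by (simp add: wedge_transv_self w_def)
  then have "s * wedge x (transv s \<nu> x) = (wedge x w)\<^sup>2"
    using assms by simp
  moreover have "(transv s \<nu> x - x)\<^sup>2 = of_real ((s * s) * (wedge x w)\<^sup>2) * w\<^sup>2"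
    unfolding y by (simp add: power2_eq_square)
  ultimately have "step s x (transv s \<nu> x) = w\<^sup>2"
    using nz assms unfolding step_def by simp
  then show ?thesis by (simp add: w_def)
qed

text \<open>A real ratio means a vanishing wedge product, hence a fixed vector and ratio
  \<open>1\<close>. So the ratio avoids the cut of \<open>Arg\<close>, and turning angles are
  continuous.\<close>

lemma transv_ratio:
  assumes "s * s = 1" "x \<noteq> 0"
  shows "transv s \<nu> x / x \<notin> \<real>\<^sub>\<le>\<^sub>0"
proof
  assume *: "transv s \<nu> x / x \<in> \<real>\<^sub>\<le>\<^sub>0"
  then have "wedge x (transv s \<nu> x) = 0"
    by (simp add: wedge_eq_Im_divide complex_nonpos_Reals_iff)
  then have "transv s \<nu> x = x"
    using transv_fixed_or_turned[OF assms(1), of \<nu> x] by auto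
  with * assms(2) show False by simp
qed

section \<open>Orbits and their turning angles\<close>

primrec orb :: "(nat \<Rightarrow> real) \<Rightarrow> (nat \<Rightarrow> complex) \<Rightarrow> nat \<Rightarrow> complex \<Rightarrow> complex" where
  "orb s \<nu> 0 x = x"
| "orb s \<nu> (Suc k) x = transv (s k) (\<nu> k) (orb s \<nu> k x)"

lemma orb_add: "orb s \<nu> k (x + y) = orb s \<nu> k x + orb s \<nu> k y"
  by (induction k) (simp_all add: transv_add)

lemma orb_scale: "orb s \<nu> k (of_real a * x) = of_real a * orb s \<nu> k x"
  by (induction k) (simp_all add: transv_scale)

lemma orb_eq_0 [simp]: "orb s \<nu> k x = 0 \<longleftrightarrow> x = 0"
  by (induction k) simp_all

lemma wedge_orb: "wedge (orb s \<nu> k x) (orb s \<nu> k y) = wedge x y"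
  by (induction k) (simp_all add: wedge_transv)

lemma orb_cong: "(\<And>i. i < k \<Longrightarrow> \<nu> i = \<nu>' i) \<Longrightarrow> orb s \<nu> k x = orb s \<nu>' k x"
  by (induction k) simp_all

definition turning :: "nat \<Rightarrow> (nat \<Rightarrow> real) \<Rightarrow> (nat \<Rightarrow> complex) \<Rightarrow> complex \<Rightarrow> real" where
  "turning p s \<nu> x = (\<Sum>k<p. Arg (orb s \<nu> (Suc k) x / orb s \<nu> k x))"

lemma orb_turning:
  assumes "x \<noteq> 0"
  shows "orb s \<nu> p x = of_real (cmod (orb s \<nu> p x) / cmod x) * cis (turning p s \<nu> x) * x"
proof (induction p)
  case (Suc p)
  let ?y = "orb s \<nu> p x" and ?z = "orb s \<nu> (Suc p) x"
  have nz: "?y \<noteq> 0" "?z \<noteq> 0" using assms by (simp_all del: orb.simps)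
  have 1: "?z / ?y = of_real (cmod ?z / cmod ?y) * cis (Arg (?z / ?y))"
    using rcis_cmod_Arg[of "?z / ?y"] unfolding rcis_def norm_divide by simp
  have "?z = (?z / ?y) * ?y" using nz by (simp del: orb.simps)
  also have "\<dots> = (of_real (cmod ?z / cmod ?y) * cis (Arg (?z / ?y))) *
      (of_real (cmod ?y / cmod x) * cis (turning p s \<nu> x) * x)"
    by (rule arg_cong2[of _ _ _ _ "(*)"]) (fact 1, fact Suc.IH)
  also have "\<dots> = of_real (cmod ?z / cmod ?y * (cmod ?y / cmod x)) *
      (cis (turning p s \<nu> x) * cis (Arg (?z / ?y))) * x"
    by (simp only: of_real_mult mult_ac)
  also have "cmod ?z / cmod ?y * (cmod ?y / cmod x) = cmod ?z / cmod x"
    using nz by (simp del: orb.simps)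
  also have "cis (turning p s \<nu> x) * cis (Arg (?z / ?y)) = cis (turning (Suc p) s \<nu> x)"
    by (simp add: cis_mult turning_def del: orb.simps)
  finally show ?case .
qed (use assms in \<open>simp add: turning_def\<close>)

definition sgn_int :: "int \<Rightarrow> real" where
  "sgn_int n = (if even n then 1 else - 1)"

lemma cis_of_int_pi: "cis (of_int n * pi) = of_real (sgn_int n)"
  using cos_npi_int[of n] sin_npi_int[of n] by (simp add: complex_eq_iff sgn_int_def mult.commute)

lemma sgn_int_sq [simp]: "sgn_int n * sgn_int n = 1" "sgn_int n \<noteq> 0"
  by (simp_all add: sgn_int_def)

text \<open>Matrices act from the left, so the orbit runs through the generators backwards: \<open>\<nu> k\<close>
  belongs to the peripheral element \<open>c\<^bsub>p-k\<^esub>\<close>.\<close>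

definition configs :: "nat \<Rightarrow> (nat \<Rightarrow> real) \<Rightarrow> int \<Rightarrow> (nat \<Rightarrow> complex) set" where
  "configs p s n = {\<nu>. (\<forall>k<p. \<nu> k \<noteq> 0) \<and> (\<forall>k\<ge>p. \<nu> k = 0) \<and>
     (\<forall>x. orb s \<nu> p x = of_real (sgn_int n) * x) \<and>
     (\<forall>x. x \<noteq> 0 \<longrightarrow> turning p s \<nu> x = of_int n * pi)}"

section \<open>Continuity and discreteness of the turning\<close>

lemma tendsto_transv:
  assumes "(f \<longlongrightarrow> \<nu>) F" "(g \<longlongrightarrow> x) F"
  shows "((\<lambda>t. transv s (f t) (g t)) \<longlongrightarrow> transv s \<nu> x) F"
  unfolding transv_def by (intro tendsto_intros assms) simp

lemma tendsto_orb:
  assumes "\<And>k. k < p \<Longrightarrow> ((\<lambda>t. f t k) \<longlongrightarrow> \<nu> k) F" "(g \<longlongrightarrow> x) F"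
  shows "((\<lambda>t. orb s (f t) p (g t)) \<longlongrightarrow> orb s \<nu> p x) F"
  using assms by (induction p) (auto intro!: tendsto_transv)

lemma tendsto_turning:
  assumes "\<And>k. k < p \<Longrightarrow> ((\<lambda>t. f t k) \<longlongrightarrow> \<nu> k) F" "(g \<longlongrightarrow> x) F" "x \<noteq> 0"
    and "\<And>k. s k * s k = 1"
  shows "((\<lambda>t. turning p s (f t) (g t)) \<longlongrightarrow> turning p s \<nu> x) F"
  unfolding turning_def
proof (intro tendsto_intros tendsto_orb assms)
  fix k assume "k \<in> {..<p}"
  show "orb s \<nu> k x \<noteq> 0" using assms by simp
  show "orb s \<nu> (Suc k) x / orb s \<nu> k x \<notin> \<real>\<^sub>\<le>\<^sub>0"
    using transv_ratio[OF assms(4)] assms(3) by simp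
qed (use assms in auto)

text \<open>The polar form of the orbit identifies \<open>cis\<close> of the turning with the scalar
  \<open>\<plusminus>1\<close>; the scalar remembers only the parity of the multiple of
  \<open>pi\<close>.\<close>

lemma turning_int:
  assumes "\<And>x. orb s \<nu> p x = of_real (sgn_int n) * x" "x \<noteq> 0"
  obtains m where "turning p s \<nu> x = of_int m * pi" "even m \<longleftrightarrow> even n"
proof -
  have 1: "cis (turning p s \<nu> x) = of_real (sgn_int n)"
  proof -
    have "of_real (sgn_int n) * x = cis (turning p s \<nu> x) * x"
      using orb_turning[OF assms(2), of s \<nu> p] assms(2)
      unfolding assms(1)[of x] by (simp add: norm_mult sgn_int_def)
    with assms(2) show ?thesis by simp
  qed
  then have "sin (turning p s \<nu> x) = 0"
    by (metis cis.sel(2) Im_complex_of_real)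
  then obtain m where m: "turning p s \<nu> x = of_int m * pi"
    using sin_zero_iff_int2 by blast
  with 1 have "sgn_int m = sgn_int n"
    by (simp add: cis_of_int_pi)
  with m that show thesis by (auto simp: sgn_int_def split: if_splits)
qed

text \<open>The turning is continuous on the punctured plane, which is connected, and takes values
  in the discrete set of multiples of \<open>pi\<close>.\<close>

lemma turning_const:
  assumes "\<And>x. orb s \<nu> p x = of_real (sgn_int n) * x" "x \<noteq> 0" "y \<noteq> 0" "\<And>k. s k * s k = 1"
  shows "turning p s \<nu> x = turning p s \<nu> y"
proof -
  have "connected (- {0::complex})"
    by (simp add: connected_punctured_universe)
  moreover have "continuous_on (- {0}) (turning p s \<nu>)"
    unfolding continuous_on_def by (auto intro!: tendsto_turning assms)
  ultimately have "turning p s \<nu> constant_on (- {0})"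
  proof (rule continuous_discrete_range_constant)
    fix x :: complex assume x: "x \<in> - {0}"
    have "pi \<le> norm (turning p s \<nu> y - turning p s \<nu> x)"
      if y: "y \<in> - {0}" "turning p s \<nu> y \<noteq> turning p s \<nu> x" for y
    proof -
      obtain a b where ab: "turning p s \<nu> y = of_int a * pi" "turning p s \<nu> x = of_int b * pi"
        using turning_int[of s \<nu> p n x] turning_int[of s \<nu> p n y] assms(1) x y(1)
        by (metis Compl_iff singletonI)
      with y(2) have "\<bar>a - b\<bar> \<ge> 1" by auto
      then have "pi * 1 \<le> pi * real_of_int \<bar>a - b\<bar>"
        by (intro mult_left_mono) (use of_int_le_iff in fastforce)+
      also have "\<dots> = \<bar>(of_int a - of_int b) * pi\<bar>"
        by (simp add: abs_mult)
      finally show ?thesis using ab by (simp add: left_diff_distrib)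
    qed
    then show "\<exists>e>0. \<forall>y. y \<in> - {0} \<and> turning p s \<nu> y \<noteq> turning p s \<nu> x \<longrightarrow>
        e \<le> norm (turning p s \<nu> y - turning p s \<nu> x)"
      using pi_gt_zero by blast
  qed
  then show ?thesis using assms(2,3) unfolding constant_on_def by fastforce
qed

lemma configsI:
  assumes "\<And>k. k < p \<Longrightarrow> \<nu> k \<noteq> 0" "\<And>k. k \<ge> p \<Longrightarrow> \<nu> k = 0"
    and "\<And>x. orb s \<nu> p x = of_real (sgn_int n) * x"
    and "x \<noteq> 0" "turning p s \<nu> x = of_int n * pi" "\<And>k. s k * s k = 1"
  shows "\<nu> \<in> configs p s n"
proof -
  have "turning p s \<nu> y = of_int n * pi" if "y \<noteq> 0" for y
    using turning_const[OF assms(3,4) that assms(6)] assms(5) by simp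
  then show ?thesis
    unfolding configs_def using assms(1-3) by blast
qed

text \<open>Among tuples that close up with the same sign, configurations are open: nonvanishing is
  an open condition, and the turning is continuous with values in the multiples of
  \<open>pi\<close>, so near a configuration it cannot change. In limit arguments only the closing
  condition has to be arranged.\<close>

lemma configs_eventually:
  assumes "\<nu> \<in> configs p s n" "\<And>k. s k * s k = 1"
    and lim: "\<And>k. k < p \<Longrightarrow> ((\<lambda>t. f t k) \<longlongrightarrow> \<nu> k) F"
    and "eventually (\<lambda>t. (\<forall>k\<ge>p. f t k = 0) \<and> (\<forall>x. orb s (f t) p x = of_real (sgn_int n) * x)) F"
  shows "eventually (\<lambda>t. f t \<in> configs p s n) F"
proof -
  have "((\<lambda>t. turning p s (f t) 1) \<longlongrightarrow> turning p s \<nu> 1) F"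
    using assms(2) lim by (intro tendsto_turning) auto
  then have "eventually (\<lambda>t. dist (turning p s (f t) 1) (of_int n * pi) < pi) F"
    using assms(1) by (intro tendstoD) (auto simp: configs_def)
  moreover have "eventually (\<lambda>t. \<forall>k<p. f t k \<noteq> 0) F"
  proof -
    have "eventually (\<lambda>t. f t k \<noteq> 0) F" if "k < p" for k
      using tendsto_imp_eventually_ne[OF lim[OF that]] assms(1) that by (auto simp: configs_def)
    then have "eventually (\<lambda>t. \<forall>k\<in>{..<p}. f t k \<noteq> 0) F"
      by (intro eventually_ball_finite) auto
    then show ?thesis by (simp add: Ball_def)
  qed
  ultimately show ?thesis using assms(4)
  proof eventually_elim
    case (elim t)
    then have *: "\<And>x. orb s (f t) p x = of_real (sgn_int n) * x" by blast
    obtain m where m: "turning p s (f t) 1 = of_int m * pi"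
      using turning_int[of s "f t" p n 1] * by (metis zero_neq_one)
    have "\<bar>(of_int m - of_int n) * pi\<bar> < 1 * pi"
      using elim(1) unfolding m dist_real_def left_diff_distrib by simp
    then have "\<bar>real_of_int (m - n)\<bar> < 1"
      unfolding abs_mult by simp
    then have "m = n" by linarith
    then show ?case
      using elim m assms(2) by (intro configsI[OF _ _ *, of 1]) (auto simp del: One_nat_def)
  qed
qed

lemma tendsto_in_closure:
  fixes f :: "'a \<Rightarrow> nat \<Rightarrow> complex"
  assumes "\<And>k. ((\<lambda>t. f t k) \<longlongrightarrow> \<nu> k) F" "eventually (\<lambda>t. f t \<in> S) F" "F \<noteq> bot"
  shows "\<nu> \<in> closure S"
proof (rule Lim_in_closed_set[OF closed_closure])
  show "eventually (\<lambda>t. f t \<in> closure S) F"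
    by (rule eventually_mono[OF assms(2)]) (use closure_subset in blast)
  have "limitin (product_topology (\<lambda>_. euclidean) UNIV) f \<nu> F"
    unfolding limitin_componentwise
  proof (intro conjI ballI)
    fix k show "limitin euclidean (\<lambda>c. f c k) (\<nu> k) F"
      unfolding limitin_canonical_iff by (rule assms(1))
  qed auto
  then show "(f \<longlongrightarrow> \<nu>) F"
    unfolding euclidean_product_topology limitin_canonical_iff .
  show "\<not> trivial_limit F" by (rule assms(3))
qed

section \<open>The shear along an orbit\<close>

text \<open>The vector at a right angle to \<open>x\<close> with reciprocal length, so that
  \<open>(x, dual x)\<close> is a basis of determinant \<open>1\<close>.\<close>

definition dual :: "complex \<Rightarrow> complex" where
  "dual x = \<i> / cnj x"

lemma wedge_dual: "x \<noteq> 0 \<Longrightarrow> wedge x (dual x) = 1"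
  by (simp add: dual_def wedge_eq_Im)

lemma dual_scale: "a * a = 1 \<Longrightarrow> dual (of_real a * x) = of_real a * dual x"
  by (simp add: dual_def square_eq_1_iff) (auto simp: square_eq_1_iff)

lemma divide_cnj: "a / cnj x = of_real (1 / (cmod x)\<^sup>2) * (a * x)"
proof (cases "x = 0")
  case False
  then have "of_real (1 / (cmod x)\<^sup>2) * (a * x) * cnj x = a"
    using complex_norm_square[of x] by (simp add: field_simps)
  with False show ?thesis by (metis complex_cnj_zero_iff nonzero_divide_eq_eq)
qed simp

lemma dual_decomposition:
  assumes "x \<noteq> 0"
  shows "u = of_real (wedge x u) * dual x + of_real (Re (u * cnj x) / (cmod x)\<^sup>2) * x"
proof -
  have "u = (u * cnj x) / cnj x"
    using assms by simp
  also have "u * cnj x = of_real (wedge x u) * \<i> + of_real (Re (u * cnj x))"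
    by (simp add: complex_eq_iff wedge_def)
  also have "\<dots> / cnj x = of_real (wedge x u) * dual x + of_real (Re (u * cnj x)) / cnj x"
    by (simp add: dual_def add_divide_distrib)
  also have "of_real (Re (u * cnj x)) / cnj x = of_real (Re (u * cnj x) / (cmod x)\<^sup>2) * x"
    unfolding divide_cnj by (simp only: of_real_mult of_real_divide of_real_1 mult_ac) simp
  finally show ?thesis .
qed

text \<open>In the bases \<open>(x, dual x)\<close> of source and target, a transvection is triangular; \<open>shear\<close> is its
  off-diagonal entry.\<close>

definition shear :: "(nat \<Rightarrow> real) \<Rightarrow> (nat \<Rightarrow> complex) \<Rightarrow> nat \<Rightarrow> complex \<Rightarrow> real" where
  "shear s \<nu> k x = Re (orb s \<nu> k (dual x) * cnj (orb s \<nu> k x)) / (cmod (orb s \<nu> k x))\<^sup>2"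

lemma orb_dual:
  assumes "x \<noteq> 0"
  shows "orb s \<nu> k (dual x) = dual (orb s \<nu> k x) + of_real (shear s \<nu> k x) * orb s \<nu> k x"
  using dual_decomposition[of "orb s \<nu> k x" "orb s \<nu> k (dual x)"] assms
  by (simp add: wedge_orb wedge_dual shear_def)

lemma shear_unique:
  assumes "x \<noteq> 0" "orb s \<nu> k (dual x) = dual (orb s \<nu> k x) + of_real K * orb s \<nu> k x"
  shows "shear s \<nu> k x = K"
  using orb_dual[OF assms(1), of s \<nu> k] assms by simp

text \<open>The product preserves area. If it maps \<open>x\<close> to \<open>\<plusminus>x\<close>,
  both diagonal entries in the basis \<open>(x, dual x)\<close> are this sign, and only the shear is
  left. Closing up thus becomes one equation for a vector and one real equation.\<close>

lemma orb_scalar_iff: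
  assumes "x \<noteq> 0" "a * a = 1"
  shows "(\<forall>u. orb s \<nu> k u = of_real a * u) \<longleftrightarrow> orb s \<nu> k x = of_real a * x \<and> shear s \<nu> k x = 0"
proof
  assume *: "\<forall>u. orb s \<nu> k u = of_real a * u"
  then have "orb s \<nu> k (dual x) = dual (orb s \<nu> k x) + of_real 0 * orb s \<nu> k x"
    using assms by (simp add: dual_scale)
  with * show "orb s \<nu> k x = of_real a * x \<and> shear s \<nu> k x = 0"
    using shear_unique[OF assms(1)] by blast
next
  assume *: "orb s \<nu> k x = of_real a * x \<and> shear s \<nu> k x = 0"
  then have d: "orb s \<nu> k (dual x) = of_real a * dual x"
    using orb_dual[OF assms(1), of s \<nu> k] assms(2) by (simp add: dual_scale)
  show "\<forall>u. orb s \<nu> k u = of_real a * u"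
  proof
    fix u
    obtain b c :: real where u: "u = of_real b * dual x + of_real c * x"
      using dual_decomposition[OF assms(1)] by blast
    show "orb s \<nu> k u = of_real a * u"
      unfolding u orb_add orb_scale using d * by (simp add: algebra_simps)
  qed
qed

text \<open>The shear contributed by the edge from \<open>x\<close> to \<open>y\<close>. With
  reciprocal lengths \<open>a\<close>, \<open>b\<close> and angle \<open>\<alpha>\<close> it is
  \<open>(2ab - (a\<^sup>2 + b\<^sup>2) cos \<alpha>) / sin \<alpha>\<close>.\<close>

definition bend :: "complex \<Rightarrow> complex \<Rightarrow> real" where
  "bend x y = (2 - Re (y * cnj x) * (1 / (cmod x)\<^sup>2 + 1 / (cmod y)\<^sup>2)) / wedge x y"

lemma transv_step_apply:
  assumes "s * wedge x y > 0" "s * s = 1"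
  shows "transv s (step s x y) u = u + of_real (wedge u (y - x) / wedge x y) * (y - x)"
proof -
  define D where "D = s * wedge x y"
  have D: "D > 0" using assms by (simp add: D_def)
  define w where "w = of_real (1 / sqrt D) * (y - x)"
  have "step s x y = w\<^sup>2"
    using D by (simp add: step_def w_def power_divide D_def[symmetric] flip: of_real_power)
  then have "transv s (step s x y) u = u + of_real (s * (1 / sqrt D * wedge u (y - x)) * (1 / sqrt D)) * (y - x)"
    by (simp only: transv_square wedge_scale_right w_def of_real_mult mult.assoc)
  also have "s * (1 / sqrt D * wedge u (y - x)) * (1 / sqrt D) = (s / D) * wedge u (y - x)"
    using D by (simp add: field_simps)
  also have "s / D = 1 / wedge x y"
    using assms(1) by (cases "s = 0") (auto simp: D_def)
  finally show ?thesis by simp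
qed

lemma transv_step_dual:
  assumes "s * wedge x y > 0" "s * s = 1"
  shows "transv s (step s x y) (dual x) = dual y + of_real (bend x y) * y"
proof -
  define u where "u = transv s (step s x y) (dual x)"
  define W P where "W = wedge x y" and "P = Re (y * cnj x)"
  have W: "W \<noteq> 0" using assms by (auto simp: W_def)
  then have nz: "x \<noteq> 0" "y \<noteq> 0" by (auto simp: W_def wedge_def)
  have "wedge y u = wedge x (dual x)"
    unfolding u_def by (subst (1) transv_step[OF assms, symmetric]) (rule wedge_transv)
  then have "u = dual y + of_real (Re (u * cnj y) / (cmod y)\<^sup>2) * y"
    using dual_decomposition[OF nz(2), of u] nz by (simp add: wedge_dual)
  moreover have "Re (u * cnj y) / (cmod y)\<^sup>2 = bend x y"
  proof -
    have dx: "dual x = of_real (1 / (cmod x)\<^sup>2) * (\<i> * x)"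
      unfolding dual_def by (rule divide_cnj)
    \<comment> \<open>Lagrange's identity; it replaces the squares of area and inner product by the
      lengths and makes the final numerator symmetric in both vertices.\<close>
    have WP: "W\<^sup>2 + P\<^sup>2 = (cmod x)\<^sup>2 * (cmod y)\<^sup>2"
      by (simp add: W_def P_def wedge_def cmod_power2) algebra
    have 1: "wedge (dual x) (y - x) = 1 - P / (cmod x)\<^sup>2"
    proof -
      have "wedge (\<i> * x) (y - x) = (cmod x)\<^sup>2 - P"
        by (simp add: P_def wedge_def cmod_sq power2_eq_square algebra_simps)
      then show ?thesis using nz by (simp only: dx wedge_scale_left) (simp add: field_simps)
    qed
    have 2: "Re (dual x * cnj y) = W / (cmod x)\<^sup>2"
    proof -
      have "Re (\<i> * x * cnj y) = W" by (simp add: W_def wedge_def)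
      then show ?thesis by (simp only: dx mult.assoc Re_complex_of_real times_complex.sel) simp
    qed
    have 3: "Re ((y - x) * cnj y) = (cmod y)\<^sup>2 - P"
      by (simp add: P_def cmod_sq power2_eq_square algebra_simps)
    have "u = dual x + of_real ((1 - P / (cmod x)\<^sup>2) / W) * (y - x)"
      using transv_step_apply[OF assms, of "dual x"] 1 by (simp only: u_def W_def)
    then have "Re (u * cnj y) = Re (dual x * cnj y) + ((1 - P / (cmod x)\<^sup>2) / W) * Re ((y - x) * cnj y)"
      by (simp only: distrib_right mult.assoc plus_complex.sel Re_complex_of_real times_complex.sel Im_complex_of_real)
    then have "Re (u * cnj y) = W / (cmod x)\<^sup>2 + ((1 - P / (cmod x)\<^sup>2) / W) * ((cmod y)\<^sup>2 - P)"
      by (simp only: 2 3)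
    also have "\<dots> = ((W\<^sup>2 + P\<^sup>2) / (cmod x)\<^sup>2 + (cmod y)\<^sup>2 - P - P * (cmod y)\<^sup>2 / (cmod x)\<^sup>2) / W"
      using W nz by (simp add: field_simps power2_eq_square)
    also have "\<dots> = (cmod y)\<^sup>2 * bend x y"
      unfolding WP bend_def W_def[symmetric] P_def[symmetric] using W nz by (simp add: field_simps)
    finally show ?thesis using nz by simp
  qed
  ultimately show ?thesis unfolding u_def by metis
qed

lemma shear_Suc_step:
  assumes "x \<noteq> 0" "s k * wedge (orb s \<nu> k x) y > 0" "s k * s k = 1" "\<nu> k = step (s k) (orb s \<nu> k x) y"
  shows "shear s \<nu> (Suc k) x = shear s \<nu> k x + bend (orb s \<nu> k x) y"
proof (rule shear_unique[OF assms(1)])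
  show "orb s \<nu> (Suc k) (dual x) = dual (orb s \<nu> (Suc k) x) +
      of_real (shear s \<nu> k x + bend (orb s \<nu> k x) y) * orb s \<nu> (Suc k) x"
    using transv_step_dual[OF assms(2,3)] transv_step[OF assms(2,3)] assms(4)
    by (simp add: orb_dual[OF assms(1), of s \<nu> k] transv_add transv_scale distrib_right add_ac)
qed

lemma transv_parallel:
  assumes "r \<ge> 0"
  shows "transv s (of_real r * x\<^sup>2) u = u + of_real (s * r * wedge u x) * x"
proof -
  have "of_real r * x\<^sup>2 = (of_real (sqrt r) * x)\<^sup>2"
    using assms by (simp add: power_mult_distrib flip: of_real_power)
  then have "transv s (of_real r * x\<^sup>2) u = u + of_real (s * (sqrt r * wedge u x) * sqrt r) * x"
    by (simp only: transv_square wedge_scale_right of_real_mult mult.assoc)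
  also have "s * (sqrt r * wedge u x) * sqrt r = s * (sqrt r * sqrt r) * wedge u x"
    by (simp only: mult_ac)
  finally show ?thesis using assms by simp
qed

text \<open>A step whose axis is the current vertex does not move it; it only shears, linearly in
  \<open>r\<close>. This is how the last transvection can cancel the shear of the others.\<close>

lemma shear_Suc_parallel:
  assumes "x \<noteq> 0" "r \<ge> 0" "\<nu> k = of_real r * (orb s \<nu> k x)\<^sup>2"
  shows "shear s \<nu> (Suc k) x = shear s \<nu> k x - s k * r"
proof (rule shear_unique[OF assms(1)])
  define y where "y = orb s \<nu> k x"
  have y: "y \<noteq> 0" "wedge (dual y) y = - 1"
    using assms(1) wedge_dual[of y] wedge_commute[of y "dual y"] by (simp_all add: y_def)
  have T: "transv (s k) (\<nu> k) u = u + of_real (s k * r * wedge u y) * y" for u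
    using transv_parallel[OF assms(2)] assms(3) by (simp add: y_def)
  have "orb s \<nu> (Suc k) (dual x) = transv (s k) (\<nu> k) (dual y + of_real (shear s \<nu> k x) * y)"
    by (simp add: orb_dual[OF assms(1), of s \<nu> k] y_def)
  also have "\<dots> = dual y + of_real (shear s \<nu> k x - s k * r) * y"
    unfolding T wedge_add_left wedge_scale_left y(2) by (simp add: algebra_simps)
  finally show "orb s \<nu> (Suc k) (dual x) = dual (orb s \<nu> (Suc k) x) +
      of_real (shear s \<nu> k x - s k * r) * orb s \<nu> (Suc k) x"
    by (simp add: T flip: y_def)
qed

lemma tendsto_shear:
  assumes "\<And>k. k < p \<Longrightarrow> ((\<lambda>t. f t k) \<longlongrightarrow> \<nu> k) F" "x \<noteq> 0"
  shows "((\<lambda>t. shear s (f t) p x) \<longlongrightarrow> shear s \<nu> p x) F"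
  unfolding shear_def using assms by (intro tendsto_intros tendsto_orb) auto

lemma shear_cong: "(\<And>i. i < k \<Longrightarrow> \<nu> i = \<nu>' i) \<Longrightarrow> shear s \<nu> k x = shear s \<nu>' k x"
  using orb_cong[of k \<nu> \<nu>' s] by (simp add: shear_def)

lemma tendsto_step:
  assumes "(f \<longlongrightarrow> x) F" "(g \<longlongrightarrow> y) F" "s * wedge x y \<noteq> 0"
  shows "((\<lambda>t. step s (f t) (g t)) \<longlongrightarrow> step s x y) F"
proof -
  have "((\<lambda>t. wedge (f t) (g t)) \<longlongrightarrow> wedge x y) F"
    unfolding wedge_def by (intro tendsto_intros assms)
  then show ?thesis
    using assms unfolding step_def by (intro tendsto_intros) auto
qed

section \<open>Removing a fixed step by rotating its parameter\<close>

lemma cis_neq_1: "0 < t \<Longrightarrow> t < pi \<Longrightarrow> cis t \<noteq> 1"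
  using sin_gt_zero[of t] by (auto simp: complex_eq_iff)

text \<open>A given vector is fixed only by parameters of one argument, so a small rotation of
  \<open>\<nu>\<close> moves it.\<close>

lemma eventually_rotated_moves:
  assumes "\<nu> \<noteq> 0" "x \<noteq> 0" "s \<noteq> 0" "transv s \<nu> x = x"
  shows "eventually (\<lambda>t. transv s (\<nu> * cis t) x \<noteq> x) (at_right 0)"
proof -
  have "transv s (\<nu> * cis t) x \<noteq> x" if t: "0 < t" "t < pi" for t
  proof
    assume "transv s (\<nu> * cis t) x = x"
    then have "\<nu> * cis t * cnj x = of_real (cmod \<nu>) * x"
      using assms by (simp add: transv_fixed_iff norm_mult)
    also have "\<dots> = \<nu> * cnj x"
      using assms by (simp add: transv_fixed_iff)
    finally show False using assms cis_neq_1[OF t] by simp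
  qed
  then show ?thesis
    by (intro eventually_at_rightI[of 0 pi]) auto
qed

lemma tendsto_rotation: "((\<lambda>t. \<nu> * cis t) \<longlongrightarrow> \<nu>) (at_right 0)"
proof -
  have "((\<lambda>t. \<nu> * cis t) \<longlongrightarrow> \<nu> * cis 0) (at_right 0)"
    by (intro tendsto_intros)
  then show ?thesis by simp
qed

text \<open>Rotating the first parameter sends \<open>x\<close> to a nearby vertex, and the second
  parameter is replaced by the step from there to the old end. The end vertex is unchanged, both
  parameters converge because \<open>step\<close> is continuous, and both steps now move.\<close>

lemma perturb_fixed_first:
  assumes s: "s1 * s1 = 1" "s2 * s2 = 1" and nz: "a \<noteq> 0" "x \<noteq> 0"
    and fixed: "transv s1 a x = x" and moved: "transv s2 b x \<noteq> x"
  shows "\<exists>f g. (f \<longlongrightarrow> a) (at_right 0) \<and> (g \<longlongrightarrow> b) (at_right (0::real)) \<and>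
    eventually (\<lambda>t. transv s2 (g t) (transv s1 (f t) x) = transv s2 b x \<and>
       transv s1 (f t) x \<noteq> x \<and> transv s1 (f t) x \<noteq> transv s2 b x) (at_right 0)"
proof -
  define f where "f t = a * cis t" for t
  define w where "w t = transv s1 (f t) x" for t
  define z where "z = transv s2 b x"
  define g where "g t = step s2 (w t) z" for t
  have f: "(f \<longlongrightarrow> a) (at_right 0)"
    unfolding f_def by (rule tendsto_rotation)
  then have w: "(w \<longlongrightarrow> x) (at_right 0)"
    using tendsto_transv[OF f, of "\<lambda>_. x" x s1] fixed by (simp add: w_def[abs_def])
  have pos: "s2 * wedge x z > 0"
    using transv_fixed_or_turned[OF s(2), of b x] moved by (auto simp: z_def)
  have "((\<lambda>t. s2 * wedge (w t) z) \<longlongrightarrow> s2 * wedge x z) (at_right 0)"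
    unfolding wedge_def by (intro tendsto_intros w)
  then have ev: "eventually (\<lambda>t. s2 * wedge (w t) z > 0) (at_right 0)"
    using pos by (rule order_tendstoD)
  have "(g \<longlongrightarrow> step s2 x z) (at_right 0)"
    unfolding g_def by (rule tendsto_step) (use w pos in auto)
  then have g: "(g \<longlongrightarrow> b) (at_right 0)"
    using step_transv[OF moved s(2)] by (simp add: z_def)
  have "eventually (\<lambda>t. w t \<noteq> x) (at_right 0)"
    using eventually_rotated_moves[OF nz _ fixed] s(1) unfolding w_def f_def by fastforce
  with ev have "eventually (\<lambda>t. transv s2 (g t) (w t) = z \<and> w t \<noteq> x \<and> w t \<noteq> z) (at_right 0)"
    by eventually_elim (auto simp: g_def transv_step[OF _ s(2)])
  then show ?thesis
    using f g unfolding w_def z_def by blast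
qed

text \<open>Time reversal of \<open>perturb_fixed_first\<close>: the inverse transvections have the
  opposite signs and run through the orbit backwards.\<close>

lemma perturb_fixed_second:
  assumes s: "s1 * s1 = 1" "s2 * s2 = 1" and nz: "b \<noteq> 0" "x \<noteq> 0"
    and moved: "transv s1 a x = z" "z \<noteq> x" and fixed: "transv s2 b z = z"
  shows "\<exists>f g. (f \<longlongrightarrow> a) (at_right 0) \<and> (g \<longlongrightarrow> b) (at_right (0::real)) \<and>
    eventually (\<lambda>t. transv s2 (g t) (transv s1 (f t) x) = z \<and>
       transv s1 (f t) x \<noteq> x \<and> transv s1 (f t) x \<noteq> z) (at_right 0)"
proof -
  have *: "(- s1) * (- s1) = 1" "(- s2) * (- s2) = 1" using s by simp_all
  have "z \<noteq> 0" using moved nz by auto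
  moreover have "transv (- s2) b z = z" "transv (- s1) a z = x"
    using fixed moved by (metis transv_inverse)+
  ultimately have "\<exists>g f. (g \<longlongrightarrow> b) (at_right 0) \<and> (f \<longlongrightarrow> a) (at_right (0::real)) \<and>
    eventually (\<lambda>t. transv (- s1) (f t) (transv (- s2) (g t) z) = x \<and>
       transv (- s2) (g t) z \<noteq> z \<and> transv (- s2) (g t) z \<noteq> x) (at_right 0)"
    using perturb_fixed_first[OF *(2,1) nz(1), of z a] moved(2) by simp
  then obtain g f where gf: "(g \<longlongrightarrow> b) (at_right 0)" "(f \<longlongrightarrow> a) (at_right (0::real))"
    and ev: "eventually (\<lambda>t. transv (- s1) (f t) (transv (- s2) (g t) z) = x \<and>
       transv (- s2) (g t) z \<noteq> z \<and> transv (- s2) (g t) z \<noteq> x) (at_right 0)"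
    by blast
  have "eventually (\<lambda>t. transv s2 (g t) (transv s1 (f t) x) = z \<and>
       transv s1 (f t) x \<noteq> x \<and> transv s1 (f t) x \<noteq> z) (at_right 0)"
    using ev by eventually_elim (metis transv_inverse')
  with gf show ?thesis by blast
qed

section \<open>Density of orbits without fixed steps\<close>

definition fixed_steps :: "(nat \<Rightarrow> real) \<Rightarrow> (nat \<Rightarrow> complex) \<Rightarrow> nat \<Rightarrow> complex \<Rightarrow> nat set" where
  "fixed_steps s \<nu> N x = {k. k < N \<and> orb s \<nu> (Suc k) x = orb s \<nu> k x}"

text \<open>Competitors to the first \<open>N\<close> entries of \<open>\<nu>\<close>: the end
  vertex is the same and all steps move. The entries from \<open>N\<close> on are kept, to be
  adjusted later.\<close>

definition generic_heads ::
  "(nat \<Rightarrow> real) \<Rightarrow> nat \<Rightarrow> complex \<Rightarrow> (nat \<Rightarrow> complex) \<Rightarrow> (nat \<Rightarrow> complex) set" where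
  "generic_heads s N x \<nu> = {\<nu>'. (\<forall>k\<ge>N. \<nu>' k = \<nu> k) \<and> (\<forall>k<N. \<nu>' k \<noteq> 0) \<and>
     orb s \<nu>' N x = orb s \<nu> N x \<and> fixed_steps s \<nu>' N x = {}}"

lemma adjacent_change:
  fixes N i j :: nat
  assumes "i < N" "j < N" "P i" "\<not> P j"
  obtains k where "Suc k < N" "P k \<noteq> P (Suc k)"
proof (rule ccontr)
  assume "\<not> thesis"
  then have *: "P k = P (Suc k)" if "Suc k < N" for k
    using that \<open>\<not> thesis\<close> \<open>\<And>k. \<lbrakk>Suc k < N; P k \<noteq> P (Suc k)\<rbrakk> \<Longrightarrow> thesis\<close> by blast
  have "P k = P 0" if "k < N" for k
    using that by (induction k) (use * in auto)
  with assms show False by blast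
qed

lemma orb_update2:
  assumes "transv (s (Suc k)) b (transv (s k) a (orb s \<nu> k x)) = orb s \<nu> (Suc (Suc k)) x"
  defines "\<nu>' \<equiv> \<nu>(k := a, Suc k := b)"
  shows "j \<le> k \<Longrightarrow> orb s \<nu>' j x = orb s \<nu> j x"
    and "orb s \<nu>' (Suc k) x = transv (s k) a (orb s \<nu> k x)"
    and "j \<ge> Suc (Suc k) \<Longrightarrow> orb s \<nu>' j x = orb s \<nu> j x"
proof -
  show 1: "j \<le> k \<Longrightarrow> orb s \<nu>' j x = orb s \<nu> j x" for j
    by (rule orb_cong) (auto simp: \<nu>'_def)
  show 2: "orb s \<nu>' (Suc k) x = transv (s k) a (orb s \<nu> k x)"
    using 1[of k] by (simp add: \<nu>'_def)
  have 3: "orb s \<nu>' (Suc (Suc k)) x = orb s \<nu> (Suc (Suc k)) x"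
    using 2 assms(1) by (simp add: \<nu>'_def)
  show "j \<ge> Suc (Suc k) \<Longrightarrow> orb s \<nu>' j x = orb s \<nu> j x"
  proof (induction j rule: dec_induct)
    case base
    show ?case by (rule 3)
  next
    case (step j)
    then show ?case by (simp add: \<nu>'_def)
  qed
qed

text \<open>Induction on the number of fixed steps. Unless all steps are fixed, some fixed step is
  adjacent to a moving one; perturbing these two makes both move and leaves all other vertices in
  place.\<close>

lemma head_dense:
  assumes s: "\<And>k. s k * s k = 1" and "x \<noteq> 0" "\<And>k. k < N \<Longrightarrow> \<nu> k \<noteq> 0"
    and "fixed_steps s \<nu> N x \<noteq> {..<N} \<or> N = 0"
  shows "\<nu> \<in> closure (generic_heads s N x \<nu>)"
  using assms(3,4)
proof (induction "card (fixed_steps s \<nu> N x)" arbitrary: \<nu> rule: less_induct)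
  case less
  define J where "J = fixed_steps s \<nu> N x"
  have J: "J \<subseteq> {..<N}" "finite J"
    by (auto simp: J_def fixed_steps_def intro: finite_subset[of _ "{..<N}"])
  show ?case
  proof (cases "J = {}")
    case True
    then have "\<nu> \<in> generic_heads s N x \<nu>"
      using less by (auto simp: generic_heads_def J_def)
    then show ?thesis using closure_subset by blast
  next
    case False
    then obtain i where i: "i \<in> J" "i < N" using J by auto
    then have "J \<noteq> {..<N}" using less by (auto simp: J_def)
    then obtain j where j: "j < N" "j \<notin> J" using J by auto
    obtain k where k: "Suc k < N" "(k \<in> J) \<noteq> (Suc k \<in> J)"
      using adjacent_change[of i N j "\<lambda>k. k \<in> J"] i j by auto
    define y where "y = orb s \<nu> k x"
    have y: "y \<noteq> 0" using assms(2) by (simp add: y_def)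
    have nz: "\<nu> k \<noteq> 0" "\<nu> (Suc k) \<noteq> 0" using k less by auto
    define z where "z = orb s \<nu> (Suc (Suc k)) x"
    have "\<exists>f g. (f \<longlongrightarrow> \<nu> k) (at_right 0) \<and> (g \<longlongrightarrow> \<nu> (Suc k)) (at_right (0::real)) \<and>
      eventually (\<lambda>t. transv (s (Suc k)) (g t) (transv (s k) (f t) y) = z \<and>
       transv (s k) (f t) y \<noteq> y \<and> transv (s k) (f t) y \<noteq> z) (at_right 0)"
    proof (cases "k \<in> J")
      case True
      then have "transv (s k) (\<nu> k) y = y" "transv (s (Suc k)) (\<nu> (Suc k)) y \<noteq> y" "z = transv (s (Suc k)) (\<nu> (Suc k)) y"
        using k by (auto simp: J_def fixed_steps_def y_def z_def)
      then show ?thesis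
        using perturb_fixed_first[OF s[of k] s[of "Suc k"] nz(1) y, of "\<nu> (Suc k)"] by simp
    next
      case False
      then have "transv (s k) (\<nu> k) y = z" "z \<noteq> y" "transv (s (Suc k)) (\<nu> (Suc k)) z = z"
        using k by (auto simp: J_def fixed_steps_def y_def z_def)
      then show ?thesis
        using perturb_fixed_second[OF s[of k] s[of "Suc k"] nz(2) y, of "\<nu> k" z] by simp
    qed
    then obtain f g where f: "(f \<longlongrightarrow> \<nu> k) (at_right 0)" and g: "(g \<longlongrightarrow> \<nu> (Suc k)) (at_right (0::real))"
      and ev: "eventually (\<lambda>t. transv (s (Suc k)) (g t) (transv (s k) (f t) y) = z \<and>
       transv (s k) (f t) y \<noteq> y \<and> transv (s k) (f t) y \<noteq> z) (at_right 0)"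
      by blast
    define \<mu> where "\<mu> t = \<nu>(k := f t, Suc k := g t)" for t
    have lim: "((\<lambda>t. \<mu> t l) \<longlongrightarrow> \<nu> l) (at_right 0)" for l
      using f g by (cases "l = Suc k"; cases "l = k") (simp_all add: \<mu>_def)
    have "eventually (\<lambda>t. \<mu> t k \<noteq> 0 \<and> \<mu> t (Suc k) \<noteq> 0) (at_right 0)"
      using tendsto_imp_eventually_ne[OF lim nz(1)] tendsto_imp_eventually_ne[OF lim nz(2)]
      by (rule eventually_conj)
    with ev have "eventually (\<lambda>t. \<mu> t \<in> closure (generic_heads s N x \<nu>)) (at_right 0)"
    proof eventually_elim
      case (elim t)
      note o = orb_update2[of s k "g t" "f t" \<nu> x, folded y_def z_def, OF conjunct1[OF elim(1)], folded \<mu>_def]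
      have sub: "fixed_steps s (\<mu> t) N x \<subseteq> J - {k, Suc k}"
      proof
        fix l assume "l \<in> fixed_steps s (\<mu> t) N x"
        then have l: "l < N" "orb s (\<mu> t) (Suc l) x = orb s (\<mu> t) l x"
          by (auto simp: fixed_steps_def)
        consider "l < k" | "l = k" | "l = Suc k" | "l > Suc k" by linarith
        then show "l \<in> J - {k, Suc k}"
        proof cases
          case 1 then show ?thesis using l o(1)[of l] o(1)[of "Suc l"] by (auto simp: J_def fixed_steps_def)
        next
          case 2 then show ?thesis using l o(1)[of k] o(2) elim(1) by (simp add: y_def)
        next
          case 3 then show ?thesis using l o(2) o(3)[of "Suc (Suc k)"] elim(1) by (simp add: z_def)
        next
          case 4 then show ?thesis using l o(3)[of l] o(3)[of "Suc l"] by (auto simp: J_def fixed_steps_def)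
        qed
      qed
      have "fixed_steps s (\<mu> t) N x \<subset> J" using sub k by blast
      then have "card (fixed_steps s (\<mu> t) N x) < card J"
        using J by (intro psubset_card_mono)
      moreover have "fixed_steps s (\<mu> t) N x \<noteq> {..<N}" using sub k(1) by auto
      moreover have "\<And>k. k < N \<Longrightarrow> \<mu> t k \<noteq> 0"
        using less elim(2) by (auto simp: \<mu>_def)
      ultimately have "\<mu> t \<in> closure (generic_heads s N x (\<mu> t))"
        using less(1) J_def by blast
      \<comment> \<open>The perturbed tuple has the same end vertex and the same later entries, so
        its competitors are those of \<open>\<nu>\<close>; a closure of a closure then gives nothing
        new.\<close>
      moreover have "generic_heads s N x (\<mu> t) = generic_heads s N x \<nu>"
        using o(3)[of N] k(1) by (auto simp: generic_heads_def \<mu>_def)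
      ultimately show ?case by simp
    qed
    then have "\<nu> \<in> closure (closure (generic_heads s N x \<nu>))"
      by (rule tendsto_in_closure[OF lim]) simp
    then show ?thesis by simp
  qed
qed

section \<open>Completing approximate heads to configurations\<close>

lemma tendsto_coordinate: "((\<lambda>\<mu>. \<mu> k) \<longlongrightarrow> \<nu> k) (inf (nhds \<nu>) (principal S))" for \<nu> :: "nat \<Rightarrow> complex"
proof -
  have "((\<lambda>\<mu>. \<mu> k) \<longlongrightarrow> \<nu> k) (nhds \<nu>)"
  proof (rule topological_tendstoI)
    fix U :: "complex set" assume U: "open U" "\<nu> k \<in> U"
    have "open ((\<lambda>\<mu>::nat \<Rightarrow> complex. \<mu> k) -` U)"
      by (rule open_vimage[OF U(1) continuous_on_product_coordinates])
    then show "eventually (\<lambda>\<mu>. \<mu> k \<in> U) (nhds \<nu>)"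
      using U unfolding eventually_nhds by blast
  qed
  then show ?thesis by (rule tendsto_mono[rotated]) simp
qed

lemma nhds_within_closure_nontrivial:
  assumes "\<nu> \<in> closure S"
  shows "inf (nhds \<nu>) (principal S) \<noteq> bot"
proof
  assume "inf (nhds \<nu>) (principal S) = bot"
  then have "eventually (\<lambda>\<mu>. \<mu> \<notin> S) (nhds \<nu>)"
    by (metis (mono_tags, lifting) eventually_bot eventually_inf_principal eventually_mono)
  then obtain U where "open U" "\<nu> \<in> U" "\<And>\<mu>. \<mu> \<in> U \<Longrightarrow> \<mu> \<notin> S"
    unfolding eventually_nhds by blast
  then show False
    using assms open_Int_closure_eq_empty[of U S] by blast
qed

text \<open>Heads are approximated freely; \<open>\<tau>\<close> completes an approximating head to a configuration.\<close>

lemma closure_by_completion: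
  fixes \<tau> :: "(nat \<Rightarrow> complex) \<Rightarrow> nat \<Rightarrow> complex"
  assumes "\<nu> \<in> configs p s n" "\<And>k. s k * s k = 1" "\<nu> \<in> closure S"
  defines "F \<equiv> inf (nhds \<nu>) (principal S)"
  assumes lim: "\<And>k. ((\<lambda>\<mu>. \<tau> \<mu> k) \<longlongrightarrow> \<nu> k) F"
    and ev: "eventually (\<lambda>\<mu>. (\<forall>k\<ge>p. \<tau> \<mu> k = 0) \<and> (\<forall>x. orb s (\<tau> \<mu>) p x = of_real (sgn_int n) * x) \<and> G (\<tau> \<mu>)) F"
  shows "\<nu> \<in> closure {\<mu> \<in> configs p s n. G \<mu>}"
proof (rule tendsto_in_closure[OF lim])
  have "eventually (\<lambda>\<mu>. (\<forall>k\<ge>p. \<tau> \<mu> k = 0) \<and> (\<forall>x. orb s (\<tau> \<mu>) p x = of_real (sgn_int n) * x)) F"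
    using ev by eventually_elim simp
  then have "eventually (\<lambda>\<mu>. \<tau> \<mu> \<in> configs p s n) F"
    using configs_eventually[OF assms(1,2) lim] by simp
  with ev show "eventually (\<lambda>\<mu>. \<tau> \<mu> \<in> {\<mu> \<in> configs p s n. G \<mu>}) F"
    by eventually_elim simp
  show "F \<noteq> bot"
    unfolding F_def by (rule nhds_within_closure_nontrivial) fact
qed

lemma eventually_within: "eventually (\<lambda>\<mu>. \<mu> \<in> S) (inf (nhds \<nu>) (principal S))"
  by (simp add: eventually_inf_principal)

text \<open>Since \<open>\<nu> N\<close> is a positive multiple of \<open>x\<^sup>2\<close>, the
  vector \<open>x\<close> spans the axis of transvection \<open>N\<close>; the orbit is started
  there.\<close>

definition generic1 :: "(nat \<Rightarrow> real) \<Rightarrow> nat \<Rightarrow> (nat \<Rightarrow> complex) \<Rightarrow> bool" where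
  "generic1 s N \<nu> \<longleftrightarrow> (\<exists>x r. x \<noteq> 0 \<and> r > 0 \<and> \<nu> N = of_real r * x\<^sup>2 \<and> fixed_steps s \<nu> N x = {})"

lemma configs_orb: "\<nu> \<in> configs p s n \<Longrightarrow> orb s \<nu> p x = of_real (sgn_int n) * x"
  by (simp add: configs_def)

lemma configs_nz: "\<nu> \<in> configs p s n \<Longrightarrow> k < p \<Longrightarrow> \<nu> k \<noteq> 0"
  by (simp add: configs_def)

text \<open>The last transvection fixes \<open>\<plusminus>x\<close>, so the others already close up
  on \<open>x\<close>, and the total shear vanishes for just one value of \<open>r\<close>. The last
  entry is therefore a function of the preceding ones and of \<open>x\<close>.\<close>

lemma parallel_tail:
  assumes "\<nu> \<in> configs (Suc N) s n" "x \<noteq> 0" "r > 0" "\<nu> N = of_real r * x\<^sup>2" "s N * s N = 1"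
  shows "orb s \<nu> N x = of_real (sgn_int n) * x" and "r = s N * shear s \<nu> N x"
proof -
  let ?e = "sgn_int n"
  have "transv (s N) (\<nu> N) (of_real ?e * x) = of_real ?e * x"
    using transv_parallel[of r "s N" x "of_real ?e * x"] assms by (simp add: wedge_scale_left)
  moreover have "transv (s N) (\<nu> N) (orb s \<nu> N x) = of_real ?e * x"
    using configs_orb[OF assms(1), of x] by simp
  ultimately show o: "orb s \<nu> N x = of_real ?e * x"
    by (metis transv_inverse)
  have "(orb s \<nu> N x)\<^sup>2 = x\<^sup>2"
    unfolding o by (simp add: power_mult_distrib power2_eq_square[of "of_real ?e"] flip: of_real_mult)
  then have "shear s \<nu> (Suc N) x = shear s \<nu> N x - s N * r"
    using assms by (intro shear_Suc_parallel) auto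
  moreover have "shear s \<nu> (Suc N) x = 0"
    using orb_scalar_iff[OF assms(2), of ?e s \<nu> "Suc N"] configs_orb[OF assms(1)] by auto
  ultimately have "s N * shear s \<nu> N x = (s N * s N) * r" by simp
  then show "r = s N * shear s \<nu> N x" using assms(5) by simp
qed

lemma parallel_tail_closes:
  assumes "orb s \<nu> N x = of_real (sgn_int n) * x" "x \<noteq> 0" "s N * s N = 1"
    and "s N * shear s \<nu> N x > 0" "\<nu> N = of_real (s N * shear s \<nu> N x) * x\<^sup>2"
  shows "orb s \<nu> (Suc N) u = of_real (sgn_int n) * u"
proof -
  let ?e = "sgn_int n" and ?r = "s N * shear s \<nu> N x"
  have "transv (s N) (\<nu> N) (of_real ?e * x) = of_real ?e * x"
    using transv_parallel[of ?r "s N" x "of_real ?e * x"] assms by (simp add: wedge_scale_left del: of_real_mult)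
  then have 1: "orb s \<nu> (Suc N) x = of_real ?e * x"
    using assms(1) by simp
  have "(orb s \<nu> N x)\<^sup>2 = x\<^sup>2"
    unfolding assms(1) by (simp add: power_mult_distrib power2_eq_square[of "of_real ?e"] flip: of_real_mult)
  then have "shear s \<nu> (Suc N) x = shear s \<nu> N x - s N * ?r"
    using assms by (intro shear_Suc_parallel) auto
  then have "shear s \<nu> (Suc N) x = (1 - s N * s N) * shear s \<nu> N x"
    by (simp add: algebra_simps)
  then show ?thesis
    using orb_scalar_iff[OF assms(2), of ?e s \<nu> "Suc N"] 1 assms(3) by auto
qed

text \<open>Approximate the head with its end vertex kept, then reset the last entry to the value
  forced by the new shear. Its coefficient is positive in the limit, hence eventually.\<close>

lemma generic1_dense:
  assumes \<nu>: "\<nu> \<in> configs (Suc N) s n" and s: "\<And>k. s k * s k = 1"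
    and x: "x = csqrt (\<nu> N)" and moved: "fixed_steps s \<nu> N x \<noteq> {..<N}"
  shows "\<nu> \<in> closure {\<mu> \<in> configs (Suc N) s n. generic1 s N \<mu>}"
proof (rule closure_by_completion[where S = "generic_heads s N x \<nu>"
    and \<tau> = "\<lambda>\<mu>. \<mu>(N := of_real (s N * shear s \<mu> N x) * x\<^sup>2)"])
  let ?F = "inf (nhds \<nu>) (principal (generic_heads s N x \<nu>))"
  have x0: "x \<noteq> 0" "\<nu> N = of_real 1 * x\<^sup>2"
    using configs_nz[OF \<nu>, of N] by (simp_all add: x)
  note pt = parallel_tail[OF \<nu> x0(1) _ x0(2) s, simplified]
  show "\<nu> \<in> closure (generic_heads s N x \<nu>)"
    using s x0 configs_nz[OF \<nu>] moved by (intro head_dense) auto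
  have shear: "((\<lambda>\<mu>. shear s \<mu> N x) \<longlongrightarrow> shear s \<nu> N x) ?F"
    by (intro tendsto_shear tendsto_coordinate x0)
  show "((\<lambda>\<mu>. (\<mu>(N := of_real (s N * shear s \<mu> N x) * x\<^sup>2)) k) \<longlongrightarrow> \<nu> k) ?F" for k
  proof (cases "k = N")
    case True
    have "((\<lambda>\<mu>. of_real (s N * shear s \<mu> N x) * x\<^sup>2) \<longlongrightarrow> of_real (s N * shear s \<nu> N x) * x\<^sup>2) ?F"
      by (intro tendsto_intros shear)
    then show ?thesis using True pt(2) x0 by (simp del: of_real_mult)
  qed (simp add: tendsto_coordinate)
  have "((\<lambda>\<mu>. s N * shear s \<mu> N x) \<longlongrightarrow> s N * shear s \<nu> N x) ?F"
    by (intro tendsto_intros shear)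
  then have "eventually (\<lambda>\<mu>. s N * shear s \<mu> N x > 0) ?F"
    using pt(2) by (intro order_tendstoD) auto
  with eventually_within show "eventually (\<lambda>\<mu>. (\<forall>k\<ge>Suc N. (\<mu>(N := of_real (s N * shear s \<mu> N x) * x\<^sup>2)) k = 0) \<and>
      (\<forall>u. orb s (\<mu>(N := of_real (s N * shear s \<mu> N x) * x\<^sup>2)) (Suc N) u = of_real (sgn_int n) * u) \<and>
      generic1 s N (\<mu>(N := of_real (s N * shear s \<mu> N x) * x\<^sup>2))) ?F"
  proof eventually_elim
    case (elim \<mu>)
    define \<mu>' where "\<mu>' = \<mu>(N := of_real (s N * shear s \<mu> N x) * x\<^sup>2)"
    have same: "orb s \<mu>' k u = orb s \<mu> k u" if "k \<le> N" for k u
      using that by (intro orb_cong) (auto simp: \<mu>'_def)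
    have sh: "shear s \<mu>' N x = shear s \<mu> N x"
      by (intro shear_cong) (auto simp: \<mu>'_def)
    have "orb s \<mu>' N x = of_real (sgn_int n) * x"
      using elim pt(1) same by (simp add: generic_heads_def)
    then have "orb s \<mu>' (Suc N) u = of_real (sgn_int n) * u" for u
      by (rule parallel_tail_closes) (use x0 s elim in \<open>simp_all add: sh, simp add: \<mu>'_def\<close>)
    moreover have "\<mu>' k = 0" if "k \<ge> Suc N" for k
      using elim that \<nu> by (simp add: \<mu>'_def generic_heads_def configs_def)
    moreover have "fixed_steps s \<mu>' N x = fixed_steps s \<mu> N x"
      using same by (auto simp: fixed_steps_def simp del: orb.simps)
    then have "generic1 s N \<mu>'"
      using elim x0 unfolding generic1_def
      by (intro exI[of _ x] exI[of _ "s N * shear s \<mu> N x"]) (auto simp: generic_heads_def \<mu>'_def)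
    ultimately show ?case unfolding \<mu>'_def by blast
  qed
qed (use \<nu> s in auto)

text \<open>The two transvections after the head must undo a genuine dilation. The strict inequality
  \<open>l > 1\<close> keeps both of them from fixing a vertex and makes the shear equation for the
  apex between them solvable.\<close>

definition generic2 :: "(nat \<Rightarrow> real) \<Rightarrow> nat \<Rightarrow> int \<Rightarrow> (nat \<Rightarrow> complex) \<Rightarrow> bool" where
  "generic2 s N n \<nu> \<longleftrightarrow> (\<exists>x l. x \<noteq> 0 \<and> l > 1 \<and> orb s \<nu> N x = of_real (sgn_int n * l) * x \<and>
     fixed_steps s \<nu> N x = {})"

section \<open>Eigenvectors of a cancelling pair and completion by it\<close>

lemma wedge_zero_parallel:
  assumes "wedge x y = 0" "x \<noteq> 0"
  obtains c where "y = of_real c * x"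
proof -
  have "y = of_real (Re (y * cnj x) / (cmod x)\<^sup>2) * x"
    using dual_decomposition[OF assms(2), of y] unfolding assms(1) by simp
  then show thesis by (rule that)
qed

lemma transv_fixed_wedge:
  assumes "s * s = 1"
  shows "transv s \<nu> x = x \<longleftrightarrow> wedge x (transv s \<nu> x) = 0"
  using transv_fixed_or_turned[OF assms, of \<nu> x] by auto

lemma transv_fixed_scale: "c \<noteq> 0 \<Longrightarrow> transv s \<nu> (of_real c * x) = of_real c * x \<longleftrightarrow> transv s \<nu> x = x"
  by (simp add: transv_scale)

lemma transv_fixed_unique:
  assumes "s \<noteq> 0" "\<nu> \<noteq> 0" "transv s \<nu> x = x" "transv s \<nu> y = y" "x \<noteq> 0"
  obtains c where "y = of_real c * x"
proof -
  have w: "csqrt \<nu> \<noteq> 0" using assms by simp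
  then have "wedge x (csqrt \<nu>) = 0" "wedge y (csqrt \<nu>) = 0"
    using assms by (simp_all add: transv_csqrt)
  then have "wedge (csqrt \<nu>) x = 0" "wedge (csqrt \<nu>) y = 0"
    using wedge_commute by (metis neg_equal_0_iff_equal)+
  then obtain a b where ab: "x = of_real a * csqrt \<nu>" "y = of_real b * csqrt \<nu>"
    using w by (meson wedge_zero_parallel)
  then have "y = of_real (b / a) * x" using assms(5) by auto
  then show thesis by (rule that)
qed

text \<open>Eigenvectors are the zeros of the quadratic form
  \<open>\<sigma> * wedge u (H u)\<close>, where \<open>H\<close> is the product. It is nonpositive
  at a vector fixed by the first factor, and nonnegative at a vector which the first factor sends to
  one fixed by the second. The intermediate value theorem gives a zero in between.\<close>

lemma pair_eigenvector:
  assumes s: "\<sigma> * \<sigma> = 1" and nz: "a \<noteq> 0" "b \<noteq> 0"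
    and x0: "x0 \<noteq> 0" "transv (- \<sigma>) b x0 = x0" "transv \<sigma> a x0 \<noteq> x0"
  shows "\<exists>x \<mu>. x \<noteq> 0 \<and> \<mu> > 0 \<and> \<mu> \<noteq> 1 \<and> transv (- \<sigma>) b (transv \<sigma> a x) = of_real \<mu> * x"
proof -
  have s': "(- \<sigma>) * (- \<sigma>) = 1" using s by simp
  have snz: "\<sigma> \<noteq> 0" using s by auto
  define H where "H u = transv (- \<sigma>) b (transv \<sigma> a u)" for u
  define v0 where "v0 = csqrt a"
  have v0: "v0 \<noteq> 0" "transv \<sigma> a v0 = v0"
    using nz by (simp_all add: v0_def transv_csqrt)
  define u0 where "u0 = transv (- \<sigma>) a x0"
  have u0: "transv \<sigma> a u0 = x0" "u0 \<noteq> x0" "H u0 = x0"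
    using x0 by (auto simp: u0_def H_def) (metis transv_inverse')
  have not_both: "\<not> (transv (- \<sigma>) b u = u \<and> transv \<sigma> a u = u)" if "u \<noteq> 0" for u
  proof
    assume u: "transv (- \<sigma>) b u = u \<and> transv \<sigma> a u = u"
    then obtain c where c: "u = of_real c * x0"
      using transv_fixed_unique[of "- \<sigma>" b x0 u] snz nz x0 by auto
    with that have "c \<noteq> 0" by auto
    then show False using u c transv_fixed_scale[of c \<sigma> a x0] x0 by metis
  qed
  define Q where "Q t = \<sigma> * wedge (of_real (1 - t) * v0 + of_real t * u0) (H (of_real (1 - t) * v0 + of_real t * u0))" for t :: real
  have Q0: "Q 0 \<le> 0"
    using transv_fixed_or_turned[OF s', of b v0] v0 by (auto simp: Q_def H_def)
  have Q1: "Q 1 \<ge> 0"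
    using transv_fixed_or_turned[OF s, of a u0] u0 by (auto simp: Q_def)
  have "continuous_on {0..1} Q"
    unfolding Q_def wedge_def H_def transv_def by (intro continuous_intros) auto
  then obtain t where t: "0 \<le> t" "t \<le> 1" "Q t = 0"
    using IVT'[of Q 0 0 1] Q0 Q1 by auto
  define x where "x = of_real (1 - t) * v0 + of_real t * u0"
  \<comment> \<open>The segment avoids the origin: the first factor fixes \<open>v0\<close> and
    sends \<open>u0\<close> to \<open>x0\<close>, so a zero would force \<open>u0 = x0\<close> or
    \<open>v0 = 0\<close>.\<close>
  have x: "x \<noteq> 0"
  proof
    assume x: "x = 0"
    then have "transv \<sigma> a x = 0" by simp
    then have "of_real (1 - t) * v0 + of_real t * x0 = 0"
      unfolding x_def transv_add transv_scale using v0 u0 by simp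
    with x have "of_real t * u0 = of_real t * x0"
      unfolding x_def by (metis add_left_cancel)
    then have "t = 0" using u0 by simp
    with x v0 show False by (simp add: x_def)
  qed
  have "wedge x (H x) = 0"
    using t(3) snz by (simp add: Q_def x_def)
  then obtain \<mu> where \<mu>: "H x = of_real \<mu> * x"
    using x by (rule wedge_zero_parallel)
  define z where "z = transv \<sigma> a x"
  have Hz: "H x = transv (- \<sigma>) b z" by (simp add: H_def z_def)
  have "\<mu> \<noteq> 0" using \<mu> x by (auto simp: H_def)
  \<comment> \<open>The factors turn in opposite directions. For a negative eigenvalue both turns
    would have to vanish, and then both factors fix \<open>x\<close>.\<close>
  moreover have "\<not> \<mu> < 0"
  proof
    assume neg: "\<mu> < 0"
    have 1: "\<sigma> * wedge x z \<ge> 0"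
      using transv_fixed_or_turned[OF s, of a x] by (auto simp: z_def)
    have 2: "- \<sigma> * wedge z (H x) \<ge> 0"
      using transv_fixed_or_turned[OF s', of b z] by (auto simp: Hz)
    have "- \<sigma> * wedge z (H x) = \<mu> * (\<sigma> * wedge x z)"
      using wedge_commute[of z x] by (simp add: \<mu> wedge_scale_right)
    with 1 2 neg have "\<sigma> * wedge x z = 0"
      by (metis mult_less_0_iff not_less order_le_less)
    then have zx: "z = x" using transv_fixed_wedge[OF s, of a x] snz by (simp add: z_def)
    then have "wedge x (transv (- \<sigma>) b x) = 0"
      using \<mu> by (simp add: Hz wedge_scale_right)
    then have "H x = x" using transv_fixed_wedge[OF s', of b x] zx Hz by simp
    then show False using not_both[OF x] zx Hz by (simp add: z_def)
  qed
  \<comment> \<open>Eigenvalue \<open>1\<close> means that both parameters send \<open>x\<close> to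
    the same \<open>z\<close>. Either both fix \<open>x\<close>, which is excluded, or
    \<open>a = b\<close>, because a step is determined by its end points; but then \<open>x0\<close>
    would be fixed by both factors.\<close>
  moreover have "\<mu> \<noteq> 1"
  proof
    assume "\<mu> = 1"
    then have z: "z = transv \<sigma> b x"
      using \<mu> Hz transv_eq_iff[of "- \<sigma>" b z x] by simp
    show False
    proof (cases "z = x")
      case True
      then have "transv (- \<sigma>) b x = x" using z transv_inverse[of \<sigma> b x] by simp
      with True not_both[OF x] show False by (simp add: z_def)
    next
      case False
      then have "a = b"
        using step_transv[OF _ s, of a x] step_transv[OF _ s, of b x] z by (metis z_def)
      then show False using x0 transv_fixed_iff[of \<sigma> a x0] transv_fixed_iff[of "- \<sigma>" a x0] snz by simp
    qed
  qed
  ultimately have "\<mu> > 0 \<and> \<mu> \<noteq> 1" by linarith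
  then show ?thesis using x \<mu> by (auto simp: H_def)
qed

text \<open>The determinant is \<open>1\<close>, so an eigenvalue \<open>\<mu> > 1\<close> comes
  with the eigenvalue \<open>1 / \<mu>\<close>, whose eigenvector is \<open>dual x\<close> corrected
  by a multiple of \<open>x\<close>.\<close>

lemma pair_attracting:
  assumes s: "\<sigma> * \<sigma> = 1" and nz: "a \<noteq> 0" "b \<noteq> 0"
    and x0: "x0 \<noteq> 0" "transv (- \<sigma>) b x0 = x0" "transv \<sigma> a x0 \<noteq> x0"
  shows "\<exists>x \<mu>. x \<noteq> 0 \<and> 0 < \<mu> \<and> \<mu> < 1 \<and> transv (- \<sigma>) b (transv \<sigma> a x) = of_real \<mu> * x"
proof -
  define H where "H u = transv (- \<sigma>) b (transv \<sigma> a u)" for u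
  have lin: "H (u + v) = H u + H v" "H (of_real c * u) = of_real c * H u" for u v c
    by (simp_all add: H_def transv_add transv_scale)
  obtain x \<mu> where x: "x \<noteq> 0" "\<mu> > 0" "\<mu> \<noteq> 1" "H x = of_real \<mu> * x"
    using pair_eigenvector[OF assms] unfolding H_def by blast
  show ?thesis
  proof (cases "\<mu> < 1")
    case False
    have "wedge (H x) (H (dual x)) = 1"
      unfolding H_def wedge_transv using x(1) by (rule wedge_dual)
    then have "\<mu> * wedge x (H (dual x)) = 1"
      unfolding x(4) wedge_scale_left .
    then have "wedge x (H (dual x)) = 1 / \<mu>"
      using x by (simp add: field_simps)
    then obtain c where c: "H (dual x) = of_real (1 / \<mu>) * dual x + of_real c * x"
      using dual_decomposition[OF x(1), of "H (dual x)"] by metis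
    have "\<mu> > 1" using False x by simp
    then have "1 / \<mu> - \<mu> \<noteq> 0" by (simp add: field_simps) (metis less_1_mult less_irrefl)
    then obtain d where d: "d * (1 / \<mu> - \<mu>) = c"
      by (metis nonzero_eq_divide_eq)
    have "H (dual x + of_real d * x) = of_real (1 / \<mu>) * dual x + of_real (c + d * \<mu>) * x"
      unfolding lin c x(4) by (simp add: algebra_simps)
    also have "c + d * \<mu> = 1 / \<mu> * d" using d by (simp add: algebra_simps)
    finally have "H (dual x + of_real d * x) = of_real (1 / \<mu>) * (dual x + of_real d * x)"
      by (simp only: distrib_left of_real_mult mult.assoc)
    moreover have "dual x + of_real d * x \<noteq> 0"
    proof
      assume "dual x + of_real d * x = 0"
      then have "wedge x (dual x + of_real d * x) = 0" by (simp add: wedge_def)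
      then show False using x wedge_dual by (simp add: wedge_add_right wedge_scale_right)
    qed
    ultimately show ?thesis
      using \<open>\<mu> > 1\<close> unfolding H_def by (intro exI[of _ "dual x + of_real d * x"] exI[of _ "1 / \<mu>"]) auto
  qed (use x in \<open>auto simp: H_def\<close>)
qed

text \<open>The path goes from \<open>y\<close> over an apex to the parallel vector
  \<open>x\<close>. The terms containing the length of the apex cancel between the two edges, so the
  sum is affine in the scaling \<open>q\<close>; for \<open>l \<noteq> 1\<close> an equation for it
  can be solved for \<open>q\<close>.\<close>

lemma bend_pair:
  fixes l q :: real
  assumes "l \<noteq> 0" "q > 0" "x \<noteq> 0" "wedge x w \<noteq> 0"
  defines "y \<equiv> of_real l * x"
  shows "bend y (of_real (1 / q) * w) + bend (of_real (1 / q) * w) x =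
    (2 * q * (1 - l) - Re (w * cnj y) / (cmod y)\<^sup>2 * (1 - l\<^sup>2)) / wedge y w"
proof -
  define W P where "W = wedge x w" and "P = Re (w * cnj x)"
  define m c where "m = (cmod x)\<^sup>2" and "c = (cmod w)\<^sup>2"
  have w: "w \<noteq> 0" using assms(4) by (auto simp: wedge_def)
  have nz: "W \<noteq> 0" "m > 0" "c > 0" using assms w by (auto simp: W_def m_def c_def)
  have 1: "wedge y w = l * W" "Re (w * cnj y) = l * P" "(cmod y)\<^sup>2 = l\<^sup>2 * m"
    unfolding y_def wedge_scale_left by (simp_all add: W_def P_def m_def norm_mult power_mult_distrib algebra_simps)
  have 2: "wedge y (of_real (1 / q) * w) = l * W / q" "wedge (of_real (1 / q) * w) x = - W / q"
    unfolding wedge_scale_right wedge_scale_left 1 using wedge_commute[of w x] by (simp_all add: W_def)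
  have 3: "Re (of_real (1 / q) * w * cnj y) = l * P / q" "Re (x * cnj (of_real (1 / q) * w)) = P / q"
    using 1(2) by (simp_all add: P_def field_simps)
  have 4: "(cmod (of_real (1 / q) * w))\<^sup>2 = c / q\<^sup>2"
    using assms(2) by (simp add: norm_mult norm_divide power_mult_distrib power_divide c_def)
  show ?thesis
    unfolding bend_def 1 2 3 4 m_def[symmetric] using nz assms(1,2)
    by (simp add: field_simps power2_eq_square)
qed

text \<open>A transvection that sends a vector to a real multiple of itself fixes it. If one member
  of the pair were idle, the other would have to rescale a vector by \<open>1 / l\<close>.\<close>

lemma pair_tail_moves:
  assumes "\<nu> \<in> configs (Suc (Suc N)) s n" "\<And>k. s k * s k = 1" "x \<noteq> 0" "l > 1"
    and o: "orb s \<nu> N x = of_real (sgn_int n * l) * x"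
  shows "orb s \<nu> (Suc N) x \<noteq> orb s \<nu> N x" and "orb s \<nu> (Suc N) x \<noteq> of_real (sgn_int n) * x"
proof -
  define y where "y = of_real (sgn_int n) * x"
  have y: "y \<noteq> 0" using assms by (simp add: y_def)
  have yN: "orb s \<nu> N x = of_real l * y"
    by (simp add: o y_def)
  have no: "transv (s k) a (of_real l * y) \<noteq> y" for k a
  proof
    assume *: "transv (s k) a (of_real l * y) = y"
    then have "wedge (of_real l * y) (transv (s k) a (of_real l * y)) = 0"
      by (simp add: wedge_scale_left)
    then have "of_real l * y = y"
      using transv_fixed_wedge[OF assms(2), of k a "of_real l * y"] * by simp
    then show False using y assms(4) by simp
  qed
  have e: "transv (s (Suc N)) (\<nu> (Suc N)) (orb s \<nu> (Suc N) x) = y"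
    using configs_orb[OF assms(1), of x] by (simp add: y_def)
  show "orb s \<nu> (Suc N) x \<noteq> orb s \<nu> N x"
    using e no[of "Suc N"] yN by auto
  show "orb s \<nu> (Suc N) x \<noteq> of_real (sgn_int n) * x"
    using no[of N "\<nu> N"] yN by (simp add: y_def)
qed

lemma pair_tail_closes:
  assumes "\<And>k. s k * s k = 1" "s (Suc N) = - s N" "x \<noteq> 0" "l > 1"
    and y: "orb s \<nu> N x = y" "y = of_real l * (of_real (sgn_int n) * x)"
    and w: "s N * wedge y w > 0" "\<nu> N = step (s N) y w" "\<nu> (Suc N) = step (s (Suc N)) w (of_real (sgn_int n) * x)"
    and shear: "shear s \<nu> N x + bend y w + bend w (of_real (sgn_int n) * x) = 0"
  shows "orb s \<nu> (Suc N) x = w" "orb s \<nu> (Suc (Suc N)) u = of_real (sgn_int n) * u"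
proof -
  define z where "z = of_real (sgn_int n) * x"
  have yz: "y = of_real l * z" by (simp add: y z_def)
  have "s (Suc N) * wedge w z = s N * wedge y w / l"
    using assms(4) wedge_commute[of w z] by (simp add: yz wedge_scale_left assms(2))
  then have wz: "s (Suc N) * wedge w z > 0" using w(1) assms(4) by simp
  show o: "orb s \<nu> (Suc N) x = w"
    using transv_step[OF w(1) assms(1)] by (simp add: y(1) w(2))
  have o2: "orb s \<nu> (Suc (Suc N)) x = z"
    using transv_step[OF wz assms(1)] o by (simp add: w(3) z_def)
  have "shear s \<nu> (Suc N) x = shear s \<nu> N x + bend y w"
    using shear_Suc_step[OF assms(3), of s N \<nu> w] y(1) w assms(1) by simp
  moreover have "shear s \<nu> (Suc (Suc N)) x = shear s \<nu> (Suc N) x + bend w z"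
    using shear_Suc_step[OF assms(3), of s "Suc N" \<nu> z] o wz w(3) assms(1) by (simp add: z_def del: orb.simps)
  ultimately have "shear s \<nu> (Suc (Suc N)) x = 0"
    using shear by (simp add: z_def)
  then show "orb s \<nu> (Suc (Suc N)) u = of_real (sgn_int n) * u"
    using orb_scalar_iff[OF assms(3) sgn_int_sq(1), of s \<nu> "Suc (Suc N)"] o2 unfolding z_def by blast
qed

lemma pair_tail_shear:
  assumes "\<nu> \<in> configs (Suc (Suc N)) s n" "\<And>k. s k * s k = 1" "x \<noteq> 0" "l > 1"
    and o: "orb s \<nu> N x = of_real (sgn_int n * l) * x"
  defines "w \<equiv> orb s \<nu> (Suc N) x"
  shows "s N * wedge (orb s \<nu> N x) w > 0" "\<nu> N = step (s N) (orb s \<nu> N x) w"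
    "\<nu> (Suc N) = step (s (Suc N)) w (of_real (sgn_int n) * x)"
    "s (Suc N) * wedge w (of_real (sgn_int n) * x) > 0"
    "shear s \<nu> N x + bend (orb s \<nu> N x) w + bend w (of_real (sgn_int n) * x) = 0"
proof -
  note m = pair_tail_moves[OF assms(1-5)]
  have e: "transv (s (Suc N)) (\<nu> (Suc N)) w = of_real (sgn_int n) * x"
    using configs_orb[OF assms(1), of x] by (simp add: w_def)
  have w: "w = transv (s N) (\<nu> N) (orb s \<nu> N x)" by (simp add: w_def)
  show 1: "s N * wedge (orb s \<nu> N x) w > 0"
    using transv_fixed_or_turned[OF assms(2)[of N], of "\<nu> N" "orb s \<nu> N x"] m(1) w by (auto simp: w_def)
  show 2: "\<nu> N = step (s N) (orb s \<nu> N x) w"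
    using step_transv[OF _ assms(2)[of N], of "\<nu> N" "orb s \<nu> N x"] m(1) w by (simp add: w_def)
  show 3: "\<nu> (Suc N) = step (s (Suc N)) w (of_real (sgn_int n) * x)"
    using step_transv[OF _ assms(2)[of "Suc N"], of "\<nu> (Suc N)" w] m(2) e by (simp add: w_def del: orb.simps)
  show 4: "s (Suc N) * wedge w (of_real (sgn_int n) * x) > 0"
    using transv_fixed_or_turned[OF assms(2)[of "Suc N"], of "\<nu> (Suc N)" w] m(2) e by (auto simp: w_def simp del: orb.simps)
  have "shear s \<nu> (Suc N) x = shear s \<nu> N x + bend (orb s \<nu> N x) w"
    using shear_Suc_step[where k = N and s = s and \<nu> = \<nu>, OF assms(3) 1 assms(2) 2] .
  moreover have "shear s \<nu> (Suc (Suc N)) x = shear s \<nu> (Suc N) x + bend w (of_real (sgn_int n) * x)"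
    using shear_Suc_step[of x s "Suc N" \<nu> "of_real (sgn_int n) * x", folded w_def, OF assms(3) 4 assms(2) 3] .
  moreover have "shear s \<nu> (Suc (Suc N)) x = 0"
    using orb_scalar_iff[OF assms(3) sgn_int_sq(1), of s \<nu> "Suc (Suc N)"] configs_orb[OF assms(1)] by blast
  ultimately show "shear s \<nu> N x + bend (orb s \<nu> N x) w + bend w (of_real (sgn_int n) * x) = 0" by simp
qed

text \<open>The final pair undoes the head up to sign, so a vector contracted by the pair is
  expanded by the head.\<close>

lemma generic1_attracting:
  assumes \<nu>: "\<nu> \<in> configs (Suc (Suc N)) s n" and s: "\<And>k. s k * s k = 1"
    and sN: "s (Suc N) = - s N" and gen: "generic1 s (Suc N) \<nu>"
  obtains x l where "x \<noteq> 0" "l > 1" "orb s \<nu> N x = of_real (sgn_int n * l) * x"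
proof -
  obtain x0 r where x0: "x0 \<noteq> 0" "r > 0" "\<nu> (Suc N) = of_real r * x0\<^sup>2" "fixed_steps s \<nu> (Suc N) x0 = {}"
    using gen unfolding generic1_def by blast
  let ?e = "sgn_int n"
  have f: "transv (- s N) (\<nu> (Suc N)) x0 = x0"
    using transv_parallel[of r "- s N" x0 x0] x0 by simp
  have "orb s \<nu> (Suc N) x0 = of_real ?e * x0"
    by (rule parallel_tail(1)[OF \<nu> x0(1-3) s])
  moreover have "orb s \<nu> (Suc N) x0 \<noteq> orb s \<nu> N x0"
    using x0(4) unfolding fixed_steps_def by blast
  ultimately have "transv (s N) (\<nu> N) x0 \<noteq> x0"
    by (metis orb.simps(2) sgn_int_sq(2) transv_fixed_scale transv_inverse)
  then obtain x \<mu> where x: "x \<noteq> 0" "0 < \<mu>" "\<mu> < 1"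
    "transv (- s N) (\<nu> (Suc N)) (transv (s N) (\<nu> N) x) = of_real \<mu> * x"
    using pair_attracting[OF s[of N] configs_nz[OF \<nu>, of N] configs_nz[OF \<nu>, of "Suc N"] x0(1) f] by auto
  have "transv (- s N) (\<nu> (Suc N)) (transv (s N) (\<nu> N) (orb s \<nu> N x)) = of_real ?e * x"
    using configs_orb[OF \<nu>, of x] by (simp add: sN)
  also have "\<dots> = transv (- s N) (\<nu> (Suc N)) (transv (s N) (\<nu> N) (of_real (?e * (1 / \<mu>)) * x))"
    unfolding transv_scale x(4) using x by simp
  finally have "orb s \<nu> N x = of_real (?e * (1 / \<mu>)) * x"
    by (metis transv_inverse)
  moreover have "1 / \<mu> > 1" using x by simp
  ultimately show thesis using that x(1) by blast
qed

text \<open>Approximate the head while keeping its eigenvector and eigenvalue, and rescale the apex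
  of the pair so that the total shear vanishes again. The scaling depends continuously on the head
  and is \<open>1\<close> in the limit.\<close>

lemma generic2_dense:
  assumes \<nu>: "\<nu> \<in> configs (Suc (Suc N)) s n" and s: "\<And>k. s k * s k = 1"
    and sN: "s (Suc N) = - s N" and gen: "generic1 s (Suc N) \<nu>"
  shows "\<nu> \<in> closure {\<mu> \<in> configs (Suc (Suc N)) s n. generic2 s N n \<mu>}"
proof -
  obtain x l where x: "x \<noteq> 0" "l > 1" and o: "orb s \<nu> N x = of_real (sgn_int n * l) * x"
    using generic1_attracting[OF assms] .
  define z y where "z = of_real (sgn_int n) * x" and "y = of_real l * z"
  have yN: "orb s \<nu> N x = y" by (simp add: o y_def z_def)
  have z0: "z \<noteq> 0" using x by (simp add: z_def)
  define w where "w = orb s \<nu> (Suc N) x"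
  note pt = pair_tail_shear[OF \<nu> s x o, folded w_def z_def, unfolded yN]
  have "l * wedge z w \<noteq> 0" using pt(1) unfolding y_def wedge_scale_left by auto
  then have zw: "wedge z w \<noteq> 0" by simp
  define S where "S = generic_heads s N x \<nu>"
  define F where "F = inf (nhds \<nu>) (principal S)"
  define D where "D = Re (w * cnj y) / (cmod y)\<^sup>2 * (1 - l\<^sup>2)"
  \<comment> \<open>The solution of the affine equation of \<open>bend_pair\<close> for the scaling;
    it exists because \<open>1 - l\<close> is nonzero.\<close>
  define q where "q \<mu> = (D - shear s \<mu> N x * wedge y w) / (2 * (1 - l))" for \<mu>
  have W: "wedge y w \<noteq> 0" using pt(1) by auto
  have bp: "bend y (of_real (1 / r) * w) + bend (of_real (1 / r) * w) z =
    (2 * r * (1 - l) - D) / wedge y w" if "r > 0" for r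
    using bend_pair[of l r z w] x that z0 zw by (simp add: y_def D_def)
  have q\<nu>: "q \<nu> = 1"
  proof -
    have "shear s \<nu> N x + (2 * (1 - l) - D) / wedge y w = 0"
      using bp[of 1] pt(5) by simp
    then have "D - shear s \<nu> N x * wedge y w = 2 * (1 - l)"
      using W by (simp add: field_simps)
    then show ?thesis using x unfolding q_def by simp
  qed
  have qlim: "(q \<longlongrightarrow> 1) F"
  proof -
    have "(q \<longlongrightarrow> q \<nu>) F"
      unfolding q_def F_def by (intro tendsto_intros tendsto_shear tendsto_coordinate x) (use x in auto)
    then show ?thesis by (simp add: q\<nu>)
  qed
  define w' where "w' \<mu> = of_real (1 / q \<mu>) * w" for \<mu>
  have wlim: "(w' \<longlongrightarrow> w) F"
  proof -
    have "(w' \<longlongrightarrow> of_real (1 / 1) * w) F"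
      unfolding w'_def by (intro tendsto_intros qlim) auto
    then show ?thesis by simp
  qed
  define \<tau> where "\<tau> \<mu> = \<mu>(N := step (s N) y (w' \<mu>), Suc N := step (s (Suc N)) (w' \<mu>) z)" for \<mu>
  show ?thesis
  proof (rule closure_by_completion[where S = S and \<tau> = \<tau> and \<nu> = \<nu>, folded F_def])
    \<comment> \<open>If all steps were fixed, \<open>x\<close> would be an eigenvector for the
      eigenvalue \<open>1\<close>, but the modulus of its eigenvalue is
      \<open>l > 1\<close>.\<close>
    have "fixed_steps s \<nu> N x \<noteq> {..<N} \<or> N = 0"
    proof (rule ccontr)
      assume *: "\<not> ?thesis"
      have "orb s \<nu> k x = x" if "k \<le> N" for k
        using that
      proof (induction k)
        case (Suc k)
        then have "k \<in> fixed_steps s \<nu> N x" using * by auto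
        with Suc show ?case by (auto simp: fixed_steps_def simp del: orb.simps(2))
      qed simp
      then have "of_real (sgn_int n * l) * x = x" using o by simp
      then have "sgn_int n * l = 1" using x by (simp flip: of_real_mult)
      then show False using x by (auto simp: sgn_int_def split: if_splits)
    qed
    then show "\<nu> \<in> closure S"
      unfolding S_def using s x configs_nz[OF \<nu>] by (intro head_dense) auto
    show "((\<lambda>\<mu>. \<tau> \<mu> k) \<longlongrightarrow> \<nu> k) F" for k
    proof -
      have 1: "((\<lambda>\<mu>. step (s N) y (w' \<mu>)) \<longlongrightarrow> \<nu> N) F"
        using pt(1) unfolding pt(2) by (intro tendsto_step wlim) auto
      have 2: "((\<lambda>\<mu>. step (s (Suc N)) (w' \<mu>) z) \<longlongrightarrow> \<nu> (Suc N)) F"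
        using pt(4) unfolding pt(3) by (intro tendsto_step wlim) auto
      show ?thesis
        using 1 2 tendsto_coordinate[of k \<nu> S, folded F_def]
        by (cases "k = Suc N"; cases "k = N") (simp_all add: \<tau>_def)
    qed
    have "eventually (\<lambda>\<mu>. q \<mu> > 0) F"
      using qlim by (rule order_tendstoD) simp
    moreover have "eventually (\<lambda>\<mu>. \<mu> \<in> S) F"
      unfolding F_def by (rule eventually_within)
    ultimately show "eventually (\<lambda>\<mu>. (\<forall>k\<ge>Suc (Suc N). \<tau> \<mu> k = 0) \<and>
      (\<forall>u. orb s (\<tau> \<mu>) (Suc (Suc N)) u = of_real (sgn_int n) * u) \<and> generic2 s N n (\<tau> \<mu>)) F"
    proof eventually_elim
      case (elim \<mu>)
      have same: "orb s (\<tau> \<mu>) k u = orb s \<mu> k u" if "k \<le> N" for k u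
        using that by (intro orb_cong) (auto simp: \<tau>_def)
      have sh: "shear s (\<tau> \<mu>) N x = shear s \<mu> N x"
        by (intro shear_cong) (auto simp: \<tau>_def)
      have oN: "orb s (\<tau> \<mu>) N x = y"
        using elim yN by (simp add: same S_def generic_heads_def)
      have "s N * wedge y (w' \<mu>) = s N * wedge y w / q \<mu>"
        unfolding w'_def wedge_scale_right by simp
      then have pos: "s N * wedge y (w' \<mu>) > 0" using pt(1) elim by simp
      have "shear s (\<tau> \<mu>) N x + bend y (w' \<mu>) + bend (w' \<mu>) z =
          shear s \<mu> N x + (2 * q \<mu> * (1 - l) - D) / wedge y w"
        using bp[of "q \<mu>"] elim by (simp add: sh w'_def)
      also have "2 * q \<mu> * (1 - l) = q \<mu> * (2 * (1 - l))" by simp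
      also have "\<dots> = D - shear s \<mu> N x * wedge y w"
        using x by (subst nonzero_eq_divide_eq[symmetric]) (auto simp: q_def)
      finally have "shear s (\<tau> \<mu>) N x + bend y (w' \<mu>) + bend (w' \<mu>) z = 0"
        using W by simp
      then have "orb s (\<tau> \<mu>) (Suc (Suc N)) u = of_real (sgn_int n) * u" for u
        by (intro pair_tail_closes(2)[of s N x l "\<tau> \<mu>" y n "w' \<mu>"])
          (use s sN x oN pos in \<open>simp_all add: y_def z_def \<tau>_def\<close>)
      moreover have "\<tau> \<mu> k = 0" if "k \<ge> Suc (Suc N)" for k
        using elim that \<nu> by (simp add: \<tau>_def S_def generic_heads_def configs_def)
      moreover have "fixed_steps s (\<tau> \<mu>) N x = fixed_steps s \<mu> N x"
        using same by (auto simp: fixed_steps_def simp del: orb.simps)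
      then have "generic2 s N n (\<tau> \<mu>)"
        using elim x oN unfolding generic2_def
        by (intro exI[of _ x] exI[of _ l]) (auto simp: S_def generic_heads_def y_def z_def)
      ultimately show ?case by blast
    qed
  qed (use \<nu> s in auto)
qed

section \<open>Parametrisation by polygons\<close>

text \<open>Reciprocal lengths are used because the bending is quadratic in them, so that interpolating
  their squares linearly preserves the sign conditions.\<close>

definition vtx :: "(nat \<Rightarrow> real) \<Rightarrow> (nat \<Rightarrow> real) \<Rightarrow> nat \<Rightarrow> complex" where
  "vtx \<theta> m k = of_real (1 / m k) * cis (\<theta> k)"

text \<open>The numbers \<open>\<theta>\<close> are lifted arguments, not arguments modulo a full
  turn: convex combinations make sense, and the difference of the outer ones is the turning.\<close>

definition polygon :: "(nat \<Rightarrow> real) \<Rightarrow> nat \<Rightarrow> (nat \<Rightarrow> real) \<Rightarrow> (nat \<Rightarrow> real) \<Rightarrow> bool" where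
  "polygon s N \<theta> m \<longleftrightarrow>
     (\<forall>k<N. 0 < s k * (\<theta> (Suc k) - \<theta> k) \<and> s k * (\<theta> (Suc k) - \<theta> k) < pi) \<and> (\<forall>k\<le>N. 0 < m k)"

definition total_bend :: "nat \<Rightarrow> (nat \<Rightarrow> real) \<Rightarrow> (nat \<Rightarrow> real) \<Rightarrow> real" where
  "total_bend N \<theta> m = (\<Sum>k<N. bend (vtx \<theta> m k) (vtx \<theta> m (Suc k)))"

lemma wedge_cis: "wedge (of_real a * cis t) (of_real b * cis u) = a * b * sin (u - t)"
  unfolding wedge_scale_left wedge_scale_right by (simp add: wedge_def sin_diff algebra_simps)

lemma wedge_vtx: "wedge (vtx \<theta> m j) (vtx \<theta> m k) = sin (\<theta> k - \<theta> j) / (m j * m k)"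
  unfolding vtx_def wedge_cis by simp

lemma sign_cases: "s * s = (1::real) \<Longrightarrow> s = 1 \<or> s = - 1"
  using square_eq_1_iff by auto

lemma sign_sin_pos:
  assumes "s * s = (1::real)" "0 < s * t" "s * t < pi"
  shows "s * sin t > 0"
  using sign_cases[OF assms(1)] assms(2,3) sin_gt_zero[of t] sin_gt_zero[of "- t"] by auto

lemma polygon_wedge:
  assumes "polygon s N \<theta> m" "k < N" "s k * s k = 1"
  shows "s k * wedge (vtx \<theta> m k) (vtx \<theta> m (Suc k)) > 0"
proof -
  have "s k * sin (\<theta> (Suc k) - \<theta> k) > 0" "m k > 0" "m (Suc k) > 0"
    using assms sign_sin_pos[of "s k" "\<theta> (Suc k) - \<theta> k"] unfolding polygon_def by auto
  then show ?thesis unfolding wedge_vtx by simp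
qed

lemma vtx_nonzero: "m k > 0 \<Longrightarrow> vtx \<theta> m k \<noteq> 0"
  by (simp add: vtx_def)

lemma Arg_vtx:
  assumes "polygon s N \<theta> m" "k < N" "s k * s k = 1"
  shows "Arg (vtx \<theta> m (Suc k) / vtx \<theta> m k) = \<theta> (Suc k) - \<theta> k"
proof -
  have m: "m k > 0" "m (Suc k) > 0" using assms by (auto simp: polygon_def)
  have "vtx \<theta> m (Suc k) / vtx \<theta> m k = rcis (m k / m (Suc k)) (\<theta> (Suc k) - \<theta> k)"
    using m by (simp add: vtx_def rcis_def cis_divide[symmetric])
  moreover have "\<theta> (Suc k) - \<theta> k \<in> {- pi<..pi}"
    using assms sign_cases[OF assms(3)] unfolding polygon_def by force
  ultimately show ?thesis using m by (simp add: Arg_rcis)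
qed

lemma polygon_orbit:
  assumes "polygon s N \<theta> m" "\<And>k. s k * s k = 1"
    and \<nu>: "\<forall>k<N. \<nu> k = step (s k) (vtx \<theta> m k) (vtx \<theta> m (Suc k))"
  shows "k \<le> N \<Longrightarrow> orb s \<nu> k (vtx \<theta> m 0) = vtx \<theta> m k"
    and "k \<le> N \<Longrightarrow> shear s \<nu> k (vtx \<theta> m 0) = total_bend k \<theta> m"
    and "k \<le> N \<Longrightarrow> turning k s \<nu> (vtx \<theta> m 0) = \<theta> k - \<theta> 0"
    and "fixed_steps s \<nu> N (vtx \<theta> m 0) = {}"
    and "k < N \<Longrightarrow> \<nu> k \<noteq> 0"
proof -
  have nz: "vtx \<theta> m 0 \<noteq> 0" using assms(1) by (simp add: polygon_def vtx_nonzero)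
  note pw = polygon_wedge[OF assms(1) _ assms(2)]
  show o: "k \<le> N \<Longrightarrow> orb s \<nu> k (vtx \<theta> m 0) = vtx \<theta> m k" for k
    by (induction k) (simp_all add: \<nu> transv_step pw assms(2))
  show "k \<le> N \<Longrightarrow> shear s \<nu> k (vtx \<theta> m 0) = total_bend k \<theta> m"
  proof (induction k)
    case 0
    have "shear s \<nu> 0 (vtx \<theta> m 0) = 0" by (rule shear_unique[OF nz]) simp
    then show ?case by (simp add: total_bend_def)
  next
    case (Suc k)
    then show ?case
      using shear_Suc_step[OF nz, of s k \<nu> "vtx \<theta> m (Suc k)"] o[of k] pw[of k] assms(2)[of k] \<nu>
      by (simp add: total_bend_def)
  qed
  show "k \<le> N \<Longrightarrow> turning k s \<nu> (vtx \<theta> m 0) = \<theta> k - \<theta> 0"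
  proof (induction k)
    case (Suc k)
    then show ?case
      using Arg_vtx[OF assms(1) _ assms(2), of k] o[of k] o[of "Suc k"]
      by (simp add: turning_def del: orb.simps)
  qed (simp add: turning_def)
  have "vtx \<theta> m (Suc k) \<noteq> vtx \<theta> m k" if "k < N" for k
    using pw[OF that] by auto
  then show "fixed_steps s \<nu> N (vtx \<theta> m 0) = {}"
    using o by (auto simp: fixed_steps_def simp del: orb.simps)
  show "k < N \<Longrightarrow> \<nu> k \<noteq> 0"
    using step_nonzero[OF pw] \<nu> by simp
qed

text \<open>The partial turnings, started at \<open>Arg x\<close>, provide the lifted arguments;
  their increments have the right sign and size because no step is fixed.\<close>

lemma polygon_of_orbit:
  assumes "\<And>k. s k * s k = 1" "x \<noteq> 0" "fixed_steps s \<nu> N x = {}"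
  defines "\<theta> \<equiv> \<lambda>k. Arg x + turning k s \<nu> x" and "m \<equiv> \<lambda>k. 1 / cmod (orb s \<nu> k x)"
  shows "polygon s N \<theta> m" and "vtx \<theta> m k = orb s \<nu> k x"
    and "\<forall>k<N. \<nu> k = step (s k) (vtx \<theta> m k) (vtx \<theta> m (Suc k))"
proof -
  show v: "vtx \<theta> m k = orb s \<nu> k x" for k
  proof -
    have x: "x = of_real (cmod x) * cis (Arg x)"
      using rcis_cmod_Arg[of x] by (simp add: rcis_def)
    have "orb s \<nu> k x = of_real (cmod (orb s \<nu> k x) / cmod x) * cis (turning k s \<nu> x) * x"
      by (rule orb_turning[OF assms(2)])
    also have "\<dots> = of_real (cmod (orb s \<nu> k x) / cmod x) * cis (turning k s \<nu> x) * (of_real (cmod x) * cis (Arg x))"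
      by (rule arg_cong[OF x])
    also have "\<dots> = vtx \<theta> m k"
      using assms(2) by (simp add: vtx_def \<theta>_def m_def cis_mult[symmetric])
    finally show ?thesis by simp
  qed
  have moved: "orb s \<nu> (Suc k) x \<noteq> orb s \<nu> k x" if "k < N" for k
    using assms(3) that by (auto simp: fixed_steps_def)
  have pos: "s k * wedge (orb s \<nu> k x) (orb s \<nu> (Suc k) x) > 0" if "k < N" for k
    using transv_fixed_or_turned[OF assms(1)[of k], of "\<nu> k" "orb s \<nu> k x"] moved[OF that] by auto
  show "polygon s N \<theta> m"
    unfolding polygon_def
  proof (intro conjI allI impI)
    fix k assume k: "k < N"
    define q where "q = orb s \<nu> (Suc k) x / orb s \<nu> k x"
    have d: "\<theta> (Suc k) - \<theta> k = Arg q" by (simp add: \<theta>_def turning_def q_def)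
    have "s k * Im q > 0"
      using pos[OF k] assms(2) unfolding wedge_eq_Im_divide q_def
      by (simp add: mult.left_commute[of "s k"] zero_less_mult_iff del: orb.simps)
    then have "0 < s k * Arg q \<and> s k * Arg q < pi"
      using sign_cases[OF assms(1)[of k]] Arg_lt_pi[of q] Arg_less_0[of q] mpi_less_Arg[of q]
        Arg_le_pi[of q] Arg_eq_pi by force
    then show "0 < s k * (\<theta> (Suc k) - \<theta> k)" "s k * (\<theta> (Suc k) - \<theta> k) < pi" by (simp_all add: d)
  next
    fix k show "0 < m k" using assms(2) by (simp add: m_def)
  qed
  show "\<forall>k<N. \<nu> k = step (s k) (vtx \<theta> m k) (vtx \<theta> m (Suc k))"
  proof (intro allI impI)
    fix k assume "k < N"
    then show "\<nu> k = step (s k) (vtx \<theta> m k) (vtx \<theta> m (Suc k))"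
      using step_transv[OF _ assms(1)[of k], of "\<nu> k" "orb s \<nu> k x"] moved[of k] by (simp add: v)
  qed
qed

lemma connected_component_path:
  fixes c :: "real \<Rightarrow> nat \<Rightarrow> complex"
  assumes "\<And>k. continuous_on {0..1} (\<lambda>t. c t k)" "\<And>t. t \<in> {0..1} \<Longrightarrow> c t \<in> C"
  shows "connected_component C (c 0) (c 1)"
proof (rule connected_componentI)
  have "continuous_on {0..1} c"
    by (rule continuous_on_coordinatewise_then_product) (rule assms)
  then show "connected (c ` {0..1})"
    by (rule connected_continuous_image) simp
qed (use assms in auto)

lemma continuous_on_step:
  assumes "continuous_on T f" "continuous_on T g" "\<And>t. t \<in> T \<Longrightarrow> s * wedge (f t) (g t) > 0"
  shows "continuous_on T (\<lambda>t. step s (f t) (g t))"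
  unfolding continuous_on_def
proof (intro ballI tendsto_step)
  fix t assume t: "t \<in> T"
  show "s * wedge (f t) (g t) \<noteq> 0" using assms(3)[OF t] by (auto simp: zero_less_mult_iff)
qed (use assms(1,2) in \<open>auto simp: continuous_on_def\<close>)

lemma continuous_on_bend:
  assumes "continuous_on T f" "continuous_on T g" "\<And>t. t \<in> T \<Longrightarrow> s * wedge (f t) (g t) > 0"
  shows "continuous_on T (\<lambda>t. bend (f t) (g t))"
proof -
  have nz: "wedge (f t) (g t) \<noteq> 0" "f t \<noteq> 0" "g t \<noteq> 0" if "t \<in> T" for t
    using assms(3)[OF that] by (auto simp: wedge_def)
  have "continuous_on T (\<lambda>t. wedge (f t) (g t))"
    unfolding wedge_def by (intro continuous_intros assms)
  then show ?thesis
    unfolding bend_def using nz by (intro continuous_intros assms) auto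
qed

lemma continuous_on_vtx:
  assumes "\<And>k. continuous_on T (\<lambda>t. \<theta> t k)" "\<And>k. continuous_on T (\<lambda>t. m t k)" "\<And>t. t \<in> T \<Longrightarrow> m t k \<noteq> 0"
  shows "continuous_on T (\<lambda>t. vtx (\<theta> t) (m t) k)"
  unfolding vtx_def by (intro continuous_intros assms) (use assms(3) in auto)

section \<open>Configurations completed by one transvection along the starting vector\<close>

definition conf1 :: "(nat \<Rightarrow> real) \<Rightarrow> nat \<Rightarrow> (nat \<Rightarrow> real) \<Rightarrow> (nat \<Rightarrow> real) \<Rightarrow> nat \<Rightarrow> complex" where
  "conf1 s N \<theta> m k = (if k < N then step (s k) (vtx \<theta> m k) (vtx \<theta> m (Suc k))
     else if k = N then of_real (s N * total_bend N \<theta> m) * (vtx \<theta> m 0)\<^sup>2 else 0)"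

text \<open>The two equations close the polygon up to the sign given by \<open>n\<close>; the last
  condition says that the coefficient of the completing transvection is positive.\<close>

definition data1 :: "(nat \<Rightarrow> real) \<Rightarrow> nat \<Rightarrow> int \<Rightarrow> (nat \<Rightarrow> real) \<Rightarrow> (nat \<Rightarrow> real) \<Rightarrow> bool" where
  "data1 s N n \<theta> m \<longleftrightarrow> polygon s N \<theta> m \<and> \<theta> N = \<theta> 0 + of_int n * pi \<and> m N = m 0 \<and> s N * total_bend N \<theta> m > 0"

lemma conf1_configs:
  assumes d: "data1 s N n \<theta> m" and s: "\<And>k. s k * s k = 1"
  shows "conf1 s N \<theta> m \<in> configs (Suc N) s n"
proof -
  let ?\<nu> = "conf1 s N \<theta> m" and ?x = "vtx \<theta> m 0"
  have p: "polygon s N \<theta> m" using d by (simp add: data1_def)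
  have \<nu>: "\<forall>k<N. ?\<nu> k = step (s k) (vtx \<theta> m k) (vtx \<theta> m (Suc k))"
    by (simp add: conf1_def)
  note po = polygon_orbit[OF p s \<nu>]
  have x: "?x \<noteq> 0" using p by (simp add: polygon_def vtx_nonzero)
  have "vtx \<theta> m N = of_real (sgn_int n) * ?x"
    using d by (simp add: data1_def vtx_def cis_mult[symmetric] cis_of_int_pi)
  then have oN: "orb s ?\<nu> N ?x = of_real (sgn_int n) * ?x"
    using po(1)[of N] by simp
  have \<nu>N: "?\<nu> N = of_real (s N * shear s ?\<nu> N ?x) * ?x\<^sup>2"
    unfolding po(2)[OF order_refl] by (simp add: conf1_def)
  have pos: "s N * shear s ?\<nu> N ?x > 0"
    using d po(2)[of N] by (simp add: data1_def)
  have orb: "orb s ?\<nu> (Suc N) u = of_real (sgn_int n) * u" for u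
    by (rule parallel_tail_closes[OF oN x s pos \<nu>N])
  show ?thesis
  proof (rule configsI[OF _ _ orb x _ s])
    fix k assume "k < Suc N"
    then show "?\<nu> k \<noteq> 0"
      using po(5)[of k] pos x unfolding \<nu>N by (cases "k = N") (auto simp: \<nu>N simp del: of_real_mult)
  next
    have "turning (Suc N) s ?\<nu> ?x = turning N s ?\<nu> ?x + Arg (orb s ?\<nu> (Suc N) ?x / orb s ?\<nu> N ?x)"
      by (simp add: turning_def)
    also have "\<dots> = of_int n * pi"
      unfolding orb oN using po(3)[of N] x d by (simp add: data1_def)
    finally show "turning (Suc N) s ?\<nu> ?x = of_int n * pi" .
  qed (simp add: conf1_def)
qed

lemma generic1_conf1:
  assumes \<nu>: "\<nu> \<in> configs (Suc N) s n" and s: "\<And>k. s k * s k = 1" and g: "generic1 s N \<nu>"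
  obtains \<theta> m where "data1 s N n \<theta> m" "\<nu> = conf1 s N \<theta> m"
proof -
  obtain x r where xr: "x \<noteq> 0" "r > 0" "\<nu> N = of_real r * x\<^sup>2" and f: "fixed_steps s \<nu> N x = {}"
    using g unfolding generic1_def by blast
  note pt = parallel_tail[OF \<nu> xr s]
  have sr: "sqrt r > 0" using xr by simp
  define y where "y = of_real (sqrt r) * x"
  have y: "y \<noteq> 0" using xr by (simp add: y_def)
  have \<nu>N: "\<nu> N = of_real 1 * y\<^sup>2"
    using xr by (simp add: y_def power_mult_distrib flip: of_real_power)
  have fy: "fixed_steps s \<nu> N y = {}"
    using f sr unfolding y_def fixed_steps_def orb_scale by auto
  note pt = parallel_tail[OF \<nu> y zero_less_one \<nu>N s]
  define \<theta> where "\<theta> = (\<lambda>k. Arg y + turning k s \<nu> y)"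
  define m where "m = (\<lambda>k. 1 / cmod (orb s \<nu> k y))"
  note po = polygon_of_orbit[OF s y fy, folded \<theta>_def m_def]
  have v0: "vtx \<theta> m 0 = y" using po(2)[of 0] by simp
  note sh = polygon_orbit(2)[OF po(1) s po(3), of N, simplified, unfolded v0]
  have "turning (Suc N) s \<nu> y = turning N s \<nu> y + Arg (orb s \<nu> (Suc N) y / orb s \<nu> N y)"
    by (simp add: turning_def)
  also have "\<dots> = turning N s \<nu> y"
    unfolding configs_orb[OF \<nu>] pt(1) using y by simp
  finally have t: "turning N s \<nu> y = of_int n * pi"
    using \<nu> y by (simp add: configs_def)
  have "data1 s N n \<theta> m"
    unfolding data1_def
  proof (intro conjI po(1))
    show "\<theta> N = \<theta> 0 + of_int n * pi" by (simp add: \<theta>_def t) (simp add: turning_def)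
    show "m N = m 0" by (simp add: m_def pt(1) norm_mult sgn_int_def)
    show "s N * total_bend N \<theta> m > 0" using pt(2) sh by simp
  qed
  moreover have "\<nu> = conf1 s N \<theta> m"
  proof
    fix k
    consider "k < N" | "k = N" | "k > N" by linarith
    then show "\<nu> k = conf1 s N \<theta> m k"
    proof cases
      case 2
      then show ?thesis using \<nu>N pt(2) sh by (simp add: conf1_def v0)
    next
      case 3
      then show ?thesis using \<nu> by (simp add: conf1_def configs_def)
    qed (simp add: conf1_def po(3))
  qed
  ultimately show thesis by (rule that)
qed

lemma continuous_on_total_bend:
  assumes "\<And>k. continuous_on T (\<lambda>t. \<theta> t k)" "\<And>k. continuous_on T (\<lambda>t. m t k)"
    and p: "\<And>t. t \<in> T \<Longrightarrow> polygon s N (\<theta> t) (m t)" and s: "\<And>k. s k * s k = 1"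
  shows "continuous_on T (\<lambda>t. total_bend N (\<theta> t) (m t))"
  unfolding total_bend_def
proof (intro continuous_on_sum)
  fix k assume k: "k \<in> {..<N}"
  have "m t j \<noteq> 0" if "t \<in> T" "j \<le> N" for t j
    using p[OF that(1)] that(2) by (auto simp: polygon_def)
  then show "continuous_on T (\<lambda>t. bend (vtx (\<theta> t) (m t) k) (vtx (\<theta> t) (m t) (Suc k)))"
    using k polygon_wedge[OF p _ s, of _ k] by (intro continuous_on_bend[where s = "s k"] continuous_on_vtx assms) auto
qed

lemma conf1_path:
  fixes \<theta> m :: "real \<Rightarrow> nat \<Rightarrow> real"
  assumes "\<And>k. continuous_on {0..1} (\<lambda>t. \<theta> t k)" "\<And>k. continuous_on {0..1} (\<lambda>t. m t k)"
    and d: "\<And>t. t \<in> {0..1} \<Longrightarrow> data1 s N n (\<theta> t) (m t)" and s: "\<And>k. s k * s k = 1"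
  shows "connected_component (configs (Suc N) s n) (conf1 s N (\<theta> 0) (m 0)) (conf1 s N (\<theta> 1) (m 1))"
proof (rule connected_component_path[where c = "\<lambda>t. conf1 s N (\<theta> t) (m t)"])
  have p: "polygon s N (\<theta> t) (m t)" if "t \<in> {0..1}" for t
    using d[OF that] by (simp add: data1_def)
  have nz: "m t j \<noteq> 0" if "t \<in> {0..1}" "j \<le> N" for t j
    using p[OF that(1)] that(2) by (auto simp: polygon_def)
  fix k
  show "continuous_on {0..1} (\<lambda>t. conf1 s N (\<theta> t) (m t) k)"
  proof -
    consider "k < N" | "k = N" | "k > N" by linarith
    then show ?thesis
    proof cases
      case 1
      have "continuous_on {0..1} (\<lambda>t. step (s k) (vtx (\<theta> t) (m t) k) (vtx (\<theta> t) (m t) (Suc k)))"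
        using 1 polygon_wedge[OF p _ s, of _ k]
        by (intro continuous_on_step continuous_on_vtx assms) (auto simp: nz)
      then show ?thesis using 1 by (simp add: conf1_def)
    next
      case 2
      have "continuous_on {0..1} (\<lambda>t. of_real (s N * total_bend N (\<theta> t) (m t)) * (vtx (\<theta> t) (m t) 0)\<^sup>2)"
        by (intro continuous_intros continuous_on_vtx continuous_on_total_bend[where s = s] assms p)
          (auto simp: nz)
      then show ?thesis using 2 by (simp add: conf1_def)
    next
      case 3
      then show ?thesis by (simp add: conf1_def)
    qed
  qed
qed (rule conf1_configs[OF d s])

section \<open>Deforming lengths and angles when all signs agree\<close>

lemma bend_polar:
  assumes "a > 0" "b > 0" "sin (u - t) \<noteq> 0"
  shows "bend (of_real (1 / a) * cis t) (of_real (1 / b) * cis u) =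
    (2 * a * b - cos (u - t) * (a\<^sup>2 + b\<^sup>2)) / sin (u - t)"
proof -
  have 1: "Re (of_real (1 / b) * cis u * cnj (of_real (1 / a) * cis t)) = cos (u - t) / (a * b)"
    by (simp add: cos_diff algebra_simps add_divide_distrib)
  have 2: "(cmod (of_real (1 / c) * cis v))\<^sup>2 = 1 / c\<^sup>2" for c v
    by (simp add: norm_mult norm_divide power_divide)
  show ?thesis
    unfolding bend_def wedge_cis 1 2 using assms by (simp add: field_simps power2_eq_square)
qed

text \<open>The Cauchy-Schwarz inequality for \<open>(a, 1)\<close> and \<open>(b, 1)\<close> with
  weights \<open>1 - t\<close> and \<open>t\<close>.\<close>

lemma sqrt_interpolation:
  assumes "a > 0" "b > 0" "0 \<le> t" "t \<le> 1"
  shows "sqrt ((1 - t) * a\<^sup>2 + t) * sqrt ((1 - t) * b\<^sup>2 + t) \<ge> (1 - t) * (a * b) + t"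
proof -
  have "((1 - t) * (a * b) + t)\<^sup>2 = ((1 - t) * a\<^sup>2 + t) * ((1 - t) * b\<^sup>2 + t) - t * (1 - t) * (a - b)\<^sup>2"
    by (simp add: power2_eq_square algebra_simps)
  also have "\<dots> \<le> ((1 - t) * a\<^sup>2 + t) * ((1 - t) * b\<^sup>2 + t)"
    using assms by simp
  finally have "(1 - t) * (a * b) + t \<le> sqrt (((1 - t) * a\<^sup>2 + t) * ((1 - t) * b\<^sup>2 + t))"
    by (rule real_le_rsqrt)
  then show ?thesis by (simp add: real_sqrt_mult)
qed

text \<open>When the squares of the reciprocal lengths are interpolated linearly, the cosine term is
  linear and the product term lies above its chord by Cauchy-Schwarz. Division by
  \<open>\<sigma> * sin \<alpha> > 0\<close> keeps the inequality.\<close>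

lemma bend_interpolation:
  assumes "\<sigma> * \<sigma> = (1::real)" "0 < \<sigma> * \<alpha>" "\<sigma> * \<alpha> < pi" "a > 0" "b > 0" "0 \<le> t" "t \<le> 1"
  defines "A \<equiv> sqrt ((1 - t) * a\<^sup>2 + t)" and "B \<equiv> sqrt ((1 - t) * b\<^sup>2 + t)"
  shows "\<sigma> * ((2 * A * B - cos \<alpha> * (A\<^sup>2 + B\<^sup>2)) / sin \<alpha>)
    \<ge> (1 - t) * (\<sigma> * ((2 * a * b - cos \<alpha> * (a\<^sup>2 + b\<^sup>2)) / sin \<alpha>)) + t * (\<sigma> * ((2 - 2 * cos \<alpha>) / sin \<alpha>))"
proof -
  have S: "\<sigma> * sin \<alpha> > 0" using sign_sin_pos assms(1-3) by blast
  have sq: "A\<^sup>2 = (1 - t) * a\<^sup>2 + t" "B\<^sup>2 = (1 - t) * b\<^sup>2 + t"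
    unfolding A_def B_def using assms by simp_all
  have AB: "(1 - t) * (a * b) + t \<le> A * B"
    unfolding A_def B_def using sqrt_interpolation assms by blast
  have div: "\<sigma> * (X / sin \<alpha>) = X / (\<sigma> * sin \<alpha>)" for X
    using sign_cases[OF assms(1)] by auto
  have "(1 - t) * (2 * a * b - cos \<alpha> * (a\<^sup>2 + b\<^sup>2)) + t * (2 - 2 * cos \<alpha>) \<le> 2 * A * B - cos \<alpha> * (A\<^sup>2 + B\<^sup>2)"
    using AB unfolding sq by (simp add: algebra_simps)
  then have "((1 - t) * (2 * a * b - cos \<alpha> * (a\<^sup>2 + b\<^sup>2)) + t * (2 - 2 * cos \<alpha>)) / (\<sigma> * sin \<alpha>)
      \<le> (2 * A * B - cos \<alpha> * (A\<^sup>2 + B\<^sup>2)) / (\<sigma> * sin \<alpha>)"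
    using S by (intro divide_right_mono) auto
  then show ?thesis unfolding div by (simp add: add_divide_distrib)
qed

text \<open>The quotient is \<open>2 tan (\<alpha> / 2)\<close>.\<close>

lemma bend_unit_pos:
  assumes "\<sigma> * \<sigma> = (1::real)" "0 < \<sigma> * \<alpha>" "\<sigma> * \<alpha> < pi"
  shows "\<sigma> * ((2 - 2 * cos \<alpha>) / sin \<alpha>) > 0"
proof -
  have S: "\<sigma> * sin \<alpha> > 0" using sign_sin_pos assms by blast
  have "cos \<alpha> < 1"
  proof (rule ccontr)
    assume "\<not> cos \<alpha> < 1"
    then have "cos \<alpha> = 1" using cos_le_one[of \<alpha>] by simp
    then have "sin \<alpha> = 0" using sin_cos_squared_add[of \<alpha>] by simp
    then show False using S by simp
  qed
  moreover have "\<sigma> * ((2 - 2 * cos \<alpha>) / sin \<alpha>) = (2 - 2 * cos \<alpha>) / (\<sigma> * sin \<alpha>)"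
  proof -
    have "\<sigma> * (X / Y) = X / (\<sigma> * Y)" for X Y :: real
      using sign_cases[OF assms(1)] by auto
    then show ?thesis .
  qed
  ultimately show ?thesis using S by simp
qed

lemma total_bend_polar:
  assumes "polygon s N \<theta> m" "\<And>k. s k * s k = 1"
  shows "total_bend N \<theta> m = (\<Sum>k<N. (2 * m k * m (Suc k) - cos (\<theta> (Suc k) - \<theta> k) * ((m k)\<^sup>2 + (m (Suc k))\<^sup>2)) / sin (\<theta> (Suc k) - \<theta> k))"
  unfolding total_bend_def
proof (intro sum.cong HOL.refl)
  fix k assume "k \<in> {..<N}"
  then show "bend (vtx \<theta> m k) (vtx \<theta> m (Suc k)) = (2 * m k * m (Suc k) - cos (\<theta> (Suc k) - \<theta> k) * ((m k)\<^sup>2 + (m (Suc k))\<^sup>2)) / sin (\<theta> (Suc k) - \<theta> k)"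
    unfolding vtx_def using assms sign_sin_pos[OF assms(2), of k "\<theta> (Suc k) - \<theta> k"]
    by (intro bend_polar) (auto simp: polygon_def)
qed

lemma total_bend_unit_pos:
  assumes "polygon s N \<theta> (\<lambda>_. 1)" "\<And>k. s k = \<sigma>" "\<sigma> * \<sigma> = 1" "N > 0"
  shows "\<sigma> * total_bend N \<theta> (\<lambda>_. 1) > 0"
proof -
  have "\<sigma> * total_bend N \<theta> (\<lambda>_. 1) = (\<Sum>k<N. \<sigma> * ((2 - 2 * cos (\<theta> (Suc k) - \<theta> k)) / sin (\<theta> (Suc k) - \<theta> k)))"
    using total_bend_polar[OF assms(1)] assms(2,3) by (simp add: sum_distrib_left mult.commute)
  also have "\<dots> > 0"
    using assms by (intro sum_pos bend_unit_pos) (auto simp: polygon_def)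
  finally show ?thesis .
qed

text \<open>Both ends of the chord are positive, the first by assumption and the unit end for all
  angles. The equation \<open>m N = m 0\<close> survives because all entries change by the same
  formula.\<close>

lemma data1_interpolation:
  assumes d: "data1 s N n \<theta> m" and s: "\<And>k. s k = \<sigma>" "\<sigma> * \<sigma> = 1" and t: "t \<in> {0..1}"
  shows "data1 s N n \<theta> (\<lambda>k. sqrt ((1 - t) * (m k)\<^sup>2 + t))" (is "data1 s N n \<theta> ?m")
proof -
  have p: "polygon s N \<theta> m" using d by (simp add: data1_def)
  have pos: "(1 - t) * (m k)\<^sup>2 + t > 0" if "k \<le> N" for k
    using p that t by (cases "t = 0") (auto simp: polygon_def intro: add_nonneg_pos)
  then have p': "polygon s N \<theta> ?m" using p by (auto simp: polygon_def)
  have N: "N > 0" using d by (cases N) (auto simp: data1_def total_bend_def)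
  have p1: "polygon s N \<theta> (\<lambda>_. 1)" using p by (auto simp: polygon_def)
  have s2: "\<And>k. s k * s k = 1" using s by simp
  let ?\<alpha> = "\<lambda>k. \<theta> (Suc k) - \<theta> k"
  have "(1 - t) * (\<sigma> * total_bend N \<theta> m) + t * (\<sigma> * total_bend N \<theta> (\<lambda>_. 1)) =
    (\<Sum>k<N. (1 - t) * (\<sigma> * ((2 * m k * m (Suc k) - cos (?\<alpha> k) * ((m k)\<^sup>2 + (m (Suc k))\<^sup>2)) / sin (?\<alpha> k)))
       + t * (\<sigma> * ((2 - 2 * cos (?\<alpha> k)) / sin (?\<alpha> k))))"
    unfolding total_bend_polar[OF p s2] total_bend_polar[OF p1 s2]
    by (simp add: sum.distrib sum_distrib_left mult.commute)
  also have "\<dots> \<le> (\<Sum>k<N. \<sigma> * ((2 * ?m k * ?m (Suc k) - cos (?\<alpha> k) * ((?m k)\<^sup>2 + (?m (Suc k))\<^sup>2)) / sin (?\<alpha> k)))"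
    using p t s by (intro sum_mono bend_interpolation) (auto simp: polygon_def)
  also have "\<dots> = \<sigma> * total_bend N \<theta> ?m"
    unfolding total_bend_polar[OF p' s2] by (simp add: sum_distrib_left)
  finally have *: "(1 - t) * (\<sigma> * total_bend N \<theta> m) + t * (\<sigma> * total_bend N \<theta> (\<lambda>_. 1)) \<le> \<sigma> * total_bend N \<theta> ?m" .
  have "\<sigma> * total_bend N \<theta> m > 0" "\<sigma> * total_bend N \<theta> (\<lambda>_. 1) > 0"
    using d s total_bend_unit_pos[OF p1 s N] by (auto simp: data1_def)
  then have "(1 - t) * (\<sigma> * total_bend N \<theta> m) + t * (\<sigma> * total_bend N \<theta> (\<lambda>_. 1)) > 0"
    using t by (cases "t = 0") (auto intro: add_nonneg_pos)
  with * have "\<sigma> * total_bend N \<theta> ?m > 0" by linarith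
  with p' d s show ?thesis by (simp add: data1_def)
qed

lemma polygon_convex:
  assumes "polygon s N \<theta> m" "polygon s N \<theta>' m'" "t \<in> {0..1}"
  shows "polygon s N (\<lambda>k. (1 - t) * \<theta> k + t * \<theta>' k) (\<lambda>k. (1 - t) * m k + t * m' k)"
proof -
  have conv: "0 < (1 - t) * a + t * b \<and> (1 - t) * a + t * b < c" if "0 < a" "0 < b" "a < c" "b < c" for a b c :: real
    using convex_bound_lt[of a c b "1 - t" t] convex_bound_lt[of "- a" 0 "- b" "1 - t" t] assms(3) that
    by simp
  have conv0: "0 < (1 - t) * a + t * b" if "0 < a" "0 < b" for a b :: real
    using conv[OF that, of "max a b + 1"] by simp
  have "s k * (((1 - t) * \<theta> (Suc k) + t * \<theta>' (Suc k)) - ((1 - t) * \<theta> k + t * \<theta>' k)) =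
    (1 - t) * (s k * (\<theta> (Suc k) - \<theta> k)) + t * (s k * (\<theta>' (Suc k) - \<theta>' k))" for k
    by (simp add: algebra_simps)
  then show ?thesis
    using assms(1,2) conv conv0 by (simp add: polygon_def)
qed

lemma conf1_unit:
  assumes d: "data1 s N n \<theta> m" and s: "\<And>k. s k = \<sigma>" "\<sigma> * \<sigma> = 1"
  shows "connected_component (configs (Suc N) s n) (conf1 s N \<theta> m) (conf1 s N \<theta> (\<lambda>_. 1))"
proof -
  have m: "m k > 0" if "k \<le> N" for k using d that by (auto simp: data1_def polygon_def)
  define M where "M t k = sqrt ((1 - t) * (m k)\<^sup>2 + t)" for t :: real and k
  have "connected_component (configs (Suc N) s n) (conf1 s N \<theta> (M 0)) (conf1 s N \<theta> (M 1))"
  proof (rule conf1_path[where \<theta> = "\<lambda>_. \<theta>"])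
    show "continuous_on {0..1} (\<lambda>t. M t k)" for k
      unfolding M_def by (intro continuous_intros)
    show "data1 s N n \<theta> (M t)" if "t \<in> {0..1}" for t
      using data1_interpolation[OF d s that] by (simp add: M_def[abs_def])
    show "s k * s k = 1" for k using s by simp
  qed simp
  moreover have "conf1 s N \<theta> (M 0) = conf1 s N \<theta> m"
  proof -
    have v: "vtx \<theta> (M 0) k = vtx \<theta> m k" if "k \<le> N" for k
      using m[OF that] by (simp add: M_def vtx_def)
    then have "total_bend N \<theta> (M 0) = total_bend N \<theta> m"
      unfolding total_bend_def by (intro sum.cong) auto
    with v show ?thesis by (intro ext) (simp add: conf1_def)
  qed
  moreover have "M 1 = (\<lambda>_. 1)" by (simp add: M_def fun_eq_iff)
  ultimately show ?thesis by simp
qed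

text \<open>Retract both configurations to unit lengths. There the shear has the right sign for all
  angles of a polygon, and the remaining conditions on the angles are convex.\<close>

lemma conf1_connected:
  assumes d: "data1 s N n \<theta> m" "data1 s N n \<theta>' m'" and s: "\<And>k. s k = \<sigma>" "\<sigma> * \<sigma> = 1"
  shows "connected_component (configs (Suc N) s n) (conf1 s N \<theta> m) (conf1 s N \<theta>' m')"
proof -
  have p: "polygon s N \<theta> (\<lambda>_. 1)" "polygon s N \<theta>' (\<lambda>_. 1)"
    using d by (auto simp: data1_def polygon_def)
  have N: "N > 0" using d(1) by (cases N) (auto simp: data1_def total_bend_def)
  define \<Theta> where "\<Theta> t k = (1 - t) * \<theta> k + t * \<theta>' k" for t :: real and k
  have d\<Theta>: "data1 s N n (\<Theta> t) (\<lambda>_. 1)" if t: "t \<in> {0..1}" for t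
  proof -
    have "polygon s N (\<Theta> t) (\<lambda>_. 1)"
      using polygon_convex[OF p t] by (simp add: \<Theta>_def[abs_def])
    moreover have "\<Theta> t N = \<Theta> t 0 + of_int n * pi"
      using d by (simp add: data1_def \<Theta>_def algebra_simps)
    moreover have "s N * total_bend N (\<Theta> t) (\<lambda>_. 1) > 0"
      using total_bend_unit_pos[OF calculation(1) s N] unfolding s(1) .
    ultimately show ?thesis by (simp add: data1_def)
  qed
  have "connected_component (configs (Suc N) s n) (conf1 s N (\<Theta> 0) (\<lambda>_. 1)) (conf1 s N (\<Theta> 1) (\<lambda>_. 1))"
  proof (rule conf1_path[where m = "\<lambda>_ _. 1"])
    show "continuous_on {0..1} (\<lambda>t. \<Theta> t k)" for k
      unfolding \<Theta>_def by (intro continuous_intros)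
    show "s k * s k = 1" for k using s by simp
  qed (simp, rule d\<Theta>)
  moreover have "\<Theta> 0 = \<theta>" "\<Theta> 1 = \<theta>'" by (simp_all add: \<Theta>_def fun_eq_iff)
  ultimately have "connected_component (configs (Suc N) s n) (conf1 s N \<theta> (\<lambda>_. 1)) (conf1 s N \<theta>' (\<lambda>_. 1))"
    by simp
  then show ?thesis
    using conf1_unit[OF d(1) s] conf1_unit[OF d(2) s] by (meson connected_component_sym connected_component_trans)
qed

section \<open>Configurations completed by a cancelling pair\<close>

definition data2 :: "(nat \<Rightarrow> real) \<Rightarrow> nat \<Rightarrow> int \<Rightarrow> (nat \<Rightarrow> real) \<Rightarrow> (nat \<Rightarrow> real) \<Rightarrow> real \<Rightarrow> bool" where
  "data2 s N n \<theta> m e \<longleftrightarrow> polygon s N \<theta> m \<and> \<theta> N = \<theta> 0 + of_int n * pi \<and> m N < m 0 \<and> e > 0"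

text \<open>The last vertex of the polygon; the parameter \<open>e\<close> makes the total shear vanish
  while keeping the apex on the correct side.\<close>

definition slope :: "(nat \<Rightarrow> real) \<Rightarrow> nat \<Rightarrow> (nat \<Rightarrow> real) \<Rightarrow> (nat \<Rightarrow> real) \<Rightarrow> real \<Rightarrow> real" where
  "slope s N \<theta> m e = e - s N * total_bend N \<theta> m / ((m 0)\<^sup>2 - (m N)\<^sup>2)"

definition apex :: "(nat \<Rightarrow> real) \<Rightarrow> nat \<Rightarrow> (nat \<Rightarrow> real) \<Rightarrow> (nat \<Rightarrow> real) \<Rightarrow> real \<Rightarrow> complex" where
  "apex s N \<theta> m e = of_real (2 / (e * (m 0 + m N))) * (of_real (slope s N \<theta> m e) + \<i> * of_real (s N)) * cis (\<theta> N)"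

definition conf2 :: "(nat \<Rightarrow> real) \<Rightarrow> nat \<Rightarrow> int \<Rightarrow> (nat \<Rightarrow> real) \<Rightarrow> (nat \<Rightarrow> real) \<Rightarrow> real \<Rightarrow> nat \<Rightarrow> complex" where
  "conf2 s N n \<theta> m e k = (if k < N then step (s k) (vtx \<theta> m k) (vtx \<theta> m (Suc k))
     else if k = N then step (s N) (vtx \<theta> m N) (apex s N \<theta> m e)
     else if k = Suc N then step (s (Suc N)) (apex s N \<theta> m e) (of_real (sgn_int n) * vtx \<theta> m 0) else 0)"

lemma wedge_apex:
  fixes a g c \<sigma> t :: real
  defines "y \<equiv> of_real a * cis t" and "w \<equiv> of_real g * (of_real c + \<i> * of_real \<sigma>) * cis t"
  shows "wedge y w = a * g * \<sigma>" "Re (w * cnj y) = a * g * c"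
proof -
  have "w * cnj y = of_real (a * g) * (of_real c + \<i> * of_real \<sigma>) * (cis t * cnj (cis t))"
    by (simp add: y_def w_def mult_ac)
  also have "cis t * cnj (cis t) = 1"
    by (simp add: cis_cnj cis_mult)
  finally have "w * cnj y = of_real (a * g) * (of_real c + \<i> * of_real \<sigma>)" by simp
  then show "wedge y w = a * g * \<sigma>" "Re (w * cnj y) = a * g * c"
    by (simp_all add: wedge_eq_Im)
qed

text \<open>As \<open>y\<close> is a positive multiple of \<open>z\<close>, the ratio
  \<open>z / w\<close> is a positive multiple of the inverse of the nonreal number
  \<open>w / y\<close>. The arguments are opposite, so the pair does not contribute to the
  turning.\<close>

lemma pair_turning:
  assumes "y = of_real l * z" "l > 0" "wedge y w \<noteq> 0"
  shows "Arg (w / y) + Arg (z / w) = 0"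
proof -
  have nz: "z \<noteq> 0" "w \<noteq> 0" using assms by (auto simp: wedge_def)
  have "w / y \<notin> \<real>"
    using assms(3) by (auto simp: wedge_eq_Im_divide complex_is_Real_iff)
  moreover have "z / w = of_real (1 / l) * inverse (w / y)"
    using assms(1,2) nz by (simp add: field_simps)
  ultimately show ?thesis
    using assms(2) Arg_times_of_real[of "1 / l" "inverse (w / y)"] by (simp add: Arg_inverse del: inverse_divide)
qed

lemma turning_Suc2:
  assumes "orb s \<nu> N x = y" "orb s \<nu> (Suc N) x = w" "orb s \<nu> (Suc (Suc N)) x = z"
    "y = of_real l * z" "l > 0" "wedge y w \<noteq> 0"
  shows "turning (Suc (Suc N)) s \<nu> x = turning N s \<nu> x"
proof -
  have "turning (Suc (Suc N)) s \<nu> x = turning N s \<nu> x + (Arg (w / y) + Arg (z / w))"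
    using assms(1-3) by (simp add: turning_def del: orb.simps)
  then show ?thesis using pair_turning[OF assms(4-6)] by simp
qed

text \<open>Here \<open>g\<close> is the size of the apex and \<open>c\<close> its slope. Expressing
  \<open>g\<close> through \<open>e\<close> makes the two terms share a factor, and the bend of the
  pair becomes proportional to \<open>c - e\<close>. This is the origin of the parameter
  \<open>e\<close>.\<close>

lemma apex_bend_arith:
  fixes M0 MN g e c \<sigma> :: real
  assumes "MN > 0" "g > 0" "g * (e * (M0 + MN)) = 2" "\<sigma> * \<sigma> = 1"
  defines "l \<equiv> M0 / MN"
  shows "(2 * (1 - l) - 1 / MN * g * c / (1 / MN\<^sup>2) * (1 - l\<^sup>2)) / (1 / MN * g * \<sigma>) = \<sigma> * ((c - e) * (M0\<^sup>2 - MN\<^sup>2))"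
proof -
  have "2 * (1 - l) - 1 / MN * g * c / (1 / MN\<^sup>2) * (1 - l\<^sup>2) =
      (g * (e * (M0 + MN))) * (1 - l) - 1 / MN * g * c / (1 / MN\<^sup>2) * (1 - l\<^sup>2)"
    by (simp only: assms(3))
  also have "\<dots> = (1 / MN * g) * ((c - e) * (M0\<^sup>2 - MN\<^sup>2))"
    using assms(1) by (simp add: l_def field_simps power2_eq_square)
  finally show ?thesis
    using assms(1,2) sign_cases[OF assms(4)] by auto
qed

text \<open>Relative to the direction of vertex \<open>N\<close>, the imaginary part of the apex has
  the sign \<open>s N\<close> whatever the slope, so the turn is correct. The slope is left free to
  cancel the bend of the head, which is possible since \<open>m N < m 0\<close>.\<close>

lemma data2_facts:
  assumes d: "data2 s N n \<theta> m e" and s: "\<And>k. s k * s k = 1"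
  defines "z \<equiv> of_real (sgn_int n) * vtx \<theta> m 0" and "l \<equiv> m 0 / m N" and "w \<equiv> apex s N \<theta> m e"
  shows "0 < m N" "l > 1" "vtx \<theta> m N = of_real l * z" "s N * wedge (vtx \<theta> m N) w > 0"
    "total_bend N \<theta> m + bend (vtx \<theta> m N) w + bend w z = 0"
proof -
  have m: "0 < m N" "m N < m 0" using d by (auto simp: data2_def polygon_def)
  then show "0 < m N" "l > 1" by (simp_all add: l_def)
  have cN: "cis (\<theta> N) = of_real (sgn_int n) * cis (\<theta> 0)"
    using d by (simp add: data2_def cis_mult[symmetric] cis_of_int_pi)
  have z: "z = of_real (1 / m 0) * cis (\<theta> N)"
    by (simp add: z_def vtx_def cN)
  show y: "vtx \<theta> m N = of_real l * z"
    using m by (simp add: z vtx_def l_def)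
  define g c \<sigma> where "g = 2 / (e * (m 0 + m N))" and "c = slope s N \<theta> m e" and "\<sigma> = s N"
  have g: "g > 0" using m d by (simp add: g_def data2_def)
  have \<sigma>: "\<sigma> * \<sigma> = 1" "\<sigma> \<noteq> 0" using s[of N] by (auto simp: \<sigma>_def)
  have w: "w = of_real g * (of_real c + \<i> * of_real \<sigma>) * cis (\<theta> N)"
    by (simp add: w_def apex_def g_def c_def \<sigma>_def)
  have W: "wedge (vtx \<theta> m N) w = 1 / m N * g * \<sigma>" and P: "Re (w * cnj (vtx \<theta> m N)) = 1 / m N * g * c"
    unfolding w vtx_def by (rule wedge_apex)+
  show pos: "s N * wedge (vtx \<theta> m N) w > 0"
    using g m \<sigma> by (simp add: W \<sigma>_def[symmetric]) (simp add: mult.left_commute[of \<sigma>])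
  then have Wz: "wedge z w \<noteq> 0" unfolding y wedge_scale_left by auto
  have z0: "z \<noteq> 0" using Wz by (auto simp: wedge_def)
  have y2: "(cmod (vtx \<theta> m N))\<^sup>2 = 1 / (m N)\<^sup>2"
    using m by (simp add: vtx_def norm_mult norm_divide power_divide)
  have "bend (vtx \<theta> m N) w + bend w z = (2 * (1 - l) - Re (w * cnj (vtx \<theta> m N)) / (cmod (vtx \<theta> m N))\<^sup>2 * (1 - l\<^sup>2)) / wedge (vtx \<theta> m N) w"
    using bend_pair[of l 1 z w, folded y] \<open>l > 1\<close> z0 Wz by simp
  also have "\<dots> = (2 * (1 - l) - 1 / m N * g * c / (1 / (m N)\<^sup>2) * (1 - l\<^sup>2)) / (1 / m N * g * \<sigma>)"
    by (simp only: P W y2)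
  also have "\<dots> = \<sigma> * ((c - e) * ((m 0)\<^sup>2 - (m N)\<^sup>2))"
    unfolding l_def by (rule apex_bend_arith) (use m d g \<sigma> in \<open>simp_all add: g_def data2_def\<close>)
  also have "\<sigma> * ((c - e) * ((m 0)\<^sup>2 - (m N)\<^sup>2)) = - total_bend N \<theta> m"
  proof -
    have "(m 0)\<^sup>2 - (m N)\<^sup>2 \<noteq> 0" using m power_strict_mono[of "m N" "m 0" 2] by simp
    then have "(c - e) * ((m 0)\<^sup>2 - (m N)\<^sup>2) = - \<sigma> * total_bend N \<theta> m"
      by (simp add: c_def slope_def \<sigma>_def)
    then have "\<sigma> * ((c - e) * ((m 0)\<^sup>2 - (m N)\<^sup>2)) = - (\<sigma> * \<sigma>) * total_bend N \<theta> m" by simp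
    then show ?thesis using \<sigma> by simp
  qed
  finally show "total_bend N \<theta> m + bend (vtx \<theta> m N) w + bend w z = 0" by simp
qed

lemma conf2_configs:
  assumes d: "data2 s N n \<theta> m e" and s: "\<And>k. s k * s k = 1" and sN: "s (Suc N) = - s N"
  shows "conf2 s N n \<theta> m e \<in> configs (Suc (Suc N)) s n"
proof -
  let ?\<nu> = "conf2 s N n \<theta> m e" and ?x = "vtx \<theta> m 0" and ?w = "apex s N \<theta> m e"
  have p: "polygon s N \<theta> m" using d by (simp add: data2_def)
  note f = data2_facts[OF d s]
  have "\<forall>k<N. ?\<nu> k = step (s k) (vtx \<theta> m k) (vtx \<theta> m (Suc k))"
    by (simp add: conf2_def)
  note po = polygon_orbit[OF p s this]
  have x: "?x \<noteq> 0" using p by (simp add: polygon_def vtx_nonzero)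
  have oN: "orb s ?\<nu> N ?x = vtx \<theta> m N" by (rule po(1)) simp
  have \<nu>N: "?\<nu> N = step (s N) (vtx \<theta> m N) ?w" "?\<nu> (Suc N) = step (s (Suc N)) ?w (of_real (sgn_int n) * ?x)"
    by (simp_all add: conf2_def)
  have sh: "shear s ?\<nu> N ?x + bend (vtx \<theta> m N) ?w + bend ?w (of_real (sgn_int n) * ?x) = 0"
    using f(5) po(2)[of N] by simp
  note cl = pair_tail_closes[OF s sN x f(2) oN f(3,4) \<nu>N sh]
  have W: "wedge (vtx \<theta> m N) ?w \<noteq> 0" using f(4) by auto
  show ?thesis
  proof (rule configsI[OF _ _ cl(2) x _ s])
    fix k assume k: "k < Suc (Suc N)"
    have "?\<nu> N \<noteq> 0" unfolding \<nu>N by (rule step_nonzero[OF f(4)])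
    moreover have "?\<nu> (Suc N) \<noteq> 0"
    proof
      assume "?\<nu> (Suc N) = 0"
      then have "transv (s (Suc N)) (?\<nu> (Suc N)) (orb s ?\<nu> (Suc N) ?x) = orb s ?\<nu> (Suc N) ?x"
        by (simp add: transv_def)
      then have "?w = of_real (sgn_int n) * ?x"
        using cl(1) cl(2)[of ?x] by simp
      then show False using W f(3) by (metis mult_zero_right wedge_scale_left wedge_self)
    qed
    ultimately show "?\<nu> k \<noteq> 0"
      using po(5)[of k] k by (cases "k < N"; cases "k = N") (auto simp: less_Suc_eq)
  next
    have "turning (Suc (Suc N)) s ?\<nu> ?x = turning N s ?\<nu> ?x"
      by (rule turning_Suc2[OF oN cl(1) cl(2) f(3)]) (use f(2) W in auto)
    then show "turning (Suc (Suc N)) s ?\<nu> ?x = of_int n * pi"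
      using po(3)[of N] d by (simp add: data2_def)
  qed (simp add: conf2_def)
qed

text \<open>In the frame of vertex \<open>N\<close>, an apex on the correct side is a positive
  multiple of \<open>c + \<i> * s N\<close>. The multiple determines \<open>e\<close>, and the shear
  equation identifies \<open>c\<close> with the slope.\<close>

lemma generic2_conf2:
  assumes \<nu>: "\<nu> \<in> configs (Suc (Suc N)) s n" and s: "\<And>k. s k * s k = 1"
    and sN: "s (Suc N) = - s N" and g: "generic2 s N n \<nu>"
  obtains \<theta> m e where "data2 s N n \<theta> m e" "\<nu> = conf2 s N n \<theta> m e"
proof -
  obtain x l where x: "x \<noteq> 0" "l > 1" and o: "orb s \<nu> N x = of_real (sgn_int n * l) * x"
    and f: "fixed_steps s \<nu> N x = {}"
    using g unfolding generic2_def by blast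
  define z w where "z = of_real (sgn_int n) * x" and "w = orb s \<nu> (Suc N) x"
  note pt = pair_tail_shear[OF \<nu> s x o, folded w_def z_def]
  define \<theta> where "\<theta> = (\<lambda>k. Arg x + turning k s \<nu> x)"
  define m where "m = (\<lambda>k. 1 / cmod (orb s \<nu> k x))"
  note po = polygon_of_orbit[OF s x(1) f, folded \<theta>_def m_def]
  have v0: "vtx \<theta> m 0 = x" using po(2)[of 0] by simp
  have vN: "vtx \<theta> m N = orb s \<nu> N x" by (rule po(2))
  have yz: "vtx \<theta> m N = of_real l * z" by (simp add: vN o z_def)
  have K: "shear s \<nu> N x = total_bend N \<theta> m"
    using polygon_orbit(2)[OF po(1) s po(3), of N] v0 by simp
  have W0: "wedge (vtx \<theta> m N) w \<noteq> 0" using pt(1) vN by auto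
  have "turning (Suc (Suc N)) s \<nu> x = turning N s \<nu> x"
    by (rule turning_Suc2[where y = "vtx \<theta> m N" and w = w and z = z and l = l])
      (use vN w_def configs_orb[OF \<nu>, of x] yz x W0 in \<open>simp_all add: z_def del: orb.simps\<close>)
  then have t: "turning N s \<nu> x = of_int n * pi"
    using \<nu> x by (simp add: configs_def)
  have m: "m N > 0" "m 0 > 0" "l = m 0 / m N"
    using x by (simp_all add: m_def o norm_mult sgn_int_def)
  define q where "q = w * cnj (cis (\<theta> N))"
  have wq: "w = q * cis (\<theta> N)"
    by (simp add: q_def mult.assoc cis_cnj cis_mult)
  define gg c where "gg = s N * Im q" and "c = Re q / gg"
  define e where "e = 2 / (gg * (m 0 + m N))"
  have "wedge (vtx \<theta> m N) w = Im q / m N"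
    using wedge_apex(1)[of "1 / m N" "\<theta> N" 1 "Re q" "Im q"]
    by (simp add: vtx_def wq complex_eq[of q, symmetric])
  then have "s N * (Im q / m N) > 0" using pt(1) vN by simp
  then have gg: "gg > 0" using m by (simp add: gg_def zero_less_divide_iff)
  have "s N * gg = (s N * s N) * Im q" by (simp add: gg_def)
  then have Imq: "Im q = gg * s N" using s by (simp add: mult.commute)
  have "q = of_real gg * (of_real c + \<i> * of_real (s N))"
    using gg Imq by (simp add: complex_eq_iff c_def)
  then have w: "w = of_real gg * (of_real c + \<i> * of_real (s N)) * cis (\<theta> N)"
    by (simp add: wq)
  have e: "e > 0" "2 / (e * (m 0 + m N)) = gg" "gg * (e * (m 0 + m N)) = 2"
  proof -
    have "2 / (2 / (gg * M) * M) = gg" "gg * (2 / (gg * M) * M) = 2" "2 / (gg * M) > 0" if "M > 0" for M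
      using gg that by simp_all
    from this[of "m 0 + m N"] m show "e > 0" "2 / (e * (m 0 + m N)) = gg" "gg * (e * (m 0 + m N)) = 2"
      unfolding e_def by auto
  qed
  have d: "data2 s N n \<theta> m e"
    unfolding data2_def
  proof (intro conjI po(1) e)
    show "\<theta> N = \<theta> 0 + of_int n * pi" by (simp add: \<theta>_def t) (simp add: turning_def)
    show "m N < m 0" using x(2) m by (simp add: field_simps)
  qed
  have c: "c = slope s N \<theta> m e"
  proof -
    define D where "D = (m 0)\<^sup>2 - (m N)\<^sup>2"
    have D: "D > 0" using d m power_strict_mono[of "m N" "m 0" 2] by (simp add: D_def data2_def)
    have W: "wedge (vtx \<theta> m N) w = 1 / m N * gg * s N" and P: "Re (w * cnj (vtx \<theta> m N)) = 1 / m N * gg * c"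
      unfolding w vtx_def by (rule wedge_apex)+
    have y2: "(cmod (vtx \<theta> m N))\<^sup>2 = 1 / (m N)\<^sup>2"
      using m by (simp add: vtx_def norm_mult norm_divide power_divide)
    have "l * wedge z w \<noteq> 0" using W0 unfolding yz wedge_scale_left .
    then have "bend (vtx \<theta> m N) w + bend w z = (2 * (1 - l) - Re (w * cnj (vtx \<theta> m N)) / (cmod (vtx \<theta> m N))\<^sup>2 * (1 - l\<^sup>2)) / wedge (vtx \<theta> m N) w"
      using bend_pair[of l 1 z w, folded yz] x by (auto simp: z_def)
    also have "\<dots> = (2 * (1 - l) - 1 / m N * gg * c / (1 / (m N)\<^sup>2) * (1 - l\<^sup>2)) / (1 / m N * gg * s N)"
      by (simp only: P W y2)
    also have "\<dots> = s N * ((c - e) * D)"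
      unfolding m(3) D_def by (rule apex_bend_arith) (rule m(1) gg e(3) s)+
    finally have "total_bend N \<theta> m = - (s N * ((c - e) * D))"
      using pt(5) K vN by simp
    then have "s N * total_bend N \<theta> m = - (s N * s N) * ((c - e) * D)" by simp
    then have "s N * total_bend N \<theta> m = (e - c) * D" using s by (simp add: algebra_simps)
    then show ?thesis using D by (simp add: slope_def D_def[symmetric])
  qed
  have ap: "apex s N \<theta> m e = w" unfolding apex_def w e(2) c ..
  have "\<nu> = conf2 s N n \<theta> m e"
  proof
    fix k
    consider "k < N" | "k = N" | "k = Suc N" | "k > Suc N" by linarith
    then show "\<nu> k = conf2 s N n \<theta> m e k"
    proof cases
      case 1 then show ?thesis using po(3) by (simp add: conf2_def)
    next
      case 2 then show ?thesis using pt(2) by (simp add: conf2_def ap vN)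
    next
      case 3 then show ?thesis using pt(3) by (simp add: conf2_def ap v0 z_def)
    next
      case 4 then show ?thesis using \<nu> by (simp add: conf2_def configs_def)
    qed
  qed
  with d show thesis by (rule that)
qed

text \<open>Once the shear equation is solved for the slope, the conditions in \<open>data2\<close>
  are linear equations and inequalities, so both sets of data are joined by a straight
  segment.\<close>

lemma conf2_connected:
  assumes d: "data2 s N n \<theta> m e" "data2 s N n \<theta>' m' e'" and s: "\<And>k. s k * s k = 1"
    and sN: "s (Suc N) = - s N"
  shows "connected_component (configs (Suc (Suc N)) s n) (conf2 s N n \<theta> m e) (conf2 s N n \<theta>' m' e')"
proof -
  define \<Theta> where "\<Theta> t k = (1 - t) * \<theta> k + t * \<theta>' k" for t :: real and k
  define M where "M t k = (1 - t) * m k + t * m' k" for t :: real and k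
  define E where "E t = (1 - t) * e + t * e'" for t :: real
  have c\<Theta>: "continuous_on {0..1} (\<lambda>t. \<Theta> t k)" for k unfolding \<Theta>_def by (intro continuous_intros)
  have cM: "continuous_on {0..1} (\<lambda>t. M t k)" for k unfolding M_def by (intro continuous_intros)
  have cE: "continuous_on {0..1} E" unfolding E_def by (intro continuous_intros)
  have D: "data2 s N n (\<Theta> t) (M t) (E t)" if t: "t \<in> {0..1}" for t
    unfolding data2_def
  proof (intro conjI)
    show "polygon s N (\<Theta> t) (M t)"
      using polygon_convex[of s N \<theta> m \<theta>' m' t] d t by (simp add: data2_def \<Theta>_def[abs_def] M_def[abs_def])
    show "\<Theta> t N = \<Theta> t 0 + of_int n * pi"
      using d by (simp add: data2_def \<Theta>_def algebra_simps)
    have "M t N - M t 0 = (1 - t) * (m N - m 0) + t * (m' N - m' 0)"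
      by (simp add: M_def algebra_simps)
    then show "M t N < M t 0"
      using convex_bound_lt[of "m N - m 0" 0 "m' N - m' 0" "1 - t" t] d t by (simp add: data2_def)
    show "E t > 0"
      using convex_bound_lt[of "- e" 0 "- e'" "1 - t" t] d t by (simp add: data2_def E_def)
  qed
  have p: "polygon s N (\<Theta> t) (M t)" if "t \<in> {0..1}" for t using D[OF that] by (simp add: data2_def)
  have Mpos: "M t j > 0" if "t \<in> {0..1}" "j \<le> N" for t j
    using p[OF that(1)] that(2) by (auto simp: polygon_def)
  note f = data2_facts[OF D s]
  have cv: "continuous_on {0..1} (\<lambda>t. vtx (\<Theta> t) (M t) k)" if "k \<le> N" for k
    using Mpos that by (intro continuous_on_vtx c\<Theta> cM) force
  have cap: "continuous_on {0..1} (\<lambda>t. apex s N (\<Theta> t) (M t) (E t))"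
  proof -
    have "E t \<noteq> 0 \<and> M t 0 + M t N \<noteq> 0 \<and> (M t 0)\<^sup>2 - (M t N)\<^sup>2 \<noteq> 0" if "t \<in> {0..1}" for t
      using D[OF that] Mpos[OF that, of 0] Mpos[OF that, of N] power_strict_mono[of "M t N" "M t 0" 2]
      by (auto simp: data2_def)
    then show ?thesis
      unfolding apex_def slope_def
      by (intro continuous_intros c\<Theta> cM cE continuous_on_total_bend[where s = s] p s) auto
  qed
  have "connected_component (configs (Suc (Suc N)) s n) (conf2 s N n (\<Theta> 0) (M 0) (E 0)) (conf2 s N n (\<Theta> 1) (M 1) (E 1))"
  proof (rule connected_component_path[where c = "\<lambda>t. conf2 s N n (\<Theta> t) (M t) (E t)"])
    show "conf2 s N n (\<Theta> t) (M t) (E t) \<in> configs (Suc (Suc N)) s n" if "t \<in> {0..1}" for t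
      by (rule conf2_configs[OF D[OF that] s sN])
    fix k
    consider "k < N" | "k = N" | "k = Suc N" | "k > Suc N" by linarith
    then show "continuous_on {0..1} (\<lambda>t. conf2 s N n (\<Theta> t) (M t) (E t) k)"
    proof cases
      case 1
      then have "continuous_on {0..1} (\<lambda>t. step (s k) (vtx (\<Theta> t) (M t) k) (vtx (\<Theta> t) (M t) (Suc k)))"
        using polygon_wedge[OF p _ s, of _ k] by (intro continuous_on_step cv) auto
      with 1 show ?thesis by (simp add: conf2_def)
    next
      case 2
      have "continuous_on {0..1} (\<lambda>t. step (s N) (vtx (\<Theta> t) (M t) N) (apex s N (\<Theta> t) (M t) (E t)))"
        by (intro continuous_on_step cv cap f(4)) auto
      with 2 show ?thesis by (simp add: conf2_def)
    next
      case 3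
      have "s (Suc N) * wedge (apex s N (\<Theta> t) (M t) (E t)) (of_real (sgn_int n) * vtx (\<Theta> t) (M t) 0) > 0"
        if t: "t \<in> {0..1}" for t
      proof -
        define z w l where "z = of_real (sgn_int n) * vtx (\<Theta> t) (M t) 0" and "w = apex s N (\<Theta> t) (M t) (E t)"
          and "l = M t 0 / M t N"
        have l: "l > 1" using f(2)[OF t] by (simp add: l_def)
        have "s N * wedge (of_real l * z) w > 0"
          using f(4)[OF t] f(3)[OF t] by (simp add: z_def w_def l_def)
        then have "l * (s N * wedge z w) > 0" unfolding wedge_scale_left by (simp add: mult_ac)
        then have "s N * wedge z w > 0" using l by (simp add: zero_less_mult_iff)
        then show ?thesis using wedge_commute[of w z] sN by (simp add: z_def w_def)
      qed
      then have "continuous_on {0..1} (\<lambda>t. step (s (Suc N)) (apex s N (\<Theta> t) (M t) (E t)) (of_real (sgn_int n) * vtx (\<Theta> t) (M t) 0))"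
        by (intro continuous_on_step continuous_intros cv cap) auto
      with 3 show ?thesis by (simp add: conf2_def)
    next
      case 4
      then show ?thesis by (simp add: conf2_def)
    qed
  qed
  moreover have "\<Theta> 0 = \<theta>" "\<Theta> 1 = \<theta>'" "M 0 = m" "M 1 = m'" "E 0 = e" "E 1 = e'"
    by (simp_all add: \<Theta>_def M_def E_def fun_eq_iff)
  ultimately show ?thesis by simp
qed

section \<open>Connectedness and emptiness of the configuration spaces\<close>

text \<open>Components are closed relative to \<open>C\<close>, so a component containing all points
  with property \<open>G\<close> contains their limits in \<open>C\<close>.\<close>

lemma connected_component_closure:
  fixes C :: "(nat \<Rightarrow> complex) set"
  assumes "\<nu> \<in> C" "\<nu> \<in> closure {\<mu> \<in> C. G \<mu>}" "\<And>\<mu>. \<mu> \<in> C \<Longrightarrow> G \<mu> \<Longrightarrow> connected_component C \<mu>0 \<mu>"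
  shows "connected_component C \<mu>0 \<nu>"
proof -
  obtain T where T: "closed T" "connected_component_set C \<mu>0 = C \<inter> T"
    using closedin_connected_component[of C \<mu>0] unfolding closedin_closed by blast
  have "{\<mu> \<in> C. G \<mu>} \<subseteq> T" using assms(3) T(2) by auto
  then have "closure {\<mu> \<in> C. G \<mu>} \<subseteq> T" by (rule closure_minimal) fact
  then have "\<nu> \<in> C \<inter> T" using assms by auto
  then show ?thesis unfolding T(2)[symmetric] by simp
qed

lemma connected_if_components:
  assumes "\<And>\<nu>. \<nu> \<in> C \<Longrightarrow> connected_component C \<mu>0 \<nu>"
  shows "connected C"
  unfolding connected_iff_connected_component
proof (intro ballI)
  fix \<nu> \<mu> assume "\<nu> \<in> C" "\<mu> \<in> C"
  then show "connected_component C \<nu> \<mu>"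
    using connected_component_trans[OF connected_component_sym[OF assms] assms] by blast
qed

lemma fixed_parallel:
  assumes "transv s \<nu> x = x" "s \<noteq> 0" "x \<noteq> 0"
  shows "\<nu> = of_real (cmod \<nu> / (cmod x)\<^sup>2) * x\<^sup>2"
proof -
  have "\<nu> * cnj x * x = of_real (cmod \<nu>) * x * x"
    using assms transv_fixed_iff by simp
  moreover have "\<nu> * cnj x * x = \<nu> * of_real ((cmod x)\<^sup>2)"
    using complex_norm_square[of x] by (simp add: mult_ac)
  ultimately show ?thesis using assms(3) by (simp add: field_simps power2_eq_square)
qed

lemma parallel_orbit:
  assumes "x \<noteq> 0" "\<And>k. k < p \<Longrightarrow> \<nu> k = of_real (r k) * x\<^sup>2 \<and> r k \<ge> 0"
  shows "k \<le> p \<Longrightarrow> orb s \<nu> k x = x" "k \<le> p \<Longrightarrow> shear s \<nu> k x = - (\<Sum>j<k. s j * r j)"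
proof -
  show o: "k \<le> p \<Longrightarrow> orb s \<nu> k x = x" for k
    by (induction k) (auto simp: assms(2) transv_parallel)
  show "k \<le> p \<Longrightarrow> shear s \<nu> k x = - (\<Sum>j<k. s j * r j)"
  proof (induction k)
    case 0
    show ?case by (rule shear_unique[OF assms(1)]) simp
  next
    case (Suc k)
    then show ?case
      using shear_Suc_parallel[of x "r k" \<nu> k s] assms o[of k] by simp
  qed
qed

text \<open>Transvections along one vector commute, their signed parameters add up, and none of them
  turns that vector. Hence the turning is \<open>0\<close>, and the product is trivial exactly if
  the signed sum vanishes.\<close>

lemma parallel_configs_iff:
  assumes "x \<noteq> 0" "\<And>k. k < p \<Longrightarrow> \<nu> k = of_real (r k) * x\<^sup>2 \<and> r k > 0" "\<And>k. k \<ge> p \<Longrightarrow> \<nu> k = 0"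
    and s: "\<And>k. s k * s k = 1"
  shows "\<nu> \<in> configs p s n \<longleftrightarrow> n = 0 \<and> (\<Sum>j<p. s j * r j) = 0"
proof -
  have o: "orb s \<nu> k x = x" if "k \<le> p" for k
    using parallel_orbit(1)[OF assms(1), of p \<nu> r k s] assms(2) that by (simp add: less_imp_le)
  have sh: "shear s \<nu> p x = - (\<Sum>j<p. s j * r j)"
    using parallel_orbit(2)[OF assms(1), of p \<nu> r p s] assms(2) by (simp add: less_imp_le)
  have t: "turning p s \<nu> x = 0"
    unfolding turning_def
  proof (intro sum.neutral ballI)
    fix k assume "k \<in> {..<p}"
    then show "Arg (orb s \<nu> (Suc k) x / orb s \<nu> k x) = 0"
      using o[of k] o[of "Suc k"] assms(1) by (simp del: orb.simps)
  qed
  show ?thesis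
  proof
    assume \<nu>: "\<nu> \<in> configs p s n"
    then have "real_of_int n * pi = 0" using t assms(1) by (simp add: configs_def)
    moreover have "shear s \<nu> p x = 0"
      using orb_scalar_iff[OF assms(1) sgn_int_sq(1), of s \<nu> p] configs_orb[OF \<nu>] by blast
    ultimately show "n = 0 \<and> (\<Sum>j<p. s j * r j) = 0" using sh by simp
  next
    assume *: "n = 0 \<and> (\<Sum>j<p. s j * r j) = 0"
    then have "\<forall>u. orb s \<nu> p u = of_real (sgn_int n) * u"
      using orb_scalar_iff[OF assms(1) sgn_int_sq(1), of s \<nu> p n] o[of p] sh by (simp add: sgn_int_def)
    then show "\<nu> \<in> configs p s n"
      using assms(1,2,3) * t s
      by (intro configsI[OF _ _ _ assms(1)]) (simp_all add: less_imp_neq[symmetric])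
  qed
qed

definition parallel :: "nat \<Rightarrow> (nat \<Rightarrow> complex) \<Rightarrow> bool" where
  "parallel p \<nu> \<longleftrightarrow> (\<exists>x r. x \<noteq> 0 \<and> (\<forall>k<p. \<nu> k = of_real (r k) * x\<^sup>2 \<and> r k > (0::real)))"

text \<open>If the axis of the last transvection is fixed by all the others, it is the axis of all
  of them.\<close>

lemma not_parallel_moves:
  assumes \<nu>: "\<nu> \<in> configs (Suc N) s n" and s: "\<And>k. s k * s k = 1" and np: "\<not> parallel (Suc N) \<nu>"
  shows "fixed_steps s \<nu> N (csqrt (\<nu> N)) \<noteq> {..<N}"
proof
  define x where "x = csqrt (\<nu> N)"
  assume f: "fixed_steps s \<nu> N (csqrt (\<nu> N)) = {..<N}"
  have x: "x \<noteq> 0" using configs_nz[OF \<nu>, of N] by (simp add: x_def)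
  have o: "orb s \<nu> k x = x" if "k \<le> N" for k
    using that
  proof (induction k)
    case (Suc k)
    then have "k \<in> fixed_steps s \<nu> N x" using f by (simp add: x_def)
    with Suc show ?case by (simp add: fixed_steps_def)
  qed simp
  have "\<nu> k = of_real (cmod (\<nu> k) / (cmod x)\<^sup>2) * x\<^sup>2 \<and> cmod (\<nu> k) / (cmod x)\<^sup>2 > 0" if k: "k < Suc N" for k
  proof
    show "cmod (\<nu> k) / (cmod x)\<^sup>2 > 0" using configs_nz[OF \<nu> k] x by simp
    show "\<nu> k = of_real (cmod (\<nu> k) / (cmod x)\<^sup>2) * x\<^sup>2"
    proof (cases "k = N")
      case True
      have "\<nu> N = x\<^sup>2" by (simp add: x_def)
      then show ?thesis using True x by (simp add: norm_power)
    next
      case False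
      then have "transv (s k) (\<nu> k) x = x" using k o[of k] o[of "Suc k"] by simp
      moreover have "s k \<noteq> 0" using s[of k] by auto
      ultimately show ?thesis using x by (rule fixed_parallel)
    qed
  qed
  then have "parallel (Suc N) \<nu>"
    unfolding parallel_def using x
    by (intro exI[of _ x] exI[of _ "\<lambda>k. cmod (\<nu> k) / (cmod x)\<^sup>2"]) simp
  with np show False by blast
qed

lemma moving_dense:
  assumes \<nu>: "\<nu> \<in> configs (Suc N) s n" and s: "\<And>k. s k * s k = 1" and np: "\<not> parallel (Suc N) \<nu>"
  shows "\<nu> \<in> closure {\<mu> \<in> configs (Suc N) s n. generic1 s N \<mu>}"
proof (rule generic1_dense[OF \<nu> s])
  show "csqrt (\<nu> N) = csqrt (\<nu> N)" ..
  show "fixed_steps s \<nu> N (csqrt (\<nu> N)) \<noteq> {..<N}"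
    by (rule not_parallel_moves[OF \<nu> s np])
qed

lemma closure_nonempty:
  assumes "\<nu> \<in> closure {\<mu> \<in> C. G \<mu>}"
  shows "\<exists>\<mu>\<in>C. G \<mu>"
proof -
  have "{\<mu> \<in> C. G \<mu>} \<noteq> {}" using assms by (metis closure_empty empty_iff)
  then show ?thesis by auto
qed

text \<open>Equal signs exclude parallel configurations, since positive weights have no vanishing
  sum; thus generic ones are dense. The bounds on \<open>n\<close> come from \<open>N\<close> angles
  of one sign and of size below \<open>pi\<close>, and each admissible \<open>n\<close> is realised
  by unit lengths and equal angles.\<close>

theorem configs_same_sign:
  assumes s: "\<And>k. s k = \<sigma>" "\<sigma> * \<sigma> = 1" and N: "N > 0"
  shows "connected (configs (Suc N) s n)"
    and "configs (Suc N) s n \<noteq> {} \<longleftrightarrow> 0 < \<sigma> * of_int n \<and> \<sigma> * of_int n < N"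
proof -
  have s2: "\<And>k. s k * s k = 1" using s by simp
  have np: "\<not> parallel (Suc N) \<nu>" if \<nu>: "\<nu> \<in> configs (Suc N) s n" for \<nu>
  proof
    assume "parallel (Suc N) \<nu>"
    then obtain x r where x: "x \<noteq> 0" and r: "\<And>k. k < Suc N \<Longrightarrow> \<nu> k = of_real (r k) * x\<^sup>2 \<and> r k > (0::real)"
      unfolding parallel_def by blast
    have "\<And>k. k \<ge> Suc N \<Longrightarrow> \<nu> k = 0" using \<nu> by (simp add: configs_def)
    then have "(\<Sum>j<Suc N. s j * r j) = 0"
      using parallel_configs_iff[where n = n, OF x r _ s2] \<nu> by simp
    then have "\<sigma> * (\<Sum>j<Suc N. r j) = 0" unfolding s(1) sum_distrib_left .
    then have "(\<Sum>j<Suc N. r j) = 0" using s(2) by auto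
    moreover have "(\<Sum>j<Suc N. r j) > 0" using r by (intro sum_pos) auto
    ultimately show False by simp
  qed
  have dense: "\<nu> \<in> closure {\<mu> \<in> configs (Suc N) s n. generic1 s N \<mu>}" if "\<nu> \<in> configs (Suc N) s n" for \<nu>
    using that s2 np[OF that] by (rule moving_dense)
  have d: "\<exists>\<theta> m. data1 s N n \<theta> m \<and> \<mu> = conf1 s N \<theta> m" if "\<mu> \<in> configs (Suc N) s n" "generic1 s N \<mu>" for \<mu>
    using generic1_conf1[OF that(1) s2 that(2)] by blast
  show "connected (configs (Suc N) s n)"
  proof (cases "configs (Suc N) s n = {}")
    case False
    then obtain \<nu> where "\<nu> \<in> configs (Suc N) s n" by blast
    then obtain \<mu>0 where \<mu>0: "\<mu>0 \<in> configs (Suc N) s n" "generic1 s N \<mu>0"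
      using closure_nonempty[OF dense] by blast
    obtain \<theta>0 m0 where 0: "data1 s N n \<theta>0 m0" "\<mu>0 = conf1 s N \<theta>0 m0"
      using d[OF \<mu>0] by blast
    have cc: "connected_component (configs (Suc N) s n) \<mu>0 \<mu>" if \<mu>: "\<mu> \<in> configs (Suc N) s n" "generic1 s N \<mu>" for \<mu>
    proof -
      obtain \<theta> m where 1: "data1 s N n \<theta> m" "\<mu> = conf1 s N \<theta> m"
        using d[OF \<mu>] by blast
      show ?thesis unfolding 0(2) 1(2) by (rule conf1_connected[OF 0(1) 1(1) s])
    qed
    show ?thesis
      by (rule connected_if_components, rule connected_component_closure[OF _ dense cc])
  qed simp
  show "configs (Suc N) s n \<noteq> {} \<longleftrightarrow> 0 < \<sigma> * of_int n \<and> \<sigma> * of_int n < N"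
  proof
    assume "configs (Suc N) s n \<noteq> {}"
    then obtain \<nu> where "\<nu> \<in> configs (Suc N) s n" by blast
    then obtain \<mu> where "\<mu> \<in> configs (Suc N) s n" "generic1 s N \<mu>"
      using closure_nonempty[OF dense] by blast
    then obtain \<theta> m where "data1 s N n \<theta> m"
      using d by blast
    then have th: "\<theta> N = \<theta> 0 + of_int n * pi" and inc: "\<And>k. k < N \<Longrightarrow> 0 < \<sigma> * (\<theta> (Suc k) - \<theta> k) \<and> \<sigma> * (\<theta> (Suc k) - \<theta> k) < pi"
      using s by (auto simp: data1_def polygon_def)
    have "(\<Sum>k<N. \<sigma> * (\<theta> (Suc k) - \<theta> k)) = \<sigma> * of_int n * pi"
      unfolding sum_distrib_left[symmetric] sum_lessThan_telescope th by simp
    moreover have "(\<Sum>k<N. \<sigma> * (\<theta> (Suc k) - \<theta> k)) > 0"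
      using inc N by (intro sum_pos) auto
    moreover have "(\<Sum>k<N. \<sigma> * (\<theta> (Suc k) - \<theta> k)) < (\<Sum>k<N. pi)"
      using inc N by (intro sum_strict_mono) auto
    ultimately show "0 < \<sigma> * of_int n \<and> \<sigma> * of_int n < N"
      by (simp add: zero_less_mult_iff)
  next
    assume *: "0 < \<sigma> * of_int n \<and> \<sigma> * of_int n < N"
    define \<theta> where "\<theta> k = real k * (of_int n * pi / N)" for k
    have "\<theta> (Suc k) - \<theta> k = of_int n * pi / N" for k
      using N by (simp add: \<theta>_def field_simps)
    then have "\<sigma> * (\<theta> (Suc k) - \<theta> k) = (\<sigma> * of_int n / N) * pi" for k by simp
    moreover have "0 < (\<sigma> * of_int n / N) * pi"
      using * N by simp
    moreover have "(\<sigma> * of_int n / N) * pi < 1 * pi"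
      by (rule mult_strict_right_mono) (use * N in simp_all)
    ultimately have p: "polygon s N \<theta> (\<lambda>_. 1)"
      using s by (simp add: polygon_def)
    have d1: "data1 s N n \<theta> (\<lambda>_. 1)"
      using p N total_bend_unit_pos[OF p s N] unfolding data1_def s(1) by (simp add: \<theta>_def)
    then show "configs (Suc N) s n \<noteq> {}"
      using conf1_configs[OF d1 s2] by blast
  qed
qed

text \<open>Positive weights with vanishing signed sum form a convex set; the common axis is moved
  by interpolating its angle.\<close>

lemma parallel_connected:
  assumes "\<nu> \<in> configs p s n" "\<mu> \<in> configs p s n" "parallel p \<nu>" "parallel p \<mu>" and s: "\<And>k. s k * s k = 1"
  shows "connected_component (configs p s n) \<nu> \<mu>"
proof -
  have normal: "\<exists>\<phi> r. (\<forall>k<p. r k > 0) \<and> \<nu> = (\<lambda>k. if k < p then of_real (r k) * (cis \<phi>)\<^sup>2 else 0)"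
    if \<nu>: "\<nu> \<in> configs p s n" "parallel p \<nu>" for \<nu>
  proof -
    obtain x r where x: "x \<noteq> 0" and r: "\<forall>k<p. \<nu> k = of_real (r k) * x\<^sup>2 \<and> r k > (0::real)"
      using \<nu>(2) unfolding parallel_def by auto
    have "x\<^sup>2 = of_real ((cmod x)\<^sup>2) * (cis (Arg x))\<^sup>2"
      using rcis_cmod_Arg[of x] by (metis of_real_power power_mult_distrib rcis_def)
    then have "\<nu> = (\<lambda>k. if k < p then of_real (r k * (cmod x)\<^sup>2) * (cis (Arg x))\<^sup>2 else 0)"
      using r \<nu>(1) by (auto simp: configs_def fun_eq_iff)
    then show ?thesis
      using r x by (intro exI[of _ "Arg x"] exI[of _ "\<lambda>k. r k * (cmod x)\<^sup>2"]) auto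
  qed
  obtain \<phi> r where r: "\<forall>k<p. r k > (0::real)" and \<nu>: "\<nu> = (\<lambda>k. if k < p then of_real (r k) * (cis \<phi>)\<^sup>2 else 0)"
    using normal[OF assms(1,3)] by auto
  obtain \<psi> q where q: "\<forall>k<p. q k > (0::real)" and \<mu>: "\<mu> = (\<lambda>k. if k < p then of_real (q k) * (cis \<psi>)\<^sup>2 else 0)"
    using normal[OF assms(2,4)] by auto
  have iff: "(\<lambda>k. if k < p then of_real (r k) * (cis \<phi>)\<^sup>2 else 0) \<in> configs p s n \<longleftrightarrow>
      n = 0 \<and> (\<Sum>j<p. s j * r j) = 0" if "\<forall>k<p. r k > 0" for r \<phi>
    by (rule parallel_configs_iff[where x = "cis \<phi>"]) (use that s in auto)
  have n: "n = 0" "(\<Sum>j<p. s j * r j) = 0" "(\<Sum>j<p. s j * q j) = 0"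
    using iff[OF r, of \<phi>] iff[OF q, of \<psi>] assms(1,2) \<nu> \<mu> by auto
  define c where "c t = (\<lambda>k. if k < p then of_real ((1 - t) * r k + t * q k) * (cis ((1 - t) * \<phi> + t * \<psi>))\<^sup>2 else 0)" for t :: real
  have "connected_component (configs p s n) (c 0) (c 1)"
  proof (rule connected_component_path)
    show "continuous_on {0..1} (\<lambda>t. c t k)" for k
      unfolding c_def by (cases "k < p") (auto intro!: continuous_intros)
    show "c t \<in> configs p s n" if t: "t \<in> {0..1}" for t
    proof -
      have "(1 - t) * r k + t * q k > 0" if "k < p" for k
        using convex_bound_lt[of "- r k" 0 "- q k" "1 - t" t] t r q that by simp
      moreover have "(\<Sum>j<p. s j * ((1 - t) * r j + t * q j)) = (1 - t) * (\<Sum>j<p. s j * r j) + t * (\<Sum>j<p. s j * q j)"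
        by (simp add: sum_distrib_left sum.distrib[symmetric] algebra_simps)
      ultimately show ?thesis
        unfolding c_def using n by (subst iff) auto
    qed
  qed
  moreover have "c 0 = \<nu>" "c 1 = \<mu>" by (auto simp: c_def \<nu> \<mu> fun_eq_iff)
  ultimately show ?thesis by simp
qed

section \<open>Counting signs, and the possible sums of angles\<close>

definition pos_count :: "nat \<Rightarrow> (nat \<Rightarrow> real) \<Rightarrow> nat" where
  "pos_count p s = card {k. k < p \<and> s k = 1}"

definition neg_count :: "nat \<Rightarrow> (nat \<Rightarrow> real) \<Rightarrow> nat" where
  "neg_count p s = card {k. k < p \<and> s k = - 1}"

lemma sum_signs:
  assumes "\<And>k. s k * s k = (1::real)"
  shows "(\<Sum>k<p. if s k = 1 then a else b) = real (pos_count p s) * a + real (neg_count p s) * b"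
proof -
  have "{k \<in> {..<p}. s k = 1} = {k. k < p \<and> s k = 1}" "{k \<in> {..<p}. s k \<noteq> 1} = {k. k < p \<and> s k = - 1}"
    using sign_cases[OF assms] by force+
  then show ?thesis
    by (simp add: sum.If_cases pos_count_def neg_count_def Int_def)
qed

lemma count_total:
  assumes "\<And>k. s k * s k = (1::real)"
  shows "real (pos_count p s) + real (neg_count p s) = real p"
  using sum_signs[OF assms, where p = p and a = 1 and b = 1] by simp

lemma polygon_angle_bound:
  assumes "polygon s N \<theta> m" "\<And>k. s k * s k = 1" "\<theta> N = \<theta> 0 + of_int n * pi" "N > 0"
  shows "- int (neg_count N s) < n \<and> n < int (pos_count N s)"
proof -
  have s: "s k = 1 \<or> s k = - 1" for k using sign_cases[OF assms(2)] .
  have inc: "0 < s k * (\<theta> (Suc k) - \<theta> k) \<and> s k * (\<theta> (Suc k) - \<theta> k) < pi" if "k < N" for k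
    using assms(1) that by (simp add: polygon_def)
  have T: "(\<Sum>k<N. \<theta> (Suc k) - \<theta> k) = of_int n * pi"
    unfolding sum_lessThan_telescope assms(3) by simp
  have "(\<Sum>k<N. \<theta> (Suc k) - \<theta> k) < (\<Sum>k<N. if s k = 1 then pi else 0)"
  proof (intro sum_strict_mono)
    fix k assume "k \<in> {..<N}"
    then show "\<theta> (Suc k) - \<theta> k < (if s k = 1 then pi else 0)"
      using inc[of k] s[of k] by auto
  qed (use assms(4) in auto)
  then have "of_int n * pi < real (pos_count N s) * pi"
    using T sum_signs[OF assms(2), where p = N and a = pi and b = 0] by simp
  moreover have "(\<Sum>k<N. if s k = 1 then 0 else - pi) < (\<Sum>k<N. \<theta> (Suc k) - \<theta> k)"
  proof (intro sum_strict_mono)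
    fix k assume "k \<in> {..<N}"
    then show "(if s k = 1 then 0 else - pi) < \<theta> (Suc k) - \<theta> k"
      using inc[of k] s[of k] by auto
  qed (use assms(4) in auto)
  then have "- real (neg_count N s) * pi < of_int n * pi"
    using T sum_signs[OF assms(2), where p = N and a = 0 and b = "- pi"] by simp
  ultimately have "real_of_int n < real (pos_count N s)" "- real (neg_count N s) < real_of_int n"
    by (simp_all only: mult_less_cancel_right_pos[OF pi_gt_zero])
  then show ?thesis by linarith
qed

text \<open>All angles are \<open>\<plusminus>pi / 2\<close> shifted by a common
  \<open>pi * \<eta>\<close>. The prescribed sum determines \<open>\<eta>\<close>, and the bounds on
  \<open>n\<close> say exactly that \<open>\<eta>\<close> lies strictly between
  \<open>-1 / 2\<close> and \<open>1 / 2\<close>.\<close>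

lemma data2_exists:
  assumes s: "\<And>k. s k * s k = 1" and N: "N > 0"
    and n: "- int (neg_count N s) < n" "n < int (pos_count N s)"
  shows "\<exists>\<theta> m. data2 s N n \<theta> m 1"
proof -
  define a b where "a = real (pos_count N s)" and "b = real (neg_count N s)"
  define \<eta> where "\<eta> = (2 * of_int n - a + b) / (2 * N)"
  have ab: "a + b = N" unfolding a_def b_def by (rule count_total[OF s])
  have "- b < of_int n" "of_int n < a" using n by (simp_all add: a_def b_def)
  then have \<eta>: "- 1 / 2 < \<eta>" "\<eta> < 1 / 2"
    using N ab by (simp_all add: \<eta>_def field_simps)
  define \<alpha> where "\<alpha> k = pi * (s k / 2 + \<eta>)" for k
  define \<theta> where "\<theta> k = (\<Sum>j<k. \<alpha> j)" for k
  have sn: "s k = 1 \<or> s k = - 1" for k using sign_cases[OF s] .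
  have "0 < s k * \<alpha> k \<and> s k * \<alpha> k < pi" for k
  proof -
    have "s k * \<alpha> k = pi * (1 / 2 + s k * \<eta>)" using s[of k] by (simp add: \<alpha>_def algebra_simps)
    moreover have "0 < 1 / 2 + s k * \<eta>" "1 / 2 + s k * \<eta> < 1" using \<eta> sn[of k] by auto
    ultimately show ?thesis
      by (metis mult.right_neutral mult_less_cancel_left_pos mult_pos_pos pi_gt_zero)
  qed
  then have "polygon s N \<theta> (\<lambda>k. if k = 0 then 2 else 1)"
    by (simp add: polygon_def \<theta>_def)
  moreover have "\<theta> N = of_int n * pi"
  proof -
    have "(\<Sum>j<N. \<alpha> j) = pi * ((\<Sum>j<N. if s j = 1 then 1 / 2 else - 1 / 2) + N * \<eta>)"
    proof -
      have "\<alpha> j = pi * ((if s j = 1 then 1 / 2 else - 1 / 2) + \<eta>)" for j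
        using sn[of j] by (auto simp: \<alpha>_def)
      then show ?thesis by (simp add: sum_distrib_left[symmetric] sum.distrib)
    qed
    also have "(\<Sum>j<N. if s j = 1 then 1 / 2 else - 1 / 2) = (a - b) / 2"
      unfolding sum_signs[OF s] a_def b_def by (simp add: field_simps)
    also have "N * \<eta> = of_int n - (a - b) / 2"
      using N by (simp add: \<eta>_def field_simps)
    finally show ?thesis by (simp add: \<theta>_def mult.commute)
  qed
  ultimately have "data2 s N n \<theta> (\<lambda>k. if k = 0 then 2 else 1) 1"
    using N by (simp add: data2_def \<theta>_def)
  then show ?thesis by blast
qed

lemma parallel_exists:
  assumes s: "\<And>k. s k * s k = 1" and "pos_count p s > 0" "neg_count p s > 0"
  shows "\<exists>\<nu> \<in> configs p s 0. parallel p \<nu>"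
proof
  \<comment> \<open>Each positive sign gets the number of negative ones as its weight, and
    conversely, so the signed sum vanishes.\<close>
  define r where "r k = (if s k = 1 then real (neg_count p s) else real (pos_count p s))" for k
  define \<nu> where "\<nu> k = (if k < p then of_real (r k) * (1::complex)\<^sup>2 else 0)" for k
  have r: "r k > 0" for k using assms(2,3) by (simp add: r_def)
  have "s j * r j = (if s j = 1 then real (neg_count p s) else - real (pos_count p s))" for j
    using sign_cases[OF s, of j] by (auto simp: r_def)
  then have "(\<Sum>j<p. s j * r j) = (\<Sum>j<p. if s j = 1 then real (neg_count p s) else - real (pos_count p s))"
    by simp
  also have "\<dots> = 0" by (subst sum_signs[OF s]) simp
  finally have 0: "(\<Sum>j<p. s j * r j) = 0" .
  have k: "\<nu> k = of_real (r k) * (1::complex)\<^sup>2 \<and> r k > 0" if "k < p" for k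
    unfolding \<nu>_def using that r[of k] by auto
  show "parallel p \<nu>"
    unfolding parallel_def using k by (intro exI[of _ 1] exI[of _ r]) auto
  show "\<nu> \<in> configs p s 0"
    using parallel_configs_iff[where x = 1 and n = 0 and \<nu> = \<nu> and p = p and r = r and s = s, OF _ k _ s] 0 by (simp add: \<nu>_def)
qed

text \<open>Rotating a cancelling pair away from a parallel configuration.\<close>

lemma parallel_limit_of_nonparallel:
  assumes s: "\<And>k. s k * s k = 1" and sN: "s (Suc N) = - s N" and N: "N > 0"
    and "pos_count N s > 0" "neg_count N s > 0"
  shows "\<exists>\<nu> \<in> configs (Suc (Suc N)) s 0. parallel (Suc (Suc N)) \<nu> \<and>
    \<nu> \<in> closure {\<mu> \<in> configs (Suc (Suc N)) s 0. \<not> parallel (Suc (Suc N)) \<mu>}"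
proof -
  define r where "r k = (if s k = 1 then real (neg_count N s) else real (pos_count N s))" for k
  have r: "r k > 0" for k using assms(4,5) by (simp add: r_def)
  have "s j * r j = (if s j = 1 then real (neg_count N s) else - real (pos_count N s))" for j
    using sign_cases[OF s, of j] by (auto simp: r_def)
  then have "(\<Sum>j<N. s j * r j) = (\<Sum>j<N. if s j = 1 then real (neg_count N s) else - real (pos_count N s))"
    by simp
  also have "\<dots> = 0" by (subst sum_signs[OF s]) simp
  finally have 0: "(\<Sum>j<N. s j * r j) = 0" .
  \<comment> \<open>The first \<open>N\<close> entries balance on their own, and the last two are
    equal with opposite signs. The pair therefore cancels after rotation by any
    \<open>t\<close>.\<close>
  define f where "f t k = (if k < N then of_real (r k) else if k < Suc (Suc N) then cis t else 0)" for t k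
  define q where "q k = (if k < N then r k else 1)" for k
  have f0: "f 0 k = of_real (q k) * (1::complex)\<^sup>2 \<and> q k > 0" if "k < Suc (Suc N)" for k
    using r that by (simp add: f_def q_def)
  have par: "parallel (Suc (Suc N)) (f 0)"
    unfolding parallel_def using f0 by (intro exI[of _ 1] exI[of _ q]) auto
  have "(\<Sum>j<Suc (Suc N). s j * q j) = (\<Sum>j<N. s j * r j) + s N + s (Suc N)"
    by (simp add: q_def)
  then have conf: "f 0 \<in> configs (Suc (Suc N)) s 0"
    using parallel_configs_iff[where x = 1 and n = 0 and \<nu> = "f 0" and p = "Suc (Suc N)" and r = q and s = s, OF _ f0 _ s] 0 sN
    by (simp add: f_def q_def)
  have lim: "((\<lambda>t. f t k) \<longlongrightarrow> f 0 k) (at_right 0)" for k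
    using tendsto_rotation[of 1] by (simp add: f_def)
  have triv: "orb s (f t) (Suc (Suc N)) u = of_real (sgn_int 0) * u" for t u
  proof -
    have k: "f t k = of_real (r k) * (1::complex)\<^sup>2 \<and> r k \<ge> 0" if "k < N" for k
      using that r[of k] by (simp add: f_def)
    have "orb s (f t) N 1 = 1" "shear s (f t) N 1 = - (\<Sum>j<N. s j * r j)"
      using parallel_orbit[where x = 1 and \<nu> = "f t" and p = N and r = r and s = s and k = N, OF _ k]
      by simp_all
    then have "orb s (f t) N u = of_real 1 * u"
      using orb_scalar_iff[of 1 1 s "f t" N] 0 by simp
    then show ?thesis by (simp add: f_def sN sgn_int_def)
  qed
  have ev: "eventually (\<lambda>t. f t \<in> configs (Suc (Suc N)) s 0) (at_right 0)"
  proof (rule configs_eventually[OF conf s lim])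
    show "eventually (\<lambda>t. (\<forall>k\<ge>Suc (Suc N). f t k = 0) \<and>
        (\<forall>x. orb s (f t) (Suc (Suc N)) x = of_real (sgn_int 0) * x)) (at_right 0)"
      using triv by (intro always_eventually) (simp add: f_def del: orb.simps)
  qed
  have np: "\<not> parallel (Suc (Suc N)) (f t)" if t: "0 < t" "t < pi" for t
  proof
    assume "parallel (Suc (Suc N)) (f t)"
    then obtain x q where q: "\<forall>k<Suc (Suc N). f t k = of_real (q k) * x\<^sup>2 \<and> q k > (0::real)"
      unfolding parallel_def by auto
    then have *: "of_real (r 0) = of_real (q 0) * x\<^sup>2 \<and> q 0 > 0" "cis t = of_real (q N) * x\<^sup>2 \<and> q N > 0"
      using N spec[OF q, of 0] spec[OF q, of N] by (simp_all add: f_def)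
    then have "x\<^sup>2 = of_real (r 0 / q 0)" by (simp add: field_simps)
    with * have "cis t = of_real (q N * (r 0 / q 0))" by simp
    then have "sin t = 0" by (metis Im_complex_of_real cis.sel(2))
    then show False using sin_gt_zero[OF t] by simp
  qed
  have "eventually (\<lambda>t. \<not> parallel (Suc (Suc N)) (f t)) (at_right 0)"
    using np by (intro eventually_at_rightI[of 0 pi]) auto
  with ev have "eventually (\<lambda>t. f t \<in> {\<mu> \<in> configs (Suc (Suc N)) s 0. \<not> parallel (Suc (Suc N)) \<mu>}) (at_right 0)"
    by eventually_elim simp
  then have "f 0 \<in> closure {\<mu> \<in> configs (Suc (Suc N)) s 0. \<not> parallel (Suc (Suc N)) \<mu>}"
    by (rule tendsto_in_closure[OF lim]) simp
  with conf par show ?thesis by blast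
qed

text \<open>Nonparallel configurations are limits of \<open>generic1\<close> ones, these are limits
  of \<open>generic2\<close> ones, and the latter have convex parameters. A parallel configuration
  forces \<open>n = 0\<close>; if \<open>0\<close> lies in the open range, the head contains both
  signs, and some parallel configuration is a limit of nonparallel ones, which links the two
  kinds.\<close>

theorem configs_mixed_tail:
  assumes s: "\<And>k. s k * s k = 1" and sN: "s (Suc N) = - s N" and N: "N > 0"
  shows "connected (configs (Suc (Suc N)) s n)"
    and "configs (Suc (Suc N)) s n \<noteq> {} \<longleftrightarrow>
      (- int (neg_count N s) < n \<and> n < int (pos_count N s)) \<or> n = 0"
proof -
  let ?p = "Suc (Suc N)" let ?C = "configs ?p s n"
  let ?range = "- int (neg_count N s) < n \<and> n < int (pos_count N s)"
  have dense1: "\<nu> \<in> closure {\<mu> \<in> ?C. generic1 s (Suc N) \<mu>}" if "\<nu> \<in> ?C" "\<not> parallel ?p \<nu>" for \<nu>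
    using that(1) s that(2) by (rule moving_dense)
  have dense2: "\<nu> \<in> closure {\<mu> \<in> ?C. generic2 s N n \<mu>}" if "\<nu> \<in> ?C" "generic1 s (Suc N) \<nu>" for \<nu>
    using that(1) s sN that(2) by (rule generic2_dense)
  have data: "\<exists>\<theta> m e. data2 s N n \<theta> m e \<and> \<nu> = conf2 s N n \<theta> m e" if "\<nu> \<in> ?C" "generic2 s N n \<nu>" for \<nu>
  proof (rule generic2_conf2[OF that(1) s sN that(2)])
    fix \<theta> m e assume "data2 s N n \<theta> m e" "\<nu> = conf2 s N n \<theta> m e"
    then show ?thesis by (intro exI conjI)
  qed
  have range: ?range if \<nu>: "\<nu> \<in> ?C" "\<not> parallel ?p \<nu>" for \<nu>
  proof -
    obtain \<mu> where "\<mu> \<in> ?C" "generic1 s (Suc N) \<mu>" using closure_nonempty[OF dense1[OF \<nu>]] by auto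
    then obtain \<mu>' where "\<mu>' \<in> ?C" "generic2 s N n \<mu>'" using closure_nonempty[OF dense2] by blast
    then obtain \<theta> m e where "data2 s N n \<theta> m e" using data by blast
    then show ?range using polygon_angle_bound[where \<theta> = \<theta> and m = m and n = n, OF _ s _ N] by (simp add: data2_def)
  qed
  have zero: "n = 0" if \<nu>: "\<nu> \<in> ?C" "parallel ?p \<nu>" for \<nu>
  proof -
    obtain x r where x: "x \<noteq> 0" and r: "\<forall>k<?p. \<nu> k = of_real (r k) * x\<^sup>2 \<and> r k > (0::real)"
      using \<nu>(2) unfolding parallel_def by auto
    have r': "\<And>k. k < ?p \<Longrightarrow> \<nu> k = of_real (r k) * x\<^sup>2 \<and> r k > 0" using r by simp
    have z: "\<And>k. k \<ge> ?p \<Longrightarrow> \<nu> k = 0" using \<nu>(1) by (simp add: configs_def)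
    show ?thesis using parallel_configs_iff[where n = n and \<nu> = \<nu> and p = ?p and r = r and s = s, OF x r' z s] \<nu>(1) by simp
  qed
  have cnt: "pos_count ?p s > 0" "neg_count ?p s > 0"
  proof -
    have fin: "finite {k. k < ?p \<and> s k = a}" for a by (rule finite_subset[of _ "{..<?p}"]) auto
    have "\<exists>k<?p. s k = 1" "\<exists>k<?p. s k = - 1"
      using sign_cases[OF s, of N] sN by (metis lessI less_SucI minus_minus)+
    then have "{k. k < ?p \<and> s k = 1} \<noteq> {}" "{k. k < ?p \<and> s k = - 1} \<noteq> {}" by auto
    then show "pos_count ?p s > 0" "neg_count ?p s > 0"
      unfolding pos_count_def neg_count_def using fin by (simp_all add: card_gt_0_iff)
  qed
  show "?C \<noteq> {} \<longleftrightarrow> ?range \<or> n = 0"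
  proof
    assume "?C \<noteq> {}"
    then obtain \<nu> where "\<nu> \<in> ?C" by auto
    then show "?range \<or> n = 0" using range[of \<nu>] zero[of \<nu>] by auto
  next
    assume "?range \<or> n = 0"
    then show "?C \<noteq> {}"
    proof
      assume r: ?range
      obtain \<theta> m where d: "data2 s N n \<theta> m 1"
        using data2_exists[OF s N conjunct1[OF r] conjunct2[OF r]] by auto
      show ?thesis using conf2_configs[OF d s sN] by auto
    next
      assume "n = 0"
      then show ?thesis using parallel_exists[OF s cnt] by auto
    qed
  qed
  show "connected ?C"
  proof (cases ?range)
    case True
    obtain \<theta>0 m0 where d0: "data2 s N n \<theta>0 m0 1"
      using data2_exists[OF s N conjunct1[OF True] conjunct2[OF True]] by auto
    define \<mu>0 where "\<mu>0 = conf2 s N n \<theta>0 m0 1"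
    have c2: "connected_component ?C \<mu>0 \<nu>" if \<nu>: "\<nu> \<in> ?C" "generic2 s N n \<nu>" for \<nu>
    proof -
      obtain \<theta> m e where "data2 s N n \<theta> m e" "\<nu> = conf2 s N n \<theta> m e" using data[OF \<nu>] by auto
      then show ?thesis unfolding \<mu>0_def using conf2_connected[OF d0 _ s sN] by simp
    qed
    have c1: "connected_component ?C \<mu>0 \<nu>" if \<nu>: "\<nu> \<in> ?C" "generic1 s (Suc N) \<nu>" for \<nu>
      using \<nu>(1) dense2[OF \<nu>] c2 by (rule connected_component_closure)
    have c0: "connected_component ?C \<mu>0 \<nu>" if \<nu>: "\<nu> \<in> ?C" "\<not> parallel ?p \<nu>" for \<nu>
      using \<nu>(1) dense1[OF \<nu>] c1 by (rule connected_component_closure)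
    have "connected_component ?C \<mu>0 \<nu>" if \<nu>: "\<nu> \<in> ?C" "parallel ?p \<nu>" for \<nu>
    proof -
      have n: "n = 0" by (rule zero[OF \<nu>])
      then have "pos_count N s > 0" "neg_count N s > 0" using True by auto
      then obtain \<nu>' where \<nu>': "\<nu>' \<in> ?C" "parallel ?p \<nu>'" "\<nu>' \<in> closure {\<mu> \<in> ?C. \<not> parallel ?p \<mu>}"
        using parallel_limit_of_nonparallel[OF s sN N] unfolding n by auto
      have "connected_component ?C \<mu>0 \<nu>'"
        using \<nu>'(1,3) c0 by (rule connected_component_closure)
      moreover have "connected_component ?C \<nu>' \<nu>"
        using \<nu>'(1) \<nu>(1) \<nu>'(2) \<nu>(2) s by (rule parallel_connected)
      ultimately show ?thesis by (rule connected_component_trans)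
    qed
    with c0 show ?thesis by (intro connected_if_components[of ?C \<mu>0]) auto
  next
    \<comment> \<open>Outside the range every configuration is parallel.\<close>
    case False
    then have par: "parallel ?p \<nu>" if "\<nu> \<in> ?C" for \<nu> using range[OF that] by auto
    show ?thesis
      unfolding connected_iff_connected_component
    proof (intro ballI)
      fix \<nu> \<mu> assume *: "\<nu> \<in> ?C" "\<mu> \<in> ?C"
      show "connected_component ?C \<nu> \<mu>"
        using * par[OF *(1)] par[OF *(2)] s by (rule parallel_connected)
    qed
  qed
qed

section \<open>Cyclic rotation of the transvections\<close>

definition cyc :: "nat \<Rightarrow> nat \<Rightarrow> nat" where
  "cyc p k = (if Suc k < p then Suc k else if Suc k = p then 0 else k)"

lemma bij_cyc: "bij_betw (cyc p) {..<p} {..<p}"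
proof (rule bij_betw_byWitness[where f' = "\<lambda>k. if k = 0 then p - 1 else k - 1"])
qed (auto simp: cyc_def)

lemma count_cyc:
  "pos_count p (\<lambda>k. s (cyc p k)) = pos_count p s" "neg_count p (\<lambda>k. s (cyc p k)) = neg_count p s"
proof -
  have "card {k. k < p \<and> s (cyc p k) = a} = card {k. k < p \<and> s k = a}" for a
  proof -
    have "cyc p ` {k. k < p \<and> s (cyc p k) = a} = {k. k < p \<and> s k = a}"
    proof
      show "cyc p ` {k. k < p \<and> s (cyc p k) = a} \<subseteq> {k. k < p \<and> s k = a}"
        using bij_betwE[OF bij_cyc[of p]] by auto
      show "{k. k < p \<and> s k = a} \<subseteq> cyc p ` {k. k < p \<and> s (cyc p k) = a}"
      proof
        fix k assume k: "k \<in> {k. k < p \<and> s k = a}"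
        then have "k \<in> cyc p ` {..<p}" using bij_betw_imp_surj_on[OF bij_cyc[of p]] by simp
        then obtain j where "j < p" "k = cyc p j" by auto
        with k show "k \<in> cyc p ` {k. k < p \<and> s (cyc p k) = a}" by auto
      qed
    qed
    moreover have "inj_on (cyc p) {k. k < p \<and> s (cyc p k) = a}"
      by (rule inj_on_subset[OF bij_betw_imp_inj_on[OF bij_cyc]]) auto
    ultimately show ?thesis using card_image by fastforce
  qed
  then show "pos_count p (\<lambda>k. s (cyc p k)) = pos_count p s" "neg_count p (\<lambda>k. s (cyc p k)) = neg_count p s"
    by (simp_all add: pos_count_def neg_count_def)
qed

text \<open>Rotation conjugates the product by the first transvection \<open>T\<close>, which does
  not affect scalars. The rotated orbit of \<open>T x\<close> is the orbit of \<open>x\<close>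
  without its first vertex; its final step repeats the first one up to sign, so the turning sums
  agree.\<close>

lemma configs_cyc:
  assumes p: "p = Suc q" and s: "\<And>k. s k * s k = 1"
  shows "(\<lambda>k. \<nu> (cyc p k)) \<in> configs p (\<lambda>k. s (cyc p k)) n \<longleftrightarrow> \<nu> \<in> configs p s n"
proof -
  define s' \<nu>' where "s' k = s (cyc p k)" and "\<nu>' k = \<nu> (cyc p k)" for k
  define T where "T = transv (s 0) (\<nu> 0)"
  have s': "\<And>k. s' k * s' k = 1" using s by (simp add: s'_def)
  have o: "orb s \<nu> (Suc k) x = orb s' \<nu>' k (T x)" if "k \<le> q" for k x
    using that
  proof (induction k)
    case (Suc k)
    then have "s' k = s (Suc k)" "\<nu>' k = \<nu> (Suc k)" by (auto simp: s'_def \<nu>'_def cyc_def p)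
    with Suc show ?case by simp
  qed (simp add: T_def)
  have last: "s' q = s 0" "\<nu>' q = \<nu> 0" by (simp_all add: s'_def \<nu>'_def cyc_def p)
  have o': "orb s' \<nu>' p (T x) = T (orb s \<nu> p x)" for x
    using o[of q x] last by (simp add: p T_def)
  have surj: "\<exists>x. y = T x" for y by (metis T_def transv_inverse')
  have inj: "T x = T y \<longleftrightarrow> x = y" for x y by (metis T_def transv_inverse)
  have Tsc: "T (of_real a * x) = of_real a * T x" for a x by (simp add: T_def transv_scale)
  have T0: "T x = 0 \<longleftrightarrow> x = 0" for x by (simp add: T_def)
  have scal: "(\<forall>y. orb s' \<nu>' p y = of_real (sgn_int n) * y) \<longleftrightarrow> (\<forall>x. orb s \<nu> p x = of_real (sgn_int n) * x)"
  proof
    assume *: "\<forall>y. orb s' \<nu>' p y = of_real (sgn_int n) * y"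
    show "\<forall>x. orb s \<nu> p x = of_real (sgn_int n) * x"
    proof
      fix x
      have "T (orb s \<nu> p x) = T (of_real (sgn_int n) * x)"
        using * o'[of x] by (simp add: Tsc)
      then show "orb s \<nu> p x = of_real (sgn_int n) * x" by (simp only: inj)
    qed
  next
    assume *: "\<forall>x. orb s \<nu> p x = of_real (sgn_int n) * x"
    show "\<forall>y. orb s' \<nu>' p y = of_real (sgn_int n) * y"
    proof
      fix y
      obtain x where y: "y = T x" using surj by auto
      show "orb s' \<nu>' p y = of_real (sgn_int n) * y"
        unfolding y o' using * by (simp add: Tsc)
    qed
  qed
  have turn: "turning p s' \<nu>' (T x) = turning p s \<nu> x"
    if *: "\<forall>x. orb s \<nu> p x = of_real (sgn_int n) * x" for x
  proof -
    have "turning p s' \<nu>' (T x) = (\<Sum>k<q. Arg (orb s' \<nu>' (Suc k) (T x) / orb s' \<nu>' k (T x))) +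
        Arg (orb s' \<nu>' p (T x) / orb s' \<nu>' q (T x))"
      by (simp add: turning_def p del: orb.simps)
    also have "orb s' \<nu>' q (T x) = of_real (sgn_int n) * x"
      using o[of q x] * by (simp add: p)
    also have "orb s' \<nu>' p (T x) = of_real (sgn_int n) * T x"
      using o' * by (simp add: Tsc)
    also have "of_real (sgn_int n) * T x / (of_real (sgn_int n) * x) = T x / x" by simp
    also have "(\<Sum>k<q. Arg (orb s' \<nu>' (Suc k) (T x) / orb s' \<nu>' k (T x))) =
        (\<Sum>k<q. Arg (orb s \<nu> (Suc (Suc k)) x / orb s \<nu> (Suc k) x))"
      by (intro sum.cong HOL.refl) (simp add: o del: orb.simps)
    finally show ?thesis
      by (simp add: turning_def p T_def sum.lessThan_Suc_shift del: sum.lessThan_Suc)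
  qed
  have turn': "(\<forall>y. y \<noteq> 0 \<longrightarrow> turning p s' \<nu>' y = of_int n * pi) \<longleftrightarrow> (\<forall>x. x \<noteq> 0 \<longrightarrow> turning p s \<nu> x = of_int n * pi)"
    if *: "\<forall>x. orb s \<nu> p x = of_real (sgn_int n) * x"
  proof safe
    fix x :: complex assume "\<forall>y. y \<noteq> 0 \<longrightarrow> turning p s' \<nu>' y = of_int n * pi" "x \<noteq> 0"
    then show "turning p s \<nu> x = of_int n * pi" using turn[OF *, of x] T0[of x] by simp
  next
    fix y :: complex assume a: "\<forall>x. x \<noteq> 0 \<longrightarrow> turning p s \<nu> x = of_int n * pi" and "y \<noteq> 0"
    obtain x where y: "y = T x" using surj by auto
    then show "turning p s' \<nu>' y = of_int n * pi" using turn[OF *, of x] T0[of x] a \<open>y \<noteq> 0\<close> by simp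
  qed
  have "(\<forall>k<p. \<nu>' k \<noteq> 0) \<longleftrightarrow> (\<forall>k\<in>cyc p ` {..<p}. \<nu> k \<noteq> 0)"
    by (auto simp: \<nu>'_def)
  then have nz: "(\<forall>k<p. \<nu>' k \<noteq> 0) \<longleftrightarrow> (\<forall>k<p. \<nu> k \<noteq> 0)"
    unfolding bij_betw_imp_surj_on[OF bij_cyc] by auto
  have z: "(\<forall>k\<ge>p. \<nu>' k = 0) \<longleftrightarrow> (\<forall>k\<ge>p. \<nu> k = 0)"
    by (simp add: \<nu>'_def cyc_def)
  have "\<nu>' \<in> configs p s' n \<longleftrightarrow> \<nu> \<in> configs p s n"
    unfolding configs_def mem_Collect_eq nz z scal
    by (intro conj_cong HOL.refl turn')
  then show ?thesis by (simp add: s'_def[abs_def] \<nu>'_def[abs_def])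
qed

lemma configs_cyc_image:
  assumes p: "p = Suc q" and s: "\<And>k. s k * s k = 1"
  shows "configs p (\<lambda>k. s (cyc p k)) n = (\<lambda>\<nu> k. \<nu> (cyc p k)) ` configs p s n"
proof
  have iff: "(\<lambda>k. \<nu> (cyc p k)) \<in> configs p (\<lambda>k. s (cyc p k)) n \<longleftrightarrow> \<nu> \<in> configs p s n" for \<nu>
    using p s by (rule configs_cyc)
  show "(\<lambda>\<nu> k. \<nu> (cyc p k)) ` configs p s n \<subseteq> configs p (\<lambda>k. s (cyc p k)) n"
    by (auto simp: iff)
  show "configs p (\<lambda>k. s (cyc p k)) n \<subseteq> (\<lambda>\<nu> k. \<nu> (cyc p k)) ` configs p s n"
  proof
    fix \<mu> assume \<mu>: "\<mu> \<in> configs p (\<lambda>k. s (cyc p k)) n"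
    define \<nu> where "\<nu> k = \<mu> (if k = 0 then q else if k < p then k - 1 else k)" for k
    have "\<nu> (cyc p k) = \<mu> k" for k by (simp add: \<nu>_def cyc_def p)
    then have eq: "\<mu> = (\<lambda>k. \<nu> (cyc p k))" by simp
    then have "\<nu> \<in> configs p s n" using iff[of \<nu>] \<mu> by simp
    with eq show "\<mu> \<in> (\<lambda>\<nu> k. \<nu> (cyc p k)) ` configs p s n" by blast
  qed
qed

text \<open>The three conditions of the theorem, stated for real signs; \<open>2 - int p\<close> is
  the Euler characteristic.\<close>

definition admissible :: "nat \<Rightarrow> (nat \<Rightarrow> real) \<Rightarrow> int \<Rightarrow> bool" where
  "admissible p s n \<longleftrightarrow> (2 - int p + int (pos_count p s) \<le> n \<and> n \<le> int p - 2 - int (neg_count p s)) \<or>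
     n = 0 \<and> (neg_count p s = 1 \<or> pos_count p s = 1) \<or>
     n = 1 \<and> neg_count p s = 0 \<or> n = - 1 \<and> pos_count p s = 0"

lemma count_total_nat:
  assumes "\<And>k. s k * s k = (1::real)"
  shows "pos_count p s + neg_count p s = p"
proof -
  have "real (pos_count p s + neg_count p s) = real p" using count_total[of s p] assms by simp
  then show ?thesis by (simp only: of_nat_eq_iff)
qed

lemma count_Suc:
  "pos_count (Suc p) s = pos_count p s + (if s p = 1 then 1 else 0)"
  "neg_count (Suc p) s = neg_count p s + (if s p = - 1 then 1 else 0)"
proof -
  have "card {k. k < Suc p \<and> s k = a} = card {k. k < p \<and> s k = a} + (if s p = a then 1 else 0)" for a
  proof (cases "s p = a")
    case True
    then have "{k. k < Suc p \<and> s k = a} = insert p {k. k < p \<and> s k = a}" by (auto simp: less_Suc_eq)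
    then show ?thesis using True by simp
  next
    case False
    then have "{k. k < Suc p \<and> s k = a} = {k. k < p \<and> s k = a}" by (auto simp: less_Suc_eq)
    then show ?thesis using False by simp
  qed
  then show "pos_count (Suc p) s = pos_count p s + (if s p = 1 then 1 else 0)"
    "neg_count (Suc p) s = neg_count p s + (if s p = - 1 then 1 else 0)"
    by (simp_all add: pos_count_def neg_count_def)
qed

text \<open>Each rotation moves the change of sign one place further, until it sits at the last two
  positions and \<open>configs_mixed_tail\<close> applies.\<close>

lemma configs_mixed:
  assumes "\<And>k. s k * s k = 1" "Suc k < Suc (Suc N)" "s (Suc k) \<noteq> s k" "N > 0"
  shows "connected (configs (Suc (Suc N)) s n) \<and> (configs (Suc (Suc N)) s n \<noteq> {} \<longleftrightarrow> admissible (Suc (Suc N)) s n)"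
  using assms(1-3)
proof (induction "N - k" arbitrary: k s)
  case 0
  note s = "0.prems"(1)
  have k: "k = N" using 0 by simp
  have sN: "s (Suc N) = - s N"
    using 0 k sign_cases[OF s, of N] sign_cases[OF s, of "Suc N"] by auto
  have tot: "pos_count N s + neg_count N s = N" by (rule count_total_nat[OF s])
  have c: "pos_count (Suc (Suc N)) s = Suc (pos_count N s)" "neg_count (Suc (Suc N)) s = Suc (neg_count N s)"
    using sN sign_cases[OF s, of N] by (auto simp: count_Suc)
  \<comment> \<open>Dropping the pair removes one sign of each kind, so condition (1) becomes the
    open range. The value \<open>n = 0\<close> lies outside it exactly when one of the smaller
    counts is \<open>0\<close>, which is condition (2).\<close>
  have "admissible (Suc (Suc N)) s n \<longleftrightarrow> (- int (neg_count N s) < n \<and> n < int (pos_count N s)) \<or> n = 0"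
    unfolding admissible_def c using tot by linarith
  then show ?case using configs_mixed_tail[where s = s and N = N and n = n, OF s sN assms(4)] by simp
next
  case (Suc d)
  note s = Suc.prems(1)
  let ?p = "Suc (Suc N)"
  define s' where "s' j = s (if j = 0 then Suc N else if j < ?p then j - 1 else j)" for j
  have s'c: "s' (cyc ?p j) = s j" for j by (auto simp: s'_def cyc_def)
  have s's: "s' j * s' j = 1" for j using s by (simp add: s'_def)
  have k: "k < N" using Suc by simp
  have "connected (configs ?p s' n) \<and> (configs ?p s' n \<noteq> {} \<longleftrightarrow> admissible ?p s' n)"
  proof (rule Suc.hyps(1)[of "Suc k"])
    show "d = N - Suc k" using Suc.hyps(2) by simp
    show "s' (Suc (Suc k)) \<noteq> s' (Suc k)" using Suc.prems k by (simp add: s'_def)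
  qed (use s's k in simp_all)
  moreover have im: "configs ?p s n = (\<lambda>\<nu> k. \<nu> (cyc ?p k)) ` configs ?p s' n"
    using configs_cyc_image[where p = ?p and q = "Suc N" and s = s' and n = n, OF HOL.refl s's] by (simp add: s'c)
  moreover have "continuous_on (configs ?p s' n) (\<lambda>\<nu> k. \<nu> (cyc ?p k))"
    by (intro continuous_on_coordinatewise_then_product)
      (rule continuous_on_subset[OF continuous_on_product_coordinates], simp)
  moreover have "pos_count ?p s' = pos_count ?p s" "neg_count ?p s' = neg_count ?p s"
    using count_cyc[of ?p s'] by (simp_all add: s'c)
  ultimately show ?case
    by (simp add: admissible_def connected_continuous_image)
qed

theorem configs_main:
  assumes s: "\<And>k. s k * s k = 1" and p: "p \<ge> 3"
  shows "connected (configs p s n)" and "configs p s n \<noteq> {} \<longleftrightarrow> admissible p s n"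
proof -
  define N where "N = p - 2"
  have pN: "p = Suc (Suc N)" "N > 0" using p by (simp_all add: N_def)
  have "connected (configs p s n) \<and> (configs p s n \<noteq> {} \<longleftrightarrow> admissible p s n)"
  proof (cases "\<exists>k. Suc k < p \<and> s (Suc k) \<noteq> s k")
    case True
    then show ?thesis using configs_mixed[of s _ N n] s pN by blast
  next
    case False
    define \<sigma> where "\<sigma> = s 0"
    have \<sigma>: "s k = \<sigma>" if "k < p" for k
      using that by (induction k) (use False in \<open>auto simp: \<sigma>_def\<close>)
    have \<sigma>2: "\<sigma> * \<sigma> = 1" using s by (simp add: \<sigma>_def)
    have o: "orb s \<nu> k x = orb (\<lambda>_. \<sigma>) \<nu> k x" if "k \<le> p" for \<nu> k x
      using that by (induction k) (simp_all add: \<sigma>)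
    have "turning p s \<nu> x = turning p (\<lambda>_. \<sigma>) \<nu> x" for \<nu> x
      unfolding turning_def by (intro sum.cong HOL.refl) (simp add: o del: orb.simps)
    \<comment> \<open>Only the signs at indices below \<open>p\<close> enter, so \<open>s\<close>
      may be replaced by a constant.\<close>
    then have eq: "configs p s n = configs p (\<lambda>_. \<sigma>) n"
      by (simp add: configs_def o)
    have "{k. k < p \<and> s k = a} = (if \<sigma> = a then {..<p} else {})" for a
      using \<sigma> by auto
    then have cnt: "pos_count p s = (if \<sigma> = 1 then p else 0)" "neg_count p s = (if \<sigma> = - 1 then p else 0)"
      by (simp_all add: pos_count_def neg_count_def)
    have "0 < \<sigma> * of_int n \<and> \<sigma> * of_int n < real (Suc N) \<longleftrightarrow> admissible p s n"
      using sign_cases[OF \<sigma>2]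
    proof
      assume "\<sigma> = 1"
      moreover have "0 < real_of_int n \<and> real_of_int n < real (Suc N) \<longleftrightarrow> 0 < n \<and> n < int (Suc N)" by linarith
      ultimately show ?thesis unfolding admissible_def cnt using p pN by auto
    next
      assume "\<sigma> = - 1"
      moreover have "0 < - real_of_int n \<and> - real_of_int n < real (Suc N) \<longleftrightarrow> n < 0 \<and> - n < int (Suc N)" by linarith
      ultimately show ?thesis unfolding admissible_def cnt using p pN by auto
    qed
    then show ?thesis
      unfolding eq using configs_same_sign[where s = "\<lambda>_. \<sigma>" and \<sigma> = \<sigma> and N = "Suc N" and n = n] \<sigma>2 pN by simp
  qed
  then show "connected (configs p s n)" and "configs p s n \<noteq> {} \<longleftrightarrow> admissible p s n" by auto
qed

section \<open>The group PSL(2,R) and its parabolic elements\<close>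

lemma carrier_SL2R: "carrier SL2R = {A. det A = 1}"
  and mult_SL2R [simp]: "A \<otimes>\<^bsub>SL2R\<^esub> B = A ** B"
  and one_SL2R [simp]: "\<one>\<^bsub>SL2R\<^esub> = mat 1"
  by (simp_all add: SL2R_def)

lemma SL2R_closed:
  "A \<in> carrier SL2R \<Longrightarrow> B \<in> carrier SL2R \<Longrightarrow> A ** B \<in> carrier SL2R"
  "mat 1 \<in> carrier SL2R"
  "- A \<in> carrier SL2R \<longleftrightarrow> A \<in> carrier SL2R"
proof -
  show "A \<in> carrier SL2R \<Longrightarrow> B \<in> carrier SL2R \<Longrightarrow> A ** B \<in> carrier SL2R" "mat 1 \<in> carrier SL2R"
    by (simp_all add: carrier_SL2R det_mul)
  show "- A \<in> carrier SL2R \<longleftrightarrow> A \<in> carrier SL2R"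
    by (simp add: carrier_SL2R det_2)
qed

lemma psl_closed: "A \<in> carrier SL2R \<Longrightarrow> psl A \<in> carrier PSL2R"
  by (simp add: carrier_PSL2R)

lemma psl_mult:
  assumes "A \<in> carrier SL2R" "B \<in> carrier SL2R"
  shows "psl A \<otimes>\<^bsub>PSL2R\<^esub> psl B = psl (A ** B)"
  using normal.rcos_sum[OF normal_center_SL2R assms] by (simp add: PSL2R_def psl_def)

lemma psl_one: "\<one>\<^bsub>PSL2R\<^esub> = psl (mat 1)"
  by (simp add: PSL2R_def psl_eq)

lemma psl_eq_iff: "psl A = psl B \<longleftrightarrow> A = B \<or> A = - B"
  by (auto simp: psl_eq doubleton_eq_iff)

lemma psl_uminus: "psl (- A) = psl A"
  by (simp add: psl_eq_iff)

lemma continuous_on_matrix_mult: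
  fixes f g :: "'a::topological_space \<Rightarrow> real^2^2"
  assumes "continuous_on S f" "continuous_on S g"
  shows "continuous_on S (\<lambda>x. f x ** g x)"
  unfolding matrix_matrix_mult_def
  by (intro continuous_intros assms)

lemma continuous_on_matrix2:
  fixes a b c d :: "'a::topological_space \<Rightarrow> real"
  assumes "continuous_on S a" "continuous_on S b" "continuous_on S c" "continuous_on S d"
  shows "continuous_on S (\<lambda>x. vector [vector [a x, b x], vector [c x, d x]] :: real^2^2)"
proof -
  have "(\<lambda>x. vector [vector [a x, b x], vector [c x, d x]] :: real^2^2) =
    (\<lambda>x. \<chi> i j. if i = 1 then (if j = 1 then a x else b x) else (if j = 1 then c x else d x))"
    by (auto simp: fun_eq_iff vec_eq_iff forall_2)
  moreover have "continuous_on S (\<lambda>x. \<chi> i j. if i = (1::2) then (if j = (1::2) then a x else b x) else (if j = 1 then c x else d x))"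
  proof (intro continuous_intros)
    fix i j :: 2
    show "continuous_on S (\<lambda>x. if i = (1::2) then (if j = (1::2) then a x else b x) else (if j = 1 then c x else d x))"
      using assms by (cases "i = 1"; cases "j = 1") simp_all
  qed
  ultimately show ?thesis by (simp only:)
qed

lemma Union_psl_image:
  assumes "V \<subseteq> carrier SL2R"
  shows "\<Union>(psl ` V) = V \<union> uminus ` V"
  by (auto simp: psl_eq)

lemma openin_psl_image:
  assumes "openin (top_of_set (carrier SL2R)) V"
  shows "openin PSL2R_topology (psl ` V)"
proof -
  have V: "V \<subseteq> carrier SL2R" using openin_imp_subset[OF assms] .
  obtain T where T: "open T" "V = carrier SL2R \<inter> T"
    using assms by (auto simp: openin_open)
  have "uminus ` V = carrier SL2R \<inter> uminus ` T"
    using T SL2R_closed(3) by (auto simp: image_iff)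
  then have "openin (top_of_set (carrier SL2R)) (uminus ` V)"
    using open_negations[OF T(1)] by (auto simp: openin_open)
  then have "openin (top_of_set (carrier SL2R)) (\<Union>(psl ` V))"
    unfolding Union_psl_image[OF V] using assms by (rule openin_Un[rotated])
  then show ?thesis
    using V by (auto simp: openin_PSL2R_topology carrier_PSL2R)
qed

lemma psl_preimage:
  assumes "U \<subseteq> carrier PSL2R"
  shows "{A \<in> carrier SL2R. psl A \<in> U} = \<Union>U"
proof
  show "{A \<in> carrier SL2R. psl A \<in> U} \<subseteq> \<Union>U" by (auto simp: psl_eq)
  show "\<Union>U \<subseteq> {A \<in> carrier SL2R. psl A \<in> U}"
  proof
    fix A assume "A \<in> \<Union>U"
    then obtain x where x: "x \<in> U" "A \<in> x" by auto
    then have "x = psl A" using mem_PSL2R assms by blast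
    moreover obtain B where "B \<in> carrier SL2R" "x = psl B"
      using x assms by (auto simp: carrier_PSL2R)
    ultimately have "A \<in> carrier SL2R" using SL2R_closed(3) by (metis psl_eq_iff)
    with x \<open>x = psl A\<close> show "A \<in> {A \<in> carrier SL2R. psl A \<in> U}" by simp
  qed
qed

lemma quotient_map_psl: "quotient_map (top_of_set (carrier SL2R)) PSL2R_topology psl"
  unfolding quotient_map_def topspace_PSL2R_topology
  by (auto simp: carrier_PSL2R[symmetric] psl_preimage openin_PSL2R_topology)

lemma continuous_map_psl: "continuous_map (top_of_set (carrier SL2R)) PSL2R_topology psl"
  by (rule quotient_imp_continuous_map[OF quotient_map_psl])

lemma continuous_map_psl_comp:
  assumes "continuous_on S f" "\<And>x. x \<in> S \<Longrightarrow> f x \<in> carrier SL2R"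
  shows "continuous_map (top_of_set S) PSL2R_topology (\<lambda>x. psl (f x))"
proof -
  have "continuous_map (top_of_set S) (top_of_set (carrier SL2R)) f"
    using assms by (auto simp: continuous_map_in_subtopology)
  from continuous_map_compose[OF this continuous_map_psl] show ?thesis
    by (simp add: o_def)
qed

text \<open>A product of quotient maps need not be a quotient map. Instead a product neighbourhood
  is found upstairs for matrix representatives and projected by \<open>psl\<close>, which is an open
  map.\<close>

lemma continuous_map_PSL2R_mult:
  "continuous_map (prod_topology PSL2R_topology PSL2R_topology) PSL2R_topology (\<lambda>z. fst z \<otimes>\<^bsub>PSL2R\<^esub> snd z)"
  unfolding continuous_map_def
proof (intro conjI allI impI)
  interpret group PSL2R by (rule group_PSL2R)
  show "(\<lambda>z. fst z \<otimes>\<^bsub>PSL2R\<^esub> snd z) \<in> topspace (prod_topology PSL2R_topology PSL2R_topology) \<rightarrow> topspace PSL2R_topology"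
    by (auto simp: topspace_PSL2R_topology)
  fix U assume U: "openin PSL2R_topology U"
  have sub: "U \<subseteq> carrier PSL2R" using openin_subset[OF U] by (simp add: topspace_PSL2R_topology)
  let ?S = "carrier SL2R"
  show "openin (prod_topology PSL2R_topology PSL2R_topology)
     {z \<in> topspace (prod_topology PSL2R_topology PSL2R_topology). fst z \<otimes>\<^bsub>PSL2R\<^esub> snd z \<in> U}"
    unfolding openin_prod_topology_alt
  proof (intro allI impI)
    fix x y assume "(x, y) \<in> {z \<in> topspace (prod_topology PSL2R_topology PSL2R_topology). fst z \<otimes>\<^bsub>PSL2R\<^esub> snd z \<in> U}"
    then have xy: "x \<in> carrier PSL2R" "y \<in> carrier PSL2R" "x \<otimes>\<^bsub>PSL2R\<^esub> y \<in> U"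
      by (auto simp: topspace_PSL2R_topology)
    then obtain A B where AB: "A \<in> ?S" "B \<in> ?S" "x = psl A" "y = psl B"
      by (auto simp: carrier_PSL2R)
    have op: "openin (top_of_set ?S) (\<Union>U)" using U by (simp add: openin_PSL2R_topology)
    have "continuous_on (?S \<times> ?S) (\<lambda>z. fst z ** snd z)"
      by (intro continuous_on_matrix_mult continuous_intros)
    then have "openin (top_of_set (?S \<times> ?S)) ((?S \<times> ?S) \<inter> (\<lambda>z. fst z ** snd z) -` \<Union>U)"
      by (rule continuous_openin_preimage[OF _ _ op]) (auto simp: SL2R_closed)
    then have "openin (prod_topology (top_of_set ?S) (top_of_set ?S)) ((?S \<times> ?S) \<inter> (\<lambda>z. fst z ** snd z) -` \<Union>U)"
      by (simp only: prod_topology_subtopology_eu)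
    moreover have "(A, B) \<in> (?S \<times> ?S) \<inter> (\<lambda>z. fst z ** snd z) -` \<Union>U"
    proof -
      have "psl (A ** B) \<in> U" using xy(3) AB by (simp only: psl_mult)
      then have "A ** B \<in> \<Union>U" unfolding psl_eq by auto
      then show ?thesis using AB by simp
    qed
    ultimately obtain V W where VW: "openin (top_of_set ?S) V" "openin (top_of_set ?S) W" "A \<in> V" "B \<in> W"
      "V \<times> W \<subseteq> (?S \<times> ?S) \<inter> (\<lambda>z. fst z ** snd z) -` \<Union>U"
      unfolding openin_prod_topology_alt by meson
    have VS: "V \<subseteq> ?S" "W \<subseteq> ?S" using openin_imp_subset[OF VW(1)] openin_imp_subset[OF VW(2)] .
    have "psl ` V \<times> psl ` W \<subseteq> {z \<in> topspace (prod_topology PSL2R_topology PSL2R_topology). fst z \<otimes>\<^bsub>PSL2R\<^esub> snd z \<in> U}"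
    proof
      fix z assume "z \<in> psl ` V \<times> psl ` W"
      then obtain C D where CD: "C \<in> V" "D \<in> W" "z = (psl C, psl D)" by auto
      then have "(C, D) \<in> (?S \<times> ?S) \<inter> (\<lambda>z. fst z ** snd z) -` \<Union>U"
        by (intro subsetD[OF VW(5)]) simp
      then have "C ** D \<in> \<Union>U" by simp
      then have "psl (C ** D) \<in> U" unfolding psl_preimage[OF sub, symmetric] by simp
      then show "z \<in> {z \<in> topspace (prod_topology PSL2R_topology PSL2R_topology). fst z \<otimes>\<^bsub>PSL2R\<^esub> snd z \<in> U}"
        using CD VS by (auto simp: topspace_PSL2R_topology psl_mult psl_closed subset_iff)
    qed
    moreover have "x \<in> psl ` V" "y \<in> psl ` W" using AB VW by auto
    ultimately show "\<exists>U' V'. openin PSL2R_topology U' \<and> openin PSL2R_topology V' \<and> x \<in> U' \<and> y \<in> V' \<and>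
        U' \<times> V' \<subseteq> {z \<in> topspace (prod_topology PSL2R_topology PSL2R_topology). fst z \<otimes>\<^bsub>PSL2R\<^esub> snd z \<in> U}"
      using openin_psl_image[OF VW(1)] openin_psl_image[OF VW(2)]
      by (intro exI[of _ "psl ` V"] exI[of _ "psl ` W"]) simp
  qed
qed

text \<open>The vector \<open>(a, b)\<close> is identified with the complex number \<open>b + a\<i>\<close>, so that rotation
  matrices with rows \<open>(cos t, sin t)\<close> and \<open>(- sin t, cos t)\<close> act as multiplication by \<open>cis t\<close>.\<close>

definition act :: "real^2^2 \<Rightarrow> complex \<Rightarrow> complex" where
  "act A x = Complex (A$2$1 * Im x + A$2$2 * Re x) (A$1$1 * Im x + A$1$2 * Re x)"

definition tmat :: "real \<Rightarrow> complex \<Rightarrow> real^2^2" where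
  "tmat s \<nu> = vector [vector [1 - s * Im \<nu> / 2, s * (cmod \<nu> - Re \<nu>) / 2],
     vector [- s * (cmod \<nu> + Re \<nu>) / 2, 1 + s * Im \<nu> / 2]]"

section \<open>Transvection matrices and the classification of parabolic elements\<close>

lemma act_mult: "act (A ** B) x = act A (act B x)"
  by (simp add: act_def matrix_matrix_mult_def sum_2 algebra_simps)

lemma act_mat1 [simp]: "act (mat 1) x = x"
  by (simp add: act_def mat_def complex_eq_iff)

lemma act_uminus: "act (- A) x = - act A x"
  by (simp add: act_def complex_eq_iff)

lemma act_tmat: "act (tmat s \<nu>) x = transv s \<nu> x"
  by (rule complex_eqI) (simp_all add: act_def tmat_def Re_transv Im_transv field_simps)

lemma act_inject:
  assumes "\<And>x. act A x = act B x"
  shows "A = B"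
proof -
  have "A $ 2 $ 2 = B $ 2 $ 2" "A $ 1 $ 2 = B $ 1 $ 2" "A $ 2 $ 1 = B $ 2 $ 1" "A $ 1 $ 1 = B $ 1 $ 1"
    using assms[of 1] assms[of \<i>] by (simp_all add: act_def)
  then show ?thesis by (simp add: vec_eq_iff forall_2)
qed

lemma tmat_SL2R: "tmat s \<nu> \<in> carrier SL2R"
proof -
  have "s * s * (cmod \<nu> * cmod \<nu>) = s * s * (Re \<nu> * Re \<nu> + Im \<nu> * Im \<nu>)" by (simp add: cmod_sq)
  then show ?thesis
    by (simp add: carrier_SL2R tmat_def det_2 field_simps)
qed

lemma continuous_on_tmat:
  assumes "continuous_on S f"
  shows "continuous_on S (\<lambda>x. tmat s (f x))"
  unfolding tmat_def by (intro continuous_on_matrix2 continuous_intros assms) auto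

text \<open>The matrix is the identity plus a traceless matrix with entries \<open>a\<close>,
  \<open>b\<close>, \<open>c\<close>, and determinant \<open>1\<close> means
  \<open>a\<^sup>2 = - bc\<close>. The choices of \<open>s\<close> and \<open>\<nu>\<close> solve
  the linear equations for the entries of \<open>tmat\<close>; the relation makes
  \<open>cmod \<nu>\<close> equal to \<open>s * (b - c)\<close>.\<close>

lemma unipotent_eq_tmat:
  assumes A: "A \<in> carrier SL2R" and tr: "trace A = 2" and ne: "A \<noteq> mat 1"
  shows "\<exists>s \<nu>. (s = 1 \<or> s = - 1) \<and> \<nu> \<noteq> 0 \<and> A = tmat s \<nu>"
proof -
  define a b c where "a = A$1$1 - 1" and "b = A$1$2" and "c = A$2$1"
  have A22: "A$2$2 = 1 - a" using tr by (simp add: trace_def sum_2 a_def)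
  have "A$1$1 * A$2$2 - A$1$2 * A$2$1 = 1" using A by (simp add: carrier_SL2R det_2)
  then have det: "a * a = - (b * c)" unfolding A22 b_def[symmetric] c_def[symmetric]
    by (simp add: a_def algebra_simps)
  define s where "s = (if b - c > 0 then 1 else - 1 :: real)"
  define \<nu> where "\<nu> = Complex (- s * (b + c)) (- 2 * s * a)"
  have bc: "b \<noteq> c"
  proof
    assume "b = c"
    then have "a * a + b * b = 0" using det by simp
    then have "a = 0" "b = 0" by (simp_all add: sum_squares_eq_zero_iff)
    then have "A = mat 1" using \<open>b = c\<close> A22 by (simp add: vec_eq_iff forall_2 mat_def a_def b_def c_def)
    with ne show False by simp
  qed
  have ss: "s * s = 1" by (simp add: s_def)
  have "(cmod \<nu>)\<^sup>2 = (s * s) * ((b + c)\<^sup>2 + 4 * (a * a))"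
    unfolding cmod_power2 by (simp add: \<nu>_def power2_eq_square algebra_simps)
  also have "\<dots> = (s * (b - c))\<^sup>2"
    unfolding det using ss by (simp add: power2_eq_square algebra_simps)
  finally have n: "cmod \<nu> = s * (b - c)"
    by (rule power2_eq_imp_eq) (auto simp: s_def)
  then have nz: "\<nu> \<noteq> 0" using bc ss by (auto simp: s_def split: if_splits)
  have r: "s * cmod \<nu> = b - c" "s * Re \<nu> = - (b + c)" "s * Im \<nu> = - 2 * a"
    unfolding n by (simp_all add: \<nu>_def mult.assoc[symmetric] ss)
  have "A = tmat s \<nu>"
    unfolding tmat_def vec_eq_iff forall_2 using r A22
    by (simp add: a_def b_def c_def right_diff_distrib distrib_left diff_divide_distrib)
  then show ?thesis using nz by (intro exI[of _ s] exI[of _ \<nu>]) (auto simp: s_def)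
qed

lemma trace_tmat: "trace (tmat s \<nu>) = 2"
  by (simp add: tmat_def trace_def sum_2)

lemma tmat_neq_1:
  assumes "s \<noteq> 0" "\<nu> \<noteq> 0"
  shows "tmat s \<nu> \<noteq> mat 1" "tmat s \<nu> \<noteq> - mat 1"
proof -
  have "s * cmod \<nu> \<noteq> 0" using assms by simp
  moreover have "tmat s \<nu> $ 1 $ 2 - tmat s \<nu> $ 2 $ 1 = s * cmod \<nu>"
    by (simp add: tmat_def field_simps)
  ultimately show "tmat s \<nu> \<noteq> mat 1" "tmat s \<nu> \<noteq> - mat 1"
    by (auto simp: mat_def)
qed

text \<open>Exactly one of the two representatives of a parabolic element has trace
  \<open>2\<close>.\<close>

lemma parabolic_iff:
  "parabolic x \<longleftrightarrow> (\<exists>s \<nu>. (s = 1 \<or> s = - 1) \<and> \<nu> \<noteq> 0 \<and> x = psl (tmat s \<nu>))"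
proof
  assume x: "parabolic x"
  then obtain A where A: "A \<in> carrier SL2R" "x = psl A" by (auto simp: parabolic_def carrier_PSL2R)
  then have "A \<in> x" by (simp add: psl_eq)
  then have tr: "\<bar>trace A\<bar> = 2" using x by (simp add: parabolic_def)
  define B where "B = (if trace A = 2 then A else - A)"
  have B: "B \<in> carrier SL2R" "x = psl B" using A by (auto simp: B_def SL2R_closed psl_uminus)
  have "trace (- A) = - trace A" by (simp add: trace_def sum_2)
  then have "trace B = 2" using tr by (auto simp: B_def)
  moreover have "B \<noteq> mat 1" using x B by (auto simp: parabolic_def psl_one)
  ultimately show "\<exists>s \<nu>. (s = 1 \<or> s = - 1) \<and> \<nu> \<noteq> 0 \<and> x = psl (tmat s \<nu>)"
    using unipotent_eq_tmat[OF B(1)] B(2) by auto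
next
  assume "\<exists>s \<nu>. (s = 1 \<or> s = - 1) \<and> \<nu> \<noteq> 0 \<and> x = psl (tmat s \<nu>)"
  then obtain s \<nu> where s: "s = 1 \<or> s = - 1" "\<nu> \<noteq> 0" "x = psl (tmat s \<nu>)" by auto
  have "trace (- tmat s \<nu>) = - 2" using trace_tmat[of s \<nu>] by (simp add: trace_def sum_2)
  then show "parabolic x"
    unfolding parabolic_def using s tmat_neq_1[of s \<nu>] trace_tmat
    by (auto simp: psl_closed tmat_SL2R psl_one psl_eq_iff) (auto simp: psl_eq trace_tmat)
qed

lemma conjugate_unipotent:
  fixes G G' :: "real^2^2" and c :: real
  assumes G: "det G = 1" and "G ** G' = mat 1"
  defines "M \<equiv> G ** vector [vector [1, c], vector [0, 1]] ** G'"
  shows "M$1$2 = c * G$1$1 * G$1$1" "M$2$1 = - c * G$2$1 * G$2$1"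
    "M$1$1 = 1 - c * G$1$1 * G$2$1" "M$2$2 = 1 + c * G$1$1 * G$2$1"
proof -
  define p q r t where "p = G$1$1" and "q = G$1$2" and "r = G$2$1" and "t = G$2$2"
  have d: "p * t - q * r = 1" using G by (simp add: det_2 p_def q_def r_def t_def)
  have e: "p * G'$1$1 + q * G'$2$1 = 1" "p * G'$1$2 + q * G'$2$2 = 0"
    "r * G'$1$1 + t * G'$2$1 = 0" "r * G'$1$2 + t * G'$2$2 = 1"
    using assms(2) by (simp_all add: vec_eq_iff forall_2 matrix_matrix_mult_def sum_2 mat_def p_def q_def r_def t_def)
  have G': "G'$1$1 = t" "G'$1$2 = - q" "G'$2$1 = - r" "G'$2$2 = p"
    using d e by algebra+
  show "M$1$2 = c * G$1$1 * G$1$1" "M$2$1 = - c * G$2$1 * G$2$1"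
    "M$1$1 = 1 - c * G$1$1 * G$2$1" "M$2$2 = 1 + c * G$1$1 * G$2$1"
    using d unfolding M_def
    by (simp_all add: matrix_matrix_mult_def sum_2 G' p_def[symmetric] q_def[symmetric] r_def[symmetric] t_def[symmetric])
      (simp_all add: algebra_simps)
qed

lemma SL2R_inverse:
  assumes "G \<in> carrier SL2R"
  obtains G' where "G' \<in> carrier SL2R" "G ** G' = mat 1" "G' ** G = mat 1" "inv\<^bsub>PSL2R\<^esub> (psl G) = psl G'"
proof -
  interpret S: group SL2R by (rule group_SL2R)
  interpret P: group PSL2R by (rule group_PSL2R)
  define G' where "G' = inv\<^bsub>SL2R\<^esub> G"
  have G': "G' \<in> carrier SL2R" "G ** G' = mat 1" "G' ** G = mat 1"
    using S.inv_closed[OF assms] S.r_inv[OF assms] S.l_inv[OF assms] by (simp_all add: G'_def)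
  have "psl G' \<otimes>\<^bsub>PSL2R\<^esub> psl G = \<one>\<^bsub>PSL2R\<^esub>"
    using G' assms by (simp add: psl_mult psl_one)
  then have "inv\<^bsub>PSL2R\<^esub> (psl G) = psl G'"
    using G' assms by (intro P.inv_equality) (auto simp: psl_closed)
  with G' show thesis by (rule that)
qed

lemma unipotent_SL2R: "vector [vector [1, c], vector [0, 1]] \<in> carrier SL2R"
  by (simp add: carrier_SL2R det_2)

lemma tmat_conjugate:
  assumes "\<nu> \<noteq> 0"
  shows "PSL2R_conjugate (psl (tmat s \<nu>)) (psl (vector [vector [1, s], vector [0, 1]]))"
proof -
  define a b where "a = Im (csqrt \<nu>)" and "b = Re (csqrt \<nu>)"
  define n where "n = a * a + b * b"
  have n: "n = cmod \<nu>"
    using cmod_sq[of "csqrt \<nu>"] by (simp add: n_def a_def b_def flip: power2_eq_square)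
  have \<nu>: "Re \<nu> = b * b - a * a" "Im \<nu> = 2 * a * b"
    using power2_csqrt[of \<nu>] by (simp_all add: complex_eq_iff power2_eq_square a_def b_def)
  \<comment> \<open>The first column is the axis \<open>csqrt \<nu>\<close>; the second is
    orthogonal to it with reciprocal length, so that the determinant is \<open>1\<close>.\<close>
  define G :: "real^2^2" where "G = vector [vector [a, - b / n], vector [b, a / n]]"
  have "n \<noteq> 0" using assms n by simp
  moreover have "det G = n / n" unfolding add_divide_distrib[of "a * a" "b * b" n, folded n_def] by (simp add: G_def det_2)
  ultimately have dG: "det G = 1" by simp
  then have G: "G \<in> carrier SL2R" by (simp add: carrier_SL2R)
  obtain G' where G': "G' \<in> carrier SL2R" "G ** G' = mat 1" "inv\<^bsub>PSL2R\<^esub> (psl G) = psl G'"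
    using SL2R_inverse[OF G] by metis
  let ?U = "vector [vector [1, s], vector [0, 1]] :: real^2^2"
  have "G ** ?U ** G' = tmat s \<nu>"
    unfolding vec_eq_iff forall_2 conjugate_unipotent[OF dG G'(2)]
    by (simp add: G_def tmat_def n[symmetric] \<nu> n_def)
  then have "psl (tmat s \<nu>) = psl G \<otimes>\<^bsub>PSL2R\<^esub> psl ?U \<otimes>\<^bsub>PSL2R\<^esub> inv\<^bsub>PSL2R\<^esub> (psl G)"
    using G G' unipotent_SL2R by (simp add: psl_mult SL2R_closed)
  then show ?thesis
    unfolding PSL2R_conjugate_def using psl_closed[OF G] by blast
qed

text \<open>The difference of the off-diagonal entries is \<open>s * cmod \<nu>\<close> for the
  transvection and \<open>c\<close> times a sum of squares for the conjugate. The trace decides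
  between the two representatives.\<close>

lemma tmat_conjugate_sign:
  assumes "PSL2R_conjugate (psl (tmat s \<nu>)) (psl (vector [vector [1, c], vector [0, 1]]))"
  shows "s * c \<ge> 0 \<or> \<nu> = 0"
proof -
  obtain G where G: "G \<in> carrier SL2R"
    and eq: "psl (tmat s \<nu>) = psl G \<otimes>\<^bsub>PSL2R\<^esub> psl (vector [vector [1, c], vector [0, 1]]) \<otimes>\<^bsub>PSL2R\<^esub> inv\<^bsub>PSL2R\<^esub> (psl G)"
    using assms by (auto simp: PSL2R_conjugate_def carrier_PSL2R)
  obtain G' where G': "G' \<in> carrier SL2R" "G ** G' = mat 1" "inv\<^bsub>PSL2R\<^esub> (psl G) = psl G'"
    using SL2R_inverse[OF G] by metis
  define M where "M = G ** vector [vector [1, c], vector [0, 1]] ** G'"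
  note M = conjugate_unipotent[of G G' c, folded M_def, OF _ G'(2)]
  have dG: "det G = 1" using G by (simp add: carrier_SL2R)
  have "psl (tmat s \<nu>) = psl M"
    using eq G G' unipotent_SL2R by (simp add: psl_mult SL2R_closed M_def)
  then have "tmat s \<nu> = M \<or> tmat s \<nu> = - M" by (simp add: psl_eq_iff)
  moreover have "trace M = 2" "trace (- M) = - 2" using M[OF dG] by (simp_all add: trace_def sum_2)
  ultimately have eqM: "tmat s \<nu> = M" using trace_tmat[of s \<nu>] by auto
  have "s * cmod \<nu> = tmat s \<nu> $ 1 $ 2 - tmat s \<nu> $ 2 $ 1" by (simp add: tmat_def field_simps)
  also have "\<dots> = c * (G$1$1 * G$1$1 + G$2$1 * G$2$1)" unfolding eqM M[OF dG] by (simp add: algebra_simps)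
  finally have *: "(s * c) * cmod \<nu> = c * c * (G$1$1 * G$1$1 + G$2$1 * G$2$1)" by (simp add: algebra_simps)
  have "(s * c) * cmod \<nu> \<ge> 0" unfolding * by simp
  then show ?thesis using mult_le_cancel_right_pos[of "cmod \<nu>" 0 "s * c"] by auto
qed

lemma parabolic_sign_tmat:
  assumes "s = 1 \<or> s = - 1" "\<nu> \<noteq> 0"
  shows "real_of_int (parabolic_sign (psl (tmat s \<nu>))) = s"
proof -
  have par: "parabolic (psl (tmat s \<nu>))" unfolding parabolic_iff using assms by blast
  show ?thesis
  proof (cases "s = 1")
    case True
    then show ?thesis using par tmat_conjugate[OF assms(2), of 1]
      by (simp add: parabolic_sign_def positive_parabolic_def)
  next
    case False
    then have s: "s = - 1" using assms by simp
    then have "\<not> positive_parabolic (psl (tmat s \<nu>))"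
      using tmat_conjugate_sign[of s \<nu> 1] assms(2) by (auto simp: positive_parabolic_def)
    then show ?thesis using s par tmat_conjugate[OF assms(2), of "- 1"]
      by (simp add: parabolic_sign_def negative_parabolic_def)
  qed
qed

section \<open>The universal covering group\<close>

abbreviation "PSLT \<equiv> PSL2R_topology"
abbreviation "cls \<equiv> path_class PSL2R_topology"
abbreviation "bpaths \<equiv> based_paths PSL2R PSL2R_topology"

section \<open>Path classes and their pointwise products\<close>

lemma path_class_self: "pathin T g \<Longrightarrow> g \<in> path_class T g"
  by (simp add: path_class_def pathin_def)

lemma path_class_eq:
  assumes "h \<in> path_class T g"
  shows "path_class T h = path_class T g"
proof -
  let ?P = "\<lambda>r. r 0 = g 0 \<and> r 1 = g 1"
  have hg: "homotopic_with ?P (top_of_set {0..1}) T g h" using assms by (simp add: path_class_def)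
  have P: "h 0 = g 0" "h 1 = g 1" using homotopic_with_imp_property[OF hg] by auto
  have "homotopic_with ?P (top_of_set {0..1}) T g k \<longleftrightarrow> homotopic_with ?P (top_of_set {0..1}) T h k" for k
    using homotopic_with_trans[OF hg, of k] homotopic_with_trans[OF homotopic_with_symD[OF hg], of k]
    by (rule iffI[rotated])
  then show ?thesis unfolding path_class_def P by (intro Collect_cong) (rule HOL.sym)
qed

lemma path_class_eqI:
  assumes "homotopic_with (\<lambda>r. r 0 = g 0 \<and> r 1 = g 1) (top_of_set {0..1}) T g h"
  shows "path_class T g = path_class T h"
proof (rule path_class_eq[THEN HOL.sym])
  show "h \<in> path_class T g" unfolding path_class_def mem_Collect_eq by (rule assms)
qed

lemma path_class_cong:
  assumes "pathin T g" "\<And>t. t \<in> {0..1} \<Longrightarrow> g t = h t"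
  shows "path_class T g = path_class T h"
  by (rule path_class_eqI, rule homotopic_with_equal) (use assms in \<open>auto simp: pathin_def\<close>)

lemma homotopic_PSL2R_mult:
  assumes "homotopic_with P X PSLT g g'" "homotopic_with Q X PSLT h h'"
    and "\<And>a b. P a \<Longrightarrow> Q b \<Longrightarrow> R (\<lambda>t. a t \<otimes>\<^bsub>PSL2R\<^esub> b t)"
  shows "homotopic_with R X PSLT (\<lambda>t. g t \<otimes>\<^bsub>PSL2R\<^esub> h t) (\<lambda>t. g' t \<otimes>\<^bsub>PSL2R\<^esub> h' t)"
proof -
  obtain k where k: "continuous_map (prod_topology (top_of_set {0..1::real}) X) PSLT k"
    "\<forall>x. k (0, x) = g x" "\<forall>x. k (1, x) = g' x" "\<forall>t\<in>{0..1}. P (\<lambda>x. k (t, x))"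
    using assms(1) unfolding homotopic_with_def by auto
  obtain l where l: "continuous_map (prod_topology (top_of_set {0..1::real}) X) PSLT l"
    "\<forall>x. l (0, x) = h x" "\<forall>x. l (1, x) = h' x" "\<forall>t\<in>{0..1}. Q (\<lambda>x. l (t, x))"
    using assms(2) unfolding homotopic_with_def by auto
  have "continuous_map (prod_topology (top_of_set {0..1}) X) (prod_topology PSLT PSLT) (\<lambda>z. (k z, l z))"
    using k(1) l(1) by (simp add: continuous_map_pairwise o_def)
  from continuous_map_compose[OF this continuous_map_PSL2R_mult]
  have "continuous_map (prod_topology (top_of_set {0..1}) X) PSLT (\<lambda>z. k z \<otimes>\<^bsub>PSL2R\<^esub> l z)"
    by (simp add: o_def)
  then show ?thesis
    unfolding homotopic_with_def
  proof (intro exI[of _ "\<lambda>z. k z \<otimes>\<^bsub>PSL2R\<^esub> l z"] conjI allI ballI)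
    fix t :: real assume "t \<in> {0..1}"
    then show "R (\<lambda>x. k (t, x) \<otimes>\<^bsub>PSL2R\<^esub> l (t, x))"
      using k(4) l(4) by (intro assms(3)) simp_all
  qed (simp_all add: k(2,3) l(2,3))
qed

lemma based_mult:
  assumes "g \<in> bpaths" "h \<in> bpaths"
  shows "(\<lambda>t. g t \<otimes>\<^bsub>PSL2R\<^esub> h t) \<in> bpaths"
proof -
  interpret group PSL2R by (rule group_PSL2R)
  have "continuous_map (top_of_set {0..1::real}) (prod_topology PSLT PSLT) (\<lambda>z. (g z, h z))"
    using assms by (simp add: continuous_map_pairwise o_def based_paths_def pathin_def)
  from continuous_map_compose[OF this continuous_map_PSL2R_mult] show ?thesis
    using assms by (simp add: based_paths_def pathin_def o_def)
qed

text \<open>Homotopic representatives have homotopic products, so the union in the definition runs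
  over copies of a single class.\<close>

lemma tilde_mult:
  assumes "g \<in> bpaths" "h \<in> bpaths"
  shows "cls g \<otimes>\<^bsub>SL2R_tilde\<^esub> cls h = cls (\<lambda>t. g t \<otimes>\<^bsub>PSL2R\<^esub> h t)"
proof -
  have eq: "cls (\<lambda>t. g' t \<otimes>\<^bsub>PSL2R\<^esub> h' t) = cls (\<lambda>t. g t \<otimes>\<^bsub>PSL2R\<^esub> h t)"
    if "g' \<in> cls g" "h' \<in> cls h" for g' h'
  proof -
    have g: "homotopic_with (\<lambda>r. r 0 = g 0 \<and> r 1 = g 1) (top_of_set {0..1}) PSLT g g'"
      and h: "homotopic_with (\<lambda>r. r 0 = h 0 \<and> r 1 = h 1) (top_of_set {0..1}) PSLT h h'"
      using that by (simp_all add: path_class_def)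
    show ?thesis
      by (rule HOL.sym[OF path_class_eqI], rule homotopic_PSL2R_mult[OF g h]) auto
  qed
  have ne: "cls g \<noteq> {}" "cls h \<noteq> {}"
    using assms path_class_self[of PSLT g] path_class_self[of PSLT h] by (auto simp: based_paths_def)
  have "(\<Union>g'\<in>cls g. \<Union>h'\<in>cls h. cls (\<lambda>t. g' t \<otimes>\<^bsub>PSL2R\<^esub> h' t)) =
      (\<Union>g'\<in>cls g. \<Union>h'\<in>cls h. cls (\<lambda>t. g t \<otimes>\<^bsub>PSL2R\<^esub> h t))"
    by (intro SUP_cong HOL.refl eq)
  then show ?thesis using ne by (simp add: SL2R_tilde_def universal_cover_def)
qed

lemma carrier_tilde: "carrier SL2R_tilde = cls ` bpaths"
  by (simp add: SL2R_tilde_def universal_cover_def)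

lemma one_tilde: "\<one>\<^bsub>SL2R_tilde\<^esub> = cls (\<lambda>t. \<one>\<^bsub>PSL2R\<^esub>)"
  by (simp add: SL2R_tilde_def universal_cover_def)

lemma based_one: "(\<lambda>t. \<one>\<^bsub>PSL2R\<^esub>) \<in> bpaths"
  by (simp add: based_paths_def pathin_def topspace_PSL2R_topology group.is_monoid[OF group_PSL2R] monoid.one_closed)

lemma based_closed: "g \<in> bpaths \<Longrightarrow> t \<in> {0..1} \<Longrightarrow> g t \<in> carrier PSL2R"
  using continuous_map_image_subset_topspace[of "top_of_set {0..1}" PSLT g]
  by (auto simp: based_paths_def pathin_def topspace_PSL2R_topology)

lemma monoid_tilde: "monoid SL2R_tilde"
proof (rule monoidI)
  interpret group PSL2R by (rule group_PSL2R)
  show "\<one>\<^bsub>SL2R_tilde\<^esub> \<in> carrier SL2R_tilde"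
    unfolding carrier_tilde one_tilde using based_one by auto
  fix x assume "x \<in> carrier SL2R_tilde"
  then obtain g where g: "g \<in> bpaths" "x = cls g" by (auto simp: carrier_tilde)
  have pg: "pathin PSLT g" using g by (simp add: based_paths_def)
  show "\<one>\<^bsub>SL2R_tilde\<^esub> \<otimes>\<^bsub>SL2R_tilde\<^esub> x = x"
    unfolding one_tilde g(2) tilde_mult[OF based_one g(1)]
    by (rule path_class_cong[THEN HOL.sym]) (use pg based_closed[OF g(1)] in auto)
  show "x \<otimes>\<^bsub>SL2R_tilde\<^esub> \<one>\<^bsub>SL2R_tilde\<^esub> = x"
    unfolding one_tilde g(2) tilde_mult[OF g(1) based_one]
    by (rule path_class_cong[THEN HOL.sym]) (use pg based_closed[OF g(1)] in auto)
  fix y assume "y \<in> carrier SL2R_tilde"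
  then obtain h where h: "h \<in> bpaths" "y = cls h" by (auto simp: carrier_tilde)
  show "x \<otimes>\<^bsub>SL2R_tilde\<^esub> y \<in> carrier SL2R_tilde"
    unfolding g(2) h(2) tilde_mult[OF g(1) h(1)] carrier_tilde using based_mult[OF g(1) h(1)] by auto
  fix z assume "z \<in> carrier SL2R_tilde"
  then obtain k where k: "k \<in> bpaths" "z = cls k" by (auto simp: carrier_tilde)
  have "pathin PSLT (\<lambda>t. (g t \<otimes>\<^bsub>PSL2R\<^esub> h t) \<otimes>\<^bsub>PSL2R\<^esub> k t)"
    using based_mult[OF based_mult[OF g(1) h(1)] k(1)] by (simp add: based_paths_def)
  then show "x \<otimes>\<^bsub>SL2R_tilde\<^esub> y \<otimes>\<^bsub>SL2R_tilde\<^esub> z = x \<otimes>\<^bsub>SL2R_tilde\<^esub> (y \<otimes>\<^bsub>SL2R_tilde\<^esub> z)"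
    unfolding g(2) h(2) k(2) tilde_mult[OF g(1) h(1)] tilde_mult[OF h(1) k(1)]
      tilde_mult[OF based_mult[OF g(1) h(1)] k(1)] tilde_mult[OF g(1) based_mult[OF h(1) k(1)]]
    by (rule path_class_cong) (use based_closed g h k in \<open>auto simp: m_assoc\<close>)
qed

lemma cover_proj_cls:
  assumes "pathin PSLT g"
  shows "cover_proj (cls g) = g 1"
proof -
  have "(\<lambda>h. h 1) ` cls g = {g 1}"
  proof
    show "(\<lambda>h. h 1) ` cls g \<subseteq> {g 1}"
      by (auto simp: path_class_def dest!: homotopic_with_imp_property)
    show "{g 1} \<subseteq> (\<lambda>h. h 1) ` cls g" using path_class_self[OF assms] by auto
  qed
  then show ?thesis by (simp add: cover_proj_def)
qed

text \<open>The paths of cosets that matter come from paths of matrices, for which products and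
  homotopies can be computed directly.\<close>

definition slpath :: "(real \<Rightarrow> real^2^2) \<Rightarrow> bool" where
  "slpath A \<longleftrightarrow> continuous_on {0..1} A \<and> (\<forall>t\<in>{0..1}. A t \<in> carrier SL2R) \<and> A 0 = mat 1"

lemma slpath_based: "slpath A \<Longrightarrow> (\<lambda>t. psl (A t)) \<in> bpaths"
  using continuous_map_psl_comp[of "{0..1}" A]
  by (simp add: slpath_def based_paths_def pathin_def psl_one)

lemma slpath_mult: "slpath A \<Longrightarrow> slpath B \<Longrightarrow> slpath (\<lambda>t. A t ** B t)"
  by (auto simp: slpath_def SL2R_closed intro: continuous_on_matrix_mult)

lemma slpath_cls_mult:
  assumes "slpath A" "slpath B"
  shows "cls (\<lambda>t. psl (A t)) \<otimes>\<^bsub>SL2R_tilde\<^esub> cls (\<lambda>t. psl (B t)) = cls (\<lambda>t. psl (A t ** B t))"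
  unfolding tilde_mult[OF slpath_based slpath_based, OF assms]
proof (rule path_class_cong)
  show "pathin PSLT (\<lambda>t. psl (A t) \<otimes>\<^bsub>PSL2R\<^esub> psl (B t))"
    using based_mult[OF slpath_based slpath_based, OF assms] by (simp add: based_paths_def)
qed (use assms in \<open>auto simp: slpath_def psl_mult\<close>)

lemma slpath_const: "slpath (\<lambda>t. mat 1)"
  by (simp add: slpath_def SL2R_closed)

lemma slpath_cls_foldr:
  assumes "\<And>i. i \<in> set l \<Longrightarrow> slpath (A i)"
  shows "slpath (\<lambda>t. foldr (**) (map (\<lambda>i. A i t) l) (mat 1)) \<and>
    foldr (\<otimes>\<^bsub>SL2R_tilde\<^esub>) (map (\<lambda>i. cls (\<lambda>t. psl (A i t))) l) \<one>\<^bsub>SL2R_tilde\<^esub> =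
      cls (\<lambda>t. psl (foldr (**) (map (\<lambda>i. A i t) l) (mat 1)))"
  using assms
proof (induction l)
  case Nil
  then show ?case by (simp add: slpath_const one_tilde psl_one)
next
  case (Cons i l)
  then have 1: "slpath (\<lambda>t. foldr (**) (map (\<lambda>i. A i t) l) (mat 1))" "slpath (A i)"
    and 2: "foldr (\<otimes>\<^bsub>SL2R_tilde\<^esub>) (map (\<lambda>i. cls (\<lambda>t. psl (A i t))) l) \<one>\<^bsub>SL2R_tilde\<^esub> =
      cls (\<lambda>t. psl (foldr (**) (map (\<lambda>i. A i t) l) (mat 1)))"
    by auto
  show ?case using slpath_mult[OF 1(2,1)] slpath_cls_mult[OF 1(2,1)] 2 by simp
qed

section \<open>One-parameter subgroups in closed form\<close>

lemma mat2_square: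
  fixes X :: "real^2^2"
  assumes "trace X = 0"
  shows "X ** X = (- det X) *\<^sub>R mat 1"
proof -
  have "X$2$2 = - X$1$1" using assms by (simp add: trace_def sum_2)
  then show ?thesis
    by (simp add: vec_eq_iff forall_2 matrix_matrix_mult_def sum_2 mat_def det_2 algebra_simps)
qed

lemma matrix_scaleR_left: "(a *\<^sub>R A) ** B = a *\<^sub>R (A ** B)" and matrix_scaleR_right: "A ** (a *\<^sub>R B) = a *\<^sub>R (A ** B)"
  for A B :: "real^2^2"
  by (simp_all add: vec_eq_iff matrix_matrix_mult_def sum_distrib_left mult_ac)

lemma matrix_funpow:
  fixes Y :: "real^2^2"
  assumes "Y ** Y = e *\<^sub>R mat 1"
  shows "((**) Y ^^ k) (mat 1) = (if even k then e ^ (k div 2) *\<^sub>R mat 1 else e ^ (k div 2) *\<^sub>R Y)"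
proof (induction k)
  case (Suc k)
  then show ?case
    by (cases "even k") (auto simp: matrix_scaleR_right assms elim!: oddE)
qed simp

text \<open>As the square of \<open>Y\<close> is scalar, even powers are scalar and odd powers are
  multiples of \<open>Y\<close>; the exponential series splits accordingly.\<close>

lemma mat_exp_eq:
  fixes Y :: "real^2^2"
  assumes Y: "Y ** Y = e *\<^sub>R mat 1"
    and C: "(\<lambda>k. if even k then e ^ (k div 2) / fact k else 0) sums C"
    and S: "(\<lambda>k. if even k then 0 else e ^ (k div 2) / fact k) sums S"
  shows "mat_exp Y = C *\<^sub>R mat 1 + S *\<^sub>R Y"
proof -
  have "(\<lambda>k. (if even k then e ^ (k div 2) / fact k else 0) *\<^sub>R mat 1 +
      (if even k then 0 else e ^ (k div 2) / fact k) *\<^sub>R Y) sums (C *\<^sub>R mat 1 + S *\<^sub>R Y)"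
    by (intro sums_add sums_scaleR_left C S)
  moreover have "(1 / fact k) *\<^sub>R (((**) Y ^^ k) (mat 1)) = (if even k then e ^ (k div 2) / fact k else 0) *\<^sub>R mat 1 +
      (if even k then 0 else e ^ (k div 2) / fact k) *\<^sub>R Y" for k
    unfolding matrix_funpow[OF Y] by simp
  ultimately show ?thesis
    unfolding mat_exp_def by (simp add: sums_iff)
qed

lemma mat_exp_nilpotent:
  fixes Y :: "real^2^2"
  assumes "Y ** Y = 0"
  shows "mat_exp Y = mat 1 + Y"
proof -
  have 0: "(\<lambda>k. if even k then 0 ^ (k div 2) / fact k else 0) sums (\<Sum>k\<in>{0}. if even k then 0 ^ (k div 2) / fact k else (0::real))"
    by (rule sums_finite) (auto simp: power_0_left elim!: evenE)
  have 1: "(\<lambda>k. if even k then 0 else 0 ^ (k div 2) / fact k) sums (\<Sum>k\<in>{1}. if even k then 0 else 0 ^ (k div 2) / fact k :: real)"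
    by (rule sums_finite) (auto simp: power_0_left, presburger)
  show ?thesis using mat_exp_eq[of Y 0, OF _ 0 1] assms by simp
qed

lemma mat_exp_hyperbolic:
  fixes Y :: "real^2^2"
  assumes "Y ** Y = (d * d) *\<^sub>R mat 1" "d \<noteq> 0"
  shows "mat_exp Y = cosh d *\<^sub>R mat 1 + (sinh d / d) *\<^sub>R Y"
proof (rule mat_exp_eq[OF assms(1)])
  show "(\<lambda>k. if even k then (d * d) ^ (k div 2) / fact k else 0) sums cosh d"
    using cosh_converges[of d] by (rule sums_cong[THEN iffD1, rotated]) (auto simp: power_mult_distrib divide_inverse mult.commute elim!: evenE simp flip: power_add mult_2)
  have "(\<lambda>k. (if even k then 0 else d ^ k /\<^sub>R fact k) / d) sums (sinh d / d)"
    by (rule sums_divide[OF sinh_converges])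
  then show "(\<lambda>k. if even k then 0 else (d * d) ^ (k div 2) / fact k) sums (sinh d / d)"
    by (rule sums_cong[THEN iffD1, rotated]) (use assms(2) in \<open>auto simp: power_mult_distrib field_simps elim!: oddE simp flip: power_add mult_2\<close>)
qed

lemma mat_exp_elliptic:
  fixes Y :: "real^2^2"
  assumes "Y ** Y = (- (d * d)) *\<^sub>R mat 1" "d \<noteq> 0"
  shows "mat_exp Y = cos d *\<^sub>R mat 1 + (sin d / d) *\<^sub>R Y"
proof (rule mat_exp_eq[OF assms(1)])
  show "(\<lambda>k. if even k then (- (d * d)) ^ (k div 2) / fact k else 0) sums cos d"
    using cos_converges[of d]
    by (rule sums_cong[THEN iffD1, rotated]) (auto simp: cos_coeff_def power_mult_distrib power_minus[of "d * d"] elim!: evenE simp flip: power_add mult_2)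
  have "(\<lambda>k. (sin_coeff k *\<^sub>R d ^ k) / d) sums (sin d / d)"
    by (rule sums_divide[OF sin_converges])
  then show "(\<lambda>k. if even k then 0 else (- (d * d)) ^ (k div 2) / fact k) sums (sin d / d)"
    by (rule sums_cong[THEN iffD1, rotated]) (use assms(2) in \<open>auto simp: sin_coeff_def power_mult_distrib power_minus[of "d * d"] elim!: oddE simp flip: power_add mult_2\<close>)
qed

definition rot :: "real \<Rightarrow> real^2^2" where
  "rot t = vector [vector [cos t, sin t], vector [- sin t, cos t]]"

text \<open>By Cayley-Hamilton the square of \<open>X\<close> is the scalar \<open>- det X\<close>,
  so the coefficients are hyperbolic, polynomial or trigonometric according to the sign of the
  determinant. The quadratic relation says that the exponential has determinant
  \<open>1\<close>.\<close>

lemma sl2R_param: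
  assumes "X \<in> sl2R"
  obtains C S where "\<And>t. mat_exp (t *\<^sub>R X) = C t *\<^sub>R mat 1 + S t *\<^sub>R X"
    "continuous_on UNIV C" "continuous_on UNIV S" "\<And>t. (C t)\<^sup>2 + det X * (S t)\<^sup>2 = 1" "C 0 = 1" "S 0 = 0"
    "det X < 0 \<Longrightarrow> C 1 > 1" "det X = 0 \<Longrightarrow> S 1 = 1"
proof -
  have tr: "trace X = 0" using assms by (simp add: sl2R_def)
  have sq: "(t *\<^sub>R X) ** (t *\<^sub>R X) = (t * t * (- det X)) *\<^sub>R mat 1" for t
    using mat2_square[OF tr] by (simp add: matrix_scaleR_left matrix_scaleR_right)
  have zero: "mat_exp (0 *\<^sub>R X) = mat 1"
    using mat_exp_nilpotent[of "0 *\<^sub>R X"] sq[of 0] by simp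
  consider "det X < 0" | "det X = 0" | "det X > 0" by linarith
  then show thesis
  proof cases
    case 1
    define d where "d = sqrt (- det X)"
    have d: "d > 0" "d * d = - det X" using 1 by (simp_all add: d_def)
    have "mat_exp (t *\<^sub>R X) = cosh (t * d) *\<^sub>R mat 1 + (sinh (t * d) / d) *\<^sub>R X" for t
    proof (cases "t = 0")
      case False
      have "(t *\<^sub>R X) ** (t *\<^sub>R X) = ((t * d) * (t * d)) *\<^sub>R mat 1"
        unfolding sq d(2)[symmetric] by (simp add: mult_ac)
      then have "mat_exp (t *\<^sub>R X) = cosh (t * d) *\<^sub>R mat 1 + (sinh (t * d) / (t * d)) *\<^sub>R (t *\<^sub>R X)"
        by (rule mat_exp_hyperbolic) (use False d in simp)
      then show ?thesis using False by simp
    qed (use zero in simp)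
    then show thesis
    proof (rule that[of "\<lambda>t. cosh (t * d)" "\<lambda>t. sinh (t * d) / d"])
      have "det X = - (d * d)" using d by simp
      then show "(cosh (t * d))\<^sup>2 + det X * (sinh (t * d) / d)\<^sup>2 = 1" for t
        using 1 d(2) cosh_square_eq[of "t * d"] by (simp add: power_divide power2_eq_square[of d])
      have "(cosh d)\<^sup>2 \<noteq> 1" using d cosh_square_eq[of d] by simp
      then have "cosh d \<noteq> 1" by auto
      then show "cosh (1 * d) > 1" using cosh_real_ge_1[of d] by (simp add: order_less_le)
    qed (use 1 d in \<open>auto intro!: continuous_intros\<close>)
  next
    case 2
    then have "mat_exp (t *\<^sub>R X) = 1 *\<^sub>R mat 1 + t *\<^sub>R X" for t
      using mat_exp_nilpotent[of "t *\<^sub>R X"] sq[of t] by simp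
    then show thesis
      by (rule that[of "\<lambda>t. 1" "\<lambda>t. t"]) (use 2 in \<open>auto intro!: continuous_intros\<close>)
  next
    case 3
    define d where "d = sqrt (det X)"
    have d: "d > 0" "d * d = det X" using 3 by (simp_all add: d_def)
    have "mat_exp (t *\<^sub>R X) = cos (t * d) *\<^sub>R mat 1 + (sin (t * d) / d) *\<^sub>R X" for t
    proof (cases "t = 0")
      case False
      have "(t *\<^sub>R X) ** (t *\<^sub>R X) = (- ((t * d) * (t * d))) *\<^sub>R mat 1"
        unfolding sq d(2)[symmetric] by (simp add: mult_ac)
      then have "mat_exp (t *\<^sub>R X) = cos (t * d) *\<^sub>R mat 1 + (sin (t * d) / (t * d)) *\<^sub>R (t *\<^sub>R X)"
        by (rule mat_exp_elliptic) (use False d in simp)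
      then show ?thesis using False by simp
    qed (use zero in simp)
    then show thesis
    proof (rule that[of "\<lambda>t. cos (t * d)" "\<lambda>t. sin (t * d) / d"])
      show "(cos (t * d))\<^sup>2 + det X * (sin (t * d) / d)\<^sup>2 = 1" for t
        using 3 d(2) by (simp add: power_divide power2_eq_square[of d])
    qed (use 3 d in \<open>auto intro!: continuous_intros\<close>)
  qed
qed

lemma det_param:
  fixes X :: "real^2^2"
  assumes "trace X = 0"
  shows "det (a *\<^sub>R mat 1 + b *\<^sub>R X) = a\<^sup>2 + det X * b\<^sup>2"
proof -
  have "X$2$2 = - X$1$1" using assms by (simp add: trace_def sum_2)
  then show ?thesis by (simp add: det_2 mat_def power2_eq_square algebra_simps)
qed

lemma slpath_exp:
  assumes "X \<in> sl2R"
  shows "slpath (\<lambda>t. mat_exp (t *\<^sub>R X))"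
proof -
  obtain C S where *: "\<And>t. mat_exp (t *\<^sub>R X) = C t *\<^sub>R mat 1 + S t *\<^sub>R X"
    "continuous_on UNIV C" "continuous_on UNIV S" "\<And>t. (C t)\<^sup>2 + det X * (S t)\<^sup>2 = 1" "C 0 = 1" "S 0 = 0"
    using sl2R_param[OF assms] by metis
  have "continuous_on {0..1} (\<lambda>t. C t *\<^sub>R mat 1 + S t *\<^sub>R X)"
    using continuous_on_subset[OF *(2), of "{0..1}"] continuous_on_subset[OF *(3), of "{0..1}"]
    by (intro continuous_intros) auto
  then show ?thesis
    unfolding slpath_def *(1) using * det_param[of X] assms by (simp add: carrier_SL2R sl2R_def)
qed

text \<open>The logarithm of \<open>tmat s \<nu>\<close>: its square is zero, so the exponential
  series stops after the linear term.\<close>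

definition nil :: "real \<Rightarrow> complex \<Rightarrow> real^2^2" where
  "nil s \<nu> = tmat s \<nu> - mat 1"

lemma nil_sl2R: "nil s \<nu> \<in> sl2R" and det_nil: "det (nil s \<nu>) = 0"
proof -
  show "nil s \<nu> \<in> sl2R" using trace_tmat[of s \<nu>] by (simp add: nil_def sl2R_def trace_def sum_2 mat_def)
  have "s * s * (cmod \<nu> * cmod \<nu>) = s * s * (Re \<nu> * Re \<nu> + Im \<nu> * Im \<nu>)" by (simp add: cmod_sq)
  then show "det (nil s \<nu>) = 0"
    by (simp add: nil_def tmat_def det_2 mat_def field_simps)
qed

text \<open>Because \<open>cmod \<nu>\<close> enters, \<open>tmat s\<close> is affine only along
  rays. So the one-parameter subgroup through a transvection is obtained by scaling
  \<open>\<nu>\<close>.\<close>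

lemma tmat_scale:
  assumes "t \<ge> 0"
  shows "tmat s (of_real t * \<nu>) = mat 1 + t *\<^sub>R nil s \<nu>"
  using assms by (simp add: tmat_def nil_def vec_eq_iff forall_2 mat_def norm_mult field_simps)

lemma exp_nil: "mat_exp (t *\<^sub>R nil s \<nu>) = mat 1 + t *\<^sub>R nil s \<nu>"
proof (rule mat_exp_nilpotent)
  have "nil s \<nu> ** nil s \<nu> = 0"
    using mat2_square[of "nil s \<nu>"] nil_sl2R[of s \<nu>] det_nil by (simp add: sl2R_def)
  then show "(t *\<^sub>R nil s \<nu>) ** (t *\<^sub>R nil s \<nu>) = 0" by (simp add: matrix_scaleR_left matrix_scaleR_right)
qed

lemma slpath_pathin: "slpath A \<Longrightarrow> pathin PSLT (\<lambda>t. psl (A t))"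
  using slpath_based by (auto simp: based_paths_def)

lemma exp_tilde_nil: "exp_tilde (nil s \<nu>) = cls (\<lambda>t. psl (tmat s (of_real t * \<nu>)))"
  unfolding exp_tilde_def
  by (rule path_class_cong[OF slpath_pathin[OF slpath_exp[OF nil_sl2R]]]) (simp add: exp_nil tmat_scale)

text \<open>Uniqueness: an exponential of trace \<open>\<plusminus>2\<close> that is not
  \<open>\<plusminus>1\<close> comes from a matrix of determinant \<open>0\<close>. That matrix is
  nilpotent, so its exponential is \<open>1 + X\<close> of trace \<open>2\<close>, and
  \<open>X\<close> is determined.\<close>

lemma exp_lift_tmat:
  assumes "s = 1 \<or> s = - 1" "\<nu> \<noteq> 0"
  shows "exp_lift (psl (tmat s \<nu>)) = cls (\<lambda>t. psl (tmat s (of_real t * \<nu>)))"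
  unfolding exp_lift_def exp_tilde_nil[symmetric]
proof (rule the_equality)
  have proj: "cover_proj (exp_tilde X) = psl (mat_exp X)" if "X \<in> sl2R" for X
    unfolding exp_tilde_def using cover_proj_cls[OF slpath_pathin[OF slpath_exp[OF that]]] by simp
  have one: "mat 1 + nil s \<nu> = tmat s \<nu>" by (simp add: nil_def)
  show "exp_tilde (nil s \<nu>) \<in> exp_tilde ` sl2R \<and> cover_proj (exp_tilde (nil s \<nu>)) = psl (tmat s \<nu>)"
    using proj[OF nil_sl2R] exp_nil[of 1 s \<nu>] nil_sl2R one by simp
  fix y assume "y \<in> exp_tilde ` sl2R \<and> cover_proj y = psl (tmat s \<nu>)"
  then obtain X where X: "X \<in> sl2R" "y = exp_tilde X" and e: "psl (mat_exp X) = psl (tmat s \<nu>)"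
    using proj by auto
  have tr: "trace X = 0" using X by (simp add: sl2R_def)
  obtain C S where *: "\<And>t. mat_exp (t *\<^sub>R X) = C t *\<^sub>R mat 1 + S t *\<^sub>R X"
    "\<And>t. (C t)\<^sup>2 + det X * (S t)\<^sup>2 = (1::real)" "det X < 0 \<Longrightarrow> C 1 > (1::real)" "det X = 0 \<Longrightarrow> S 1 = (1::real)"
    using sl2R_param[OF X(1)] by metis
  have ex: "mat_exp X = C 1 *\<^sub>R mat 1 + S 1 *\<^sub>R X" using *(1)[of 1] by simp
  have "trace (mat_exp X) = 2 * C 1 + S 1 * trace X"
    unfolding ex by (simp add: trace_def sum_2 mat_def algebra_simps)
  then have trex: "trace (mat_exp X) = 2 * C 1" using tr by simp
  have snz: "s \<noteq> 0" using assms by auto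
  have cases: "mat_exp X = tmat s \<nu> \<or> mat_exp X = - tmat s \<nu>" using e by (simp add: psl_eq_iff)
  have "trace (- tmat s \<nu>) = - 2" using trace_tmat[of s \<nu>] by (simp add: trace_def sum_2)
  then have C: "C 1 = 1 \<or> C 1 = - 1" using cases trex trace_tmat[of s \<nu>] by auto
  then have "det X * (S 1)\<^sup>2 = 0" using *(2)[of 1] by auto
  moreover have "S 1 \<noteq> 0"
  proof
    assume "S 1 = 0"
    then have "mat_exp X = mat 1 \<or> mat_exp X = - mat 1" using ex C by auto
    then show False using cases tmat_neq_1[OF snz assms(2)] by auto (metis minus_minus)+
  qed
  ultimately have 0: "det X = 0" by simp
  have "X ** X = 0" using mat2_square[OF tr] 0 by simp
  then have ex1: "mat_exp X = mat 1 + X" by (rule mat_exp_nilpotent)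
  then have "trace (mat_exp X) = 2" using tr by (simp add: trace_def sum_2 mat_def)
  then have "mat_exp X = tmat s \<nu>" using cases \<open>trace (- tmat s \<nu>) = - 2\<close> by auto
  then have "X = nil s \<nu>" using ex1 unfolding nil_def by (metis add_diff_cancel_left')
  then show "y = exp_tilde (nil s \<nu>)" using X by simp
qed

section \<open>Rotations as powers of the central generator\<close>

lemma rot_add: "rot a ** rot b = rot (a + b)"
  by (simp add: rot_def vec_eq_iff forall_2 matrix_matrix_mult_def sum_2 sin_add cos_add)

lemma rot_zero: "rot 0 = mat 1"
  by (simp add: rot_def vec_eq_iff forall_2 mat_def)

lemma slpath_rot: "slpath (\<lambda>t. rot (a * t))"
  unfolding slpath_def
proof (intro conjI ballI)
  show "continuous_on {0..1} (\<lambda>t. rot (a * t))"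
    unfolding rot_def by (intro continuous_on_matrix2 continuous_intros)
  show "rot (a * t) \<in> carrier SL2R" for t
    using sin_cos_squared_add[of "a * t"] by (simp add: rot_def carrier_SL2R det_2 power2_eq_square)
qed (simp add: rot_zero)

abbreviation rot_class :: "int \<Rightarrow> (real \<Rightarrow> (real^2^2) set) set" where
  "rot_class n \<equiv> cls (\<lambda>t. psl (rot (of_int n * pi * t)))"

lemma z_tilde_rot: "z_tilde = rot_class 1"
proof -
  let ?Z = "vector [vector [0, pi], vector [- pi, 0]] :: real^2^2"
  have sq: "(t *\<^sub>R ?Z) ** (t *\<^sub>R ?Z) = (- ((pi * t) * (pi * t))) *\<^sub>R mat 1" for t
    by (simp add: vec_eq_iff forall_2 matrix_matrix_mult_def sum_2 mat_def)
  have "mat_exp (t *\<^sub>R ?Z) = rot (pi * t)" for t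
  proof (cases "t = 0")
    case True
    then show ?thesis using mat_exp_nilpotent[of "t *\<^sub>R ?Z"] sq[of t] by (simp add: rot_zero)
  next
    case False
    have "mat_exp (t *\<^sub>R ?Z) = cos (pi * t) *\<^sub>R mat 1 + (sin (pi * t) / (pi * t)) *\<^sub>R (t *\<^sub>R ?Z)"
      by (rule mat_exp_elliptic[OF sq]) (use False in simp)
    also have "\<dots> = rot (pi * t)"
      using False by (simp add: rot_def vec_eq_iff forall_2 mat_def)
    finally show ?thesis .
  qed
  then show ?thesis unfolding z_tilde_def exp_tilde_def by simp
qed

lemma rot_class_closed: "rot_class n \<in> carrier SL2R_tilde"
  unfolding carrier_tilde using slpath_based[OF slpath_rot] by blast

lemma rot_class_mult: "rot_class m \<otimes>\<^bsub>SL2R_tilde\<^esub> rot_class n = rot_class (m + n)"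
  unfolding slpath_cls_mult[OF slpath_rot slpath_rot] rot_add by (simp add: distrib_right)

lemma rot_class_zero: "rot_class 0 = \<one>\<^bsub>SL2R_tilde\<^esub>"
  by (simp add: one_tilde psl_one rot_zero)

text \<open>Negative powers are defined through inverses; the class of the opposite rotation is an
  explicit two-sided inverse.\<close>

lemma z_tilde_pow: "z_tilde [^]\<^bsub>SL2R_tilde\<^esub> (n::int) = rot_class n"
proof -
  interpret monoid SL2R_tilde by (rule monoid_tilde)
  have nat: "z_tilde [^]\<^bsub>SL2R_tilde\<^esub> (k::nat) = rot_class (int k)" for k
  proof (induction k)
    case 0
    show ?case unfolding nat_pow_0 of_nat_0 rot_class_zero ..
  next
    case (Suc k)
    have "z_tilde [^]\<^bsub>SL2R_tilde\<^esub> Suc k = rot_class (int k) \<otimes>\<^bsub>SL2R_tilde\<^esub> z_tilde"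
      unfolding nat_pow_Suc Suc.IH ..
    also have "\<dots> = rot_class (int k + 1)" unfolding z_tilde_rot by (rule rot_class_mult)
    also have "int k + 1 = int (Suc k)" by simp
    finally show ?case .
  qed
  show ?thesis
  proof (cases "n < 0")
    case True
    have "rot_class (- n) \<otimes>\<^bsub>SL2R_tilde\<^esub> rot_class n = \<one>\<^bsub>SL2R_tilde\<^esub>"
      "rot_class n \<otimes>\<^bsub>SL2R_tilde\<^esub> rot_class (- n) = \<one>\<^bsub>SL2R_tilde\<^esub>"
      unfolding rot_class_mult add.left_inverse add.right_inverse by (rule rot_class_zero)+
    then have "rot_class n = inv\<^bsub>SL2R_tilde\<^esub> (rot_class (- n))"
      by (rule inv_unique'[OF rot_class_closed rot_class_closed])
    also have "- n = int (nat (- n))" using True by simp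
    also have "rot_class \<dots> = z_tilde [^]\<^bsub>SL2R_tilde\<^esub> nat (- n)" by (rule nat[symmetric])
    also have "inv\<^bsub>SL2R_tilde\<^esub> \<dots> = z_tilde [^]\<^bsub>SL2R_tilde\<^esub> n"
      unfolding int_pow_def2 using True by (simp only: if_True)
    finally show ?thesis by (rule HOL.sym)
  next
    case False
    then have "z_tilde [^]\<^bsub>SL2R_tilde\<^esub> n = z_tilde [^]\<^bsub>SL2R_tilde\<^esub> nat n"
      unfolding int_pow_def2 by (simp only: if_False)
    also have "\<dots> = rot_class (int (nat n))" by (rule nat)
    also have "int (nat n) = n" using False by simp
    finally show ?thesis .
  qed
qed

definition mat_of :: "complex \<Rightarrow> complex \<Rightarrow> real^2^2" where
  "mat_of p u = vector [vector [Im u, Im p], vector [Re u, Re p]]"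

lemma mat_of_act: "mat_of (act A 1) (act A \<i>) = A"
  by (simp add: mat_of_def act_def vec_eq_iff forall_2)

lemma det_mat_of: "det (mat_of p u) = wedge p u"
  by (simp add: mat_of_def det_2 wedge_def mult.commute)

text \<open>Logarithms of the image of \<open>1\<close>, together with the shear, are global coordinates of the covering group.\<close>

lemma cls_eq_rot_class:
  assumes A: "slpath A" and q: "continuous_on {0..1} q" "\<And>t. t \<in> {0..1} \<Longrightarrow> act (A t) 1 = exp (q t)"
    "q 0 = 0" "q 1 = \<i> * of_real (of_int n * pi)" and A1: "\<And>x. act (A 1) x = of_real (sgn_int n) * x"
  shows "cls (\<lambda>t. psl (A t)) = rot_class n"
proof (rule path_class_eqI)
  define \<tau> where "\<tau> t = Re (act (A t) \<i> * cnj (act (A t) 1)) / (cmod (act (A t) 1))\<^sup>2" for t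
  \<comment> \<open>The matrix taking \<open>1\<close> to \<open>exp Q\<close> and
    \<open>\<i>\<close> to the dual vector sheared by \<open>T\<close>. Its determinant is
    \<open>1\<close> for all values of the coordinates.\<close>
  define m where "m Q T = mat_of (exp Q) (dual (exp Q) + of_real T * exp Q)" for Q T
  have det: "m Q T \<in> carrier SL2R" for Q T
    by (simp add: m_def carrier_SL2R det_mat_of wedge_add_right wedge_scale_right wedge_dual)
  have mA: "m (q t) (\<tau> t) = A t" if t: "t \<in> {0..1}" for t
  proof -
    have "A t \<in> carrier SL2R" using A t unfolding slpath_def by blast
    then have "det (A t) = 1" unfolding carrier_SL2R by blast
    then have "wedge (act (A t) 1) (act (A t) \<i>) = 1"
      unfolding det_mat_of[symmetric] mat_of_act .
    moreover have "act (A t) 1 \<noteq> 0" unfolding q(2)[OF t] by simp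
    ultimately have "act (A t) \<i> = dual (act (A t) 1) + of_real (\<tau> t) * act (A t) 1"
      using dual_decomposition[of "act (A t) 1" "act (A t) \<i>"] unfolding \<tau>_def by (simp only: of_real_1 mult_1 simp_thms True_implies_equals)
    then have "m (q t) (\<tau> t) = mat_of (act (A t) 1) (act (A t) \<i>)"
      unfolding m_def q(2)[OF t, symmetric] by (simp only:)
    then show ?thesis unfolding mat_of_act .
  qed
  have contA: "continuous_on {0..1} (\<lambda>t. act (A t) x)" for x
    using A unfolding slpath_def act_def Complex_eq by (intro continuous_intros) auto
  have nz: "act (A t) 1 \<noteq> 0" if "t \<in> {0..1}" for t using q(2)[OF that] by simp
  have c\<tau>: "continuous_on {0..1} \<tau>"
    unfolding \<tau>_def by (intro continuous_intros contA) (use nz in auto)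
  have \<tau>0: "\<tau> 0 = 0" using A by (simp add: \<tau>_def slpath_def)
  have \<tau>1: "\<tau> 1 = 0" by (simp add: \<tau>_def A1)
  \<comment> \<open>The straight homotopy in the coordinates, from the given path to the rotation.
    Both paths have the same coordinates at \<open>0\<close> and at \<open>1\<close>, so the ends
    stay fixed.\<close>
  define h where "h z = m (of_real (1 - fst z) * q (snd z) + of_real (fst z) * (\<i> * of_real (of_int n * pi * snd z))) ((1 - fst z) * \<tau> (snd z))"
    for z :: "real \<times> real"
  have ch: "continuous_on ({0..1} \<times> {0..1}) h"
  proof -
    have "continuous_on ({0..1} \<times> {0..1}) (\<lambda>z::real \<times> real. q (snd z))" "continuous_on ({0..1} \<times> {0..1}) (\<lambda>z::real \<times> real. \<tau> (snd z))"
      by (rule continuous_on_compose2[OF q(1)] continuous_on_compose2[OF c\<tau>]; force intro!: continuous_intros)+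
    then show ?thesis
      unfolding h_def m_def mat_of_def dual_def by (intro continuous_on_matrix2 continuous_intros) auto
  qed
  have h0: "h (0, t) = A t" if "t \<in> {0..1}" for t using mA[OF that] by (simp add: h_def)
  have h1: "h (1, t) = rot (of_int n * pi * t)" for t
  proof -
    have "exp (\<i> * of_real (of_int n * pi * t)) = cis (of_int n * pi * t)" by (simp add: cis_conv_exp)
    moreover have "dual (cis a) = \<i> * cis a" for a by (simp add: dual_def cis_cnj divide_inverse)
    ultimately show ?thesis by (simp add: h_def m_def mat_of_def rot_def)
  qed
  have hs0: "h (r, 0) = A 0" and hs1: "h (r, 1) = A 1" for r
  proof -
    have "h (r, 0) = m (q 0) (\<tau> 0)" by (simp add: h_def \<tau>0 q(3))
    then show "h (r, 0) = A 0" using mA[of 0] by simp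
    have "of_real (1 - r) * q 1 + of_real r * (\<i> * of_real (of_int n * pi * 1)) = q 1"
      unfolding q(4) by (simp add: algebra_simps)
    then have "h (r, 1) = m (q 1) (\<tau> 1)" by (simp add: h_def \<tau>1)
    then show "h (r, 1) = A 1" using mA[of 1] by simp
  qed
  show "homotopic_with (\<lambda>r. r 0 = psl (A 0) \<and> r 1 = psl (A 1)) (top_of_set {0..1}) PSLT
      (\<lambda>t. psl (A t)) (\<lambda>t. psl (rot (of_int n * pi * t)))"
  proof (subst homotopic_with)
    show "\<exists>h. continuous_map (prod_topology (top_of_set {0..1::real}) (top_of_set {0..1})) PSLT h \<and>
       (\<forall>x\<in>topspace (top_of_set {0..1}). h (0, x) = psl (A x)) \<and>
       (\<forall>x\<in>topspace (top_of_set {0..1}). h (1, x) = psl (rot (of_int n * pi * x))) \<and>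
       (\<forall>t\<in>{0..1}. h (t, 0) = psl (A 0) \<and> h (t, 1) = psl (A 1))"
    proof (intro exI[of _ "\<lambda>z. psl (h z)"] conjI)
      show "continuous_map (prod_topology (top_of_set {0..1}) (top_of_set {0..1})) PSLT (\<lambda>z. psl (h z))"
        unfolding prod_topology_subtopology_eu
        by (rule continuous_map_psl_comp[OF ch]) (simp add: h_def det)
    qed (simp_all add: h0 h1 hs0 hs1)
  qed auto
qed

section \<open>Winding numbers distinguish the rotation classes\<close>

lemma exp_trivial_const:
  assumes "continuous_on {0..1::real} g" "\<And>t. t \<in> {0..1} \<Longrightarrow> exp (g t) = 1"
  shows "g 1 = (g 0 :: complex)"
proof -
  have "g constant_on {0..1}"
  proof (rule continuous_discrete_range_constant[OF _ assms(1)])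
    fix x :: real assume x: "x \<in> {0..1}"
    have "2 * pi \<le> norm (g y - g x)" if y: "y \<in> {0..1}" "g y \<noteq> g x" for y
    proof -
      obtain a b :: int where ab: "Re (g x) = 0" "Im (g x) = of_int (2 * a) * pi" "Re (g y) = 0" "Im (g y) = of_int (2 * b) * pi"
        using assms(2)[OF x] assms(2)[OF y(1)] unfolding exp_eq_1 by blast
      then have d: "g y - g x = of_real (2 * pi * of_int (b - a)) * \<i>"
        by (simp add: complex_eq_iff algebra_simps)
      have "b - a \<noteq> 0" using y(2) d by auto
      then have "1 \<le> \<bar>real_of_int (b - a)\<bar>" by linarith
      then have "2 * pi * 1 \<le> 2 * pi * \<bar>real_of_int (b - a)\<bar>" by (intro mult_left_mono) auto
      also have "\<dots> = norm (g y - g x)" unfolding d by (simp only: norm_mult norm_of_real norm_ii abs_mult) simp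
      finally show ?thesis by simp
    qed
    then show "\<exists>e>0. \<forall>y. y \<in> {0..1} \<and> g y \<noteq> g x \<longrightarrow> e \<le> norm (g y - g x)"
      by (intro exI[of _ "2 * pi"]) auto
  qed simp
  then show ?thesis unfolding constant_on_def by (metis atLeastAtMost_iff order_refl zero_le_one)
qed

text \<open>The square makes the value independent of the representative; it detects the winding number of a
  path of cosets.\<close>

definition col_sq :: "(real^2^2) set \<Rightarrow> complex" where
  "col_sq x = (act (SOME A. A \<in> x) 1)\<^sup>2"

lemma col_sq_psl: "col_sq (psl A) = (act A 1)\<^sup>2"
proof -
  have "(SOME B. B \<in> psl A) \<in> psl A" by (rule someI[of _ A]) (simp add: psl_eq)
  then have "(SOME B. B \<in> psl A) = A \<or> (SOME B. B \<in> psl A) = - A" by (simp add: psl_eq)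
  then show ?thesis unfolding col_sq_def by (auto simp: act_uminus)
qed

lemma act_nonzero:
  assumes "A \<in> carrier SL2R" "x \<noteq> 0"
  shows "act A x \<noteq> 0"
proof -
  obtain B where "B ** A = mat 1" using SL2R_inverse[OF assms(1)] by metis
  then have "act B (act A x) = x" by (simp flip: act_mult)
  then show ?thesis using assms(2) by (auto simp: act_def complex_eq_iff)
qed

lemma continuous_map_col_sq: "continuous_map PSLT (top_of_set (- {0})) col_sq"
proof (rule continuous_compose_quotient_map[OF quotient_map_psl])
  have "continuous_on (carrier SL2R) (\<lambda>A. (act A 1)\<^sup>2)"
    unfolding act_def Complex_eq by (intro continuous_intros)
  moreover have "(act A 1)\<^sup>2 \<in> - {0}" if "A \<in> carrier SL2R" for A
    using act_nonzero[OF that, of 1] by simp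
  ultimately show "continuous_map (top_of_set (carrier SL2R)) (top_of_set (- {0})) (col_sq \<circ> psl)"
    by (auto simp: continuous_map_in_subtopology o_def col_sq_psl image_subset_iff)
qed

text \<open>Under \<open>col_sq\<close> a homotopy of coset paths becomes a homotopy of loops in the
  punctured plane. It has a logarithm on the contractible square. The increment along a loop is
  \<open>2 * pi * \<i>\<close> times an integer, \<open>m\<close> at one end of the homotopy and
  \<open>n\<close> at the other; on the two remaining sides the logarithm is constant.\<close>

lemma rot_class_inject:
  assumes "rot_class m = rot_class n"
  shows "m = n"
proof -
  let ?f = "\<lambda>k t. psl (rot (of_int k * pi * t))"
  have col: "col_sq (?f k t) = exp (2 * (\<i> * of_real (of_int k * pi * t)))" for k t
  proof -
    have "act (rot a) 1 = exp (\<i> * of_real a)" for a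
      by (simp add: act_def rot_def complex_eq_iff cis_conv_exp[symmetric])
    then show ?thesis by (simp only: col_sq_psl exp_double)
  qed
  have "?f n \<in> cls (?f m)"
    unfolding assms by (rule path_class_self[OF slpath_pathin[OF slpath_rot]])
  then have hom: "homotopic_with (\<lambda>r. r 0 = ?f m 0 \<and> r 1 = ?f m 1) (top_of_set {0..1}) PSLT (?f m) (?f n)"
    by (simp only: path_class_def mem_Collect_eq)
  define P where "P = (\<lambda>r :: real \<Rightarrow> complex. r 0 = 1 \<and> r 1 = 1)"
  have "exp (2 * (\<i> * of_real (of_int m * pi * 1))) = exp (2 * of_int m * of_real pi * \<i>)" by (simp add: mult_ac)
  also have "\<dots> = 1" by (simp add: exp_eq_1)
  finally have e1: "col_sq (?f m 1) = 1" unfolding col .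
  have e0: "col_sq (?f m 0) = 1" unfolding col by simp
  have "homotopic_with P (top_of_set {0..1}) (top_of_set (- {0})) (col_sq \<circ> ?f m) (col_sq \<circ> ?f n)"
    by (rule homotopic_with_compose_continuous_map_left[OF hom continuous_map_col_sq]) (use e0 e1 in \<open>auto simp: P_def\<close>)
  then obtain K where K: "continuous_map (prod_topology (top_of_set {0..1::real}) (top_of_set {0..1::real})) (top_of_set (- {0})) K"
    "\<forall>t. K (0, t) = col_sq (?f m t)" "\<forall>t. K (1, t) = col_sq (?f n t)" "\<forall>s\<in>{0..1}. K (s, 0) = 1 \<and> K (s, 1) = 1"
    unfolding homotopic_with_def P_def o_def by (elim exE conjE, intro that)
  have cK: "continuous_on ({0..1} \<times> {0..1}) K" "K ` ({0..1} \<times> {0..1}) \<subseteq> - {0}"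
    using K(1) unfolding prod_topology_subtopology_eu by (auto simp: continuous_map_in_subtopology)
  obtain g where g: "continuous_on ({0..1} \<times> {0..1}) g" "\<And>z. z \<in> {0..1} \<times> {0..1} \<Longrightarrow> K z = exp (g z)"
  proof (rule continuous_logarithm_on_contractible[OF cK(1)])
    show "contractible ({0..1::real} \<times> {0..1::real})"
      by (intro convex_imp_contractible convex_Times) auto
  qed (use cK(2) in auto)
  have sub: "continuous_on {0..1} (\<lambda>t. g (p t, r t))" if "continuous_on {0..1} p" "continuous_on {0..1} r"
    "\<And>t. t \<in> {0..1} \<Longrightarrow> p t \<in> {0..1} \<and> r t \<in> {0..1}" for p r :: "real \<Rightarrow> real"
  proof (rule continuous_on_compose2[OF g(1)])
    show "continuous_on {0..1} (\<lambda>t. (p t, r t))" by (intro continuous_on_Pair that(1,2))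
    show "(\<lambda>t. (p t, r t)) ` {0..1} \<subseteq> {0..1} \<times> {0..1}" using that(3) by blast
  qed
  have horizontal: "g (1, a) = g (0, a)" if a: "a = 0 \<or> a = 1" for a
  proof (rule exp_trivial_const[of "\<lambda>s. g (s, a)"])
    show "continuous_on {0..1} (\<lambda>s. g (s, a))" by (rule sub) (use a in auto)
    show "exp (g (s, a)) = 1" if "s \<in> {0..1}" for s
      using g(2)[of "(s, a)"] K(4) that a by auto
  qed
  have vertical: "g (s, 1) - g (s, 0) = 2 * (\<i> * of_real (of_int k * pi))"
    if s: "s \<in> {0..1}" and k: "\<And>t. K (s, t) = col_sq (?f k t)" for s k
  proof -
    define d where "d t = g (s, t) - 2 * (\<i> * of_real (of_int k * pi * t))" for t
    have "d 1 = d 0"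
    proof (rule exp_trivial_const)
      show "continuous_on {0..1} d"
        unfolding d_def by (intro continuous_intros sub) (use s in auto)
      show "exp (d t) = 1" if "t \<in> {0..1}" for t
      proof -
        have "exp (g (s, t)) = exp (2 * (\<i> * of_real (of_int k * pi * t)))"
          using g(2)[of "(s, t)", symmetric] that s unfolding k[of t] col by blast
        then show ?thesis unfolding d_def exp_diff by simp
      qed
    qed
    then have "g (s, 1) - g (s, 0) = 2 * (\<i> * of_real (of_int k * pi * 1)) - 2 * (\<i> * of_real (of_int k * pi * 0))"
      unfolding d_def by (simp only: diff_eq_eq diff_add_eq) (simp add: algebra_simps)
    then show ?thesis by simp
  qed
  have "2 * (\<i> * of_real (of_int m * pi)) = 2 * (\<i> * of_real (of_int n * pi))"
  proof -
    have "g (0, 1) - g (0, 0) = 2 * (\<i> * of_real (of_int m * pi))"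
      by (rule vertical[OF _ spec[OF K(2)]]) simp
    moreover have "g (1, 1) - g (1, 0) = 2 * (\<i> * of_real (of_int n * pi))"
      by (rule vertical[OF _ spec[OF K(3)]]) simp
    moreover have "g (1, 1) - g (1, 0) = g (0, 1) - g (0, 0)"
      using horizontal[of 0] horizontal[of 1] by (simp only: simp_thms)
    ultimately show ?thesis by (simp only:)
  qed
  then have "of_real (of_int m * pi) = (of_real (of_int n * pi) :: complex)" by simp
  then have "real_of_int m * pi = real_of_int n * pi" by (simp only: of_real_eq_iff)
  then show ?thesis by simp
qed

text \<open>The rightmost matrix belongs to generator \<open>p\<close> and acts first, as step
  \<open>0\<close> of the orbit; hence the first \<open>k\<close> steps use the last
  \<open>k\<close> generators.\<close>

lemma act_foldr_tmat:
  "k \<le> p \<Longrightarrow> act (foldr (**) (map (\<lambda>i. tmat (s (p - i)) (\<nu> (p - i))) [p - k + 1..<p + 1]) (mat 1)) x = orb s \<nu> k x"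
proof (induction k)
  case (Suc k)
  have "[p - Suc k + 1..<p + 1] = (p - k) # [p - k + 1..<p + 1]"
  proof -
    have "p - Suc k + 1 = p - k" using Suc.prems by simp
    then show ?thesis using Suc.prems upt_conv_Cons[of "p - k" "p + 1"] by (simp del: upt_Suc)
  qed
  moreover have "p - (p - k) = k" using Suc.prems by simp
  ultimately show ?case using Suc.IH Suc.prems by (simp only: list.map foldr.simps o_apply act_mult) (simp add: act_tmat)
qed simp

lemma slpath_tmat: "slpath (\<lambda>t. tmat s (of_real t * \<nu>))"
  unfolding slpath_def
proof (intro conjI ballI)
  show "continuous_on {0..1} (\<lambda>t. tmat s (of_real t * \<nu>))"
    by (intro continuous_on_tmat continuous_intros)
  show "tmat s (of_real 0 * \<nu>) = mat 1" by (simp add: tmat_def vec_eq_iff forall_2 mat_def)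
qed (rule tmat_SL2R)

text \<open>Scaling every \<open>\<nu>\<close> by \<open>t\<close> multiplies the canonical lifts
  pointwise. Along this path the logarithm of the modulus plus \<open>\<i>\<close> times the turning
  is a continuous logarithm of the image of \<open>1\<close>; it starts at \<open>0\<close> and ends
  at \<open>\<i> * n * pi\<close>.\<close>

lemma tmat_product_class:
  assumes s: "\<And>k. s k * s k = 1" and scalar: "\<And>x. orb s \<nu> p x = of_real (sgn_int n) * x"
    and turn: "turning p s \<nu> 1 = of_int n * pi"
  shows "foldr (\<otimes>\<^bsub>SL2R_tilde\<^esub>) (map (\<lambda>i. cls (\<lambda>t. psl (tmat (s (p - i)) (of_real t * \<nu> (p - i))))) [1..<p + 1])
    \<one>\<^bsub>SL2R_tilde\<^esub> = rot_class n"
proof -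
  define M where "M t = foldr (**) (map (\<lambda>i. tmat (s (p - i)) (of_real t * \<nu> (p - i))) [1..<p + 1]) (mat 1)" for t
  have sl: "slpath M" and fold: "foldr (\<otimes>\<^bsub>SL2R_tilde\<^esub>) (map (\<lambda>i. cls (\<lambda>t. psl (tmat (s (p - i)) (of_real t * \<nu> (p - i))))) [1..<p + 1])
    \<one>\<^bsub>SL2R_tilde\<^esub> = cls (\<lambda>t. psl (M t))"
    using slpath_cls_foldr[of "[1..<p + 1]" "\<lambda>i t. tmat (s (p - i)) (of_real t * \<nu> (p - i))"] slpath_tmat
    unfolding M_def by (simp_all del: upt_Suc)
  define \<mu> where "\<mu> t k = of_real t * \<nu> k" for t k
  have actM: "act (M t) x = orb s (\<mu> t) p x" for t x
    using act_foldr_tmat[of p p s "\<mu> t" x] unfolding M_def \<mu>_def by simp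
  define q where "q t = Complex (ln (cmod (orb s (\<mu> t) p 1))) (turning p s (\<mu> t) 1)" for t
  have lim: "((\<lambda>u. \<mu> u k) \<longlongrightarrow> \<mu> t k) (at t within T)" for t k T
    unfolding \<mu>_def by (intro tendsto_intros)
  have "cls (\<lambda>t. psl (M t)) = rot_class n"
  proof (rule cls_eq_rot_class[OF sl])
    show "continuous_on {0..1} q"
      unfolding continuous_on_def
    proof
      fix t :: real
      have 1: "((\<lambda>u. orb s (\<mu> u) p 1) \<longlongrightarrow> orb s (\<mu> t) p 1) (at t within {0..1})"
        by (rule tendsto_orb[OF lim tendsto_const])
      have 2: "((\<lambda>u. turning p s (\<mu> u) 1) \<longlongrightarrow> turning p s (\<mu> t) 1) (at t within {0..1})"
        by (rule tendsto_turning[OF lim tendsto_const _ s]) simp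
      show "(q \<longlongrightarrow> q t) (at t within {0..1})"
        unfolding q_def by (intro tendsto_Complex tendsto_ln tendsto_norm 1 2) simp
    qed
    show "act (M t) 1 = exp (q t)" for t
    proof -
      have "exp (q t) = of_real (cmod (orb s (\<mu> t) p 1)) * cis (turning p s (\<mu> t) 1)"
        by (simp add: q_def exp_eq_polar)
      also have "\<dots> = orb s (\<mu> t) p 1"
        using orb_turning[of 1 s "\<mu> t" p] by simp
      finally show ?thesis by (simp add: actM)
    qed
    have o0: "orb s (\<mu> 0) k 1 = 1" for k
      by (induction k) (simp_all add: \<mu>_def transv_def)
    have "q 0 = Complex (ln (cmod 1)) 0" unfolding q_def turning_def o0 by simp
    then show "q 0 = 0" by (simp add: complex_eq_iff)
    have \<mu>1: "\<mu> 1 = \<nu>" by (simp add: \<mu>_def fun_eq_iff)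
    have "cmod (orb s \<nu> p 1) = 1" unfolding scalar by (simp add: sgn_int_def)
    then show "q 1 = \<i> * of_real (of_int n * pi)"
      using turn by (simp add: q_def \<mu>1 complex_eq_iff)
    show "act (M 1) x = of_real (sgn_int n) * x" for x
      using scalar by (simp add: actM \<mu>1)
  qed
  with fold show ?thesis by simp
qed

lemma rel_euler_class_eq:
  assumes s: "\<And>k. s k * s k = 1" and nz: "\<And>k. k < p \<Longrightarrow> \<nu> k \<noteq> 0"
    and scalar: "\<And>x. orb s \<nu> p x = of_real (sgn_int n) * x" and turn: "turning p s \<nu> 1 = of_int n * pi"
    and \<phi>: "\<And>i. i \<in> {1..p} \<Longrightarrow> \<phi> (peripheral p i) = psl (tmat (s (p - i)) (\<nu> (p - i)))"
  shows "rel_euler_class p \<phi> = n"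
proof -
  have "map (\<lambda>i. exp_lift (\<phi> (peripheral p i))) [1..<p + 1] =
      map (\<lambda>i. cls (\<lambda>t. psl (tmat (s (p - i)) (of_real t * \<nu> (p - i))))) [1..<p + 1]"
  proof (intro map_cong HOL.refl)
    fix i assume "i \<in> set [1..<p + 1]"
    then have i: "i \<in> {1..p}" "p - i < p" by auto
    show "exp_lift (\<phi> (peripheral p i)) = cls (\<lambda>t. psl (tmat (s (p - i)) (of_real t * \<nu> (p - i))))"
      unfolding \<phi>[OF i(1)] by (rule exp_lift_tmat[OF sign_cases[OF s] nz[OF i(2)]])
  qed
  then have "foldr (\<otimes>\<^bsub>SL2R_tilde\<^esub>) (map (\<lambda>i. exp_lift (\<phi> (peripheral p i))) [1..<p + 1]) \<one>\<^bsub>SL2R_tilde\<^esub> = rot_class n"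
    using tmat_product_class[OF s scalar turn] by (simp only:)
  then show ?thesis
    unfolding rel_euler_class_def z_tilde_pow
    by (intro the_equality) (auto dest: rot_class_inject)
qed

section \<open>Homomorphisms from presented groups\<close>

lemma word_eq_lists: "word_eq I R u v \<Longrightarrow> u \<in> lists (I \<times> UNIV) \<and> v \<in> lists (I \<times> UNIV)"
  by (induction rule: word_eq.induct) auto

lemma word_eq_append:
  assumes "word_eq I R u v" "a \<in> lists (I \<times> UNIV)" "b \<in> lists (I \<times> UNIV)"
  shows "word_eq I R (a @ u @ b) (a @ v @ b)"
  using assms(1)
proof (induction rule: word_eq.induct)
  case (refl w)
  then show ?case using assms by (intro word_eq.refl) auto
next
  case (sym v w)
  show ?case by (rule word_eq.sym[OF sym.IH])
next
  case (trans u v w)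
  show ?case by (rule word_eq.trans[OF trans.IH])
next
  case (cancel u v x c)
  then show ?case using word_eq.cancel[of "a @ u" I "v @ b" x R c] assms by simp
next
  case (relator u v r)
  then show ?case using word_eq.relator[of "a @ u" I "v @ b" r R] assms by simp
qed

lemma word_class_eqI: "word_eq I R u v \<Longrightarrow> word_class I R u = word_class I R v"
  unfolding word_class_def by (blast intro: word_eq.trans word_eq.sym)

lemma word_class_self: "u \<in> lists (I \<times> UNIV) \<Longrightarrow> u \<in> word_class I R u"
  by (simp add: word_class_def word_eq.refl)

lemma presented_mult:
  assumes "u \<in> lists (I \<times> UNIV)" "v \<in> lists (I \<times> UNIV)"
  shows "word_class I R u \<otimes>\<^bsub>presented_group I R\<^esub> word_class I R v = word_class I R (u @ v)"
proof -
  have *: "word_class I R (u' @ v') = word_class I R (u @ v)"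
    if "u' \<in> word_class I R u" "v' \<in> word_class I R v" for u' v'
  proof (rule HOL.sym[OF word_class_eqI])
    have uv: "word_eq I R u u'" "word_eq I R v v'" using that by (simp_all add: word_class_def)
    have "word_eq I R ([] @ u @ v) ([] @ u' @ v)" by (rule word_eq_append[OF uv(1)]) (use assms in auto)
    moreover have "word_eq I R (u' @ v @ []) (u' @ v' @ [])"
      by (rule word_eq_append[OF uv(2)]) (use word_eq_lists[OF uv(1)] in auto)
    ultimately show "word_eq I R (u @ v) (u' @ v')"
      by (simp only: append_Nil append_Nil2) (rule word_eq.trans)
  qed
  define K where "K = word_class I R (u @ v)"
  have "(\<Union>v'\<in>word_class I R v. word_class I R (u' @ v')) = K" if "u' \<in> word_class I R u" for u'
    by (rule SUP_eq_const) (use word_class_self[OF assms(2), of R] *[OF that] in \<open>auto simp: K_def\<close>)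
  moreover have "word_class I R u \<noteq> {}" using word_class_self[OF assms(1), of R] by blast
  ultimately have "(\<Union>u'\<in>word_class I R u. \<Union>v'\<in>word_class I R v. word_class I R (u' @ v')) = K"
    by (rule SUP_eq_const[rotated])
  then show ?thesis by (simp add: presented_group_def K_def)
qed

primrec word_value :: "('b, 'c) monoid_scheme \<Rightarrow> ('a \<Rightarrow> 'b) \<Rightarrow> ('a \<times> bool) list \<Rightarrow> 'b" where
  "word_value G f [] = \<one>\<^bsub>G\<^esub>"
| "word_value G f (x # w) = (if snd x then f (fst x) else inv\<^bsub>G\<^esub> (f (fst x))) \<otimes>\<^bsub>G\<^esub> word_value G f w"

lemma (in group) word_value_closed:
  assumes "f \<in> I \<rightarrow> carrier G"
  shows "w \<in> lists (I \<times> UNIV) \<Longrightarrow> word_value G f w \<in> carrier G"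
proof (induction w)
  case (Cons x w)
  then have "f (fst x) \<in> carrier G" using assms by auto
  then show ?case using Cons by simp
qed simp

lemma (in group) word_value_append:
  assumes f: "f \<in> I \<rightarrow> carrier G"
  shows "u \<in> lists (I \<times> UNIV) \<Longrightarrow> v \<in> lists (I \<times> UNIV) \<Longrightarrow>
    word_value G f (u @ v) = word_value G f u \<otimes> word_value G f v"
proof (induction u)
  case Nil
  then show ?case using word_value_closed[OF f, of v] by simp
next
  case (Cons x u)
  then have "f (fst x) \<in> carrier G" "u \<in> lists (I \<times> UNIV)" using f by auto
  then show ?case using Cons word_value_closed[OF f, of u] word_value_closed[OF f, of v] by (simp add: m_assoc)
qed

lemma (in group) word_value_insert:
  assumes f: "f \<in> I \<rightarrow> carrier G" and u: "u \<in> lists (I \<times> UNIV)" and v: "v \<in> lists (I \<times> UNIV)"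
    and r: "r \<in> lists (I \<times> UNIV)" "word_value G f r = \<one>"
  shows "word_value G f (u @ r @ v) = word_value G f (u @ v)"
proof -
  have rv: "r @ v \<in> lists (I \<times> UNIV)" using r v by simp
  have "word_value G f (u @ r @ v) = word_value G f u \<otimes> (word_value G f r \<otimes> word_value G f v)"
    using word_value_append[OF f u rv] word_value_append[OF f r(1) v] by simp
  then show ?thesis
    using word_value_append[OF f u v] r(2) word_value_closed[OF f v] by simp
qed

lemma (in group) word_value_eq:
  assumes f: "f \<in> I \<rightarrow> carrier G" and R: "\<forall>r\<in>R \<inter> lists (I \<times> UNIV). word_value G f r = \<one>"
    and "word_eq I R u v"
  shows "word_value G f u = word_value G f v"
  using assms(3)
proof (induction rule: word_eq.induct)
  case (cancel u v x c)
  have "[(x, c), (x, \<not> c)] \<in> lists (I \<times> UNIV)" "f x \<in> carrier G" using cancel f by auto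
  moreover from this have "word_value G f [(x, c), (x, \<not> c)] = \<one>" by (cases c) simp_all
  ultimately show ?case using word_value_insert[OF f cancel(1,2)] by blast
next
  case (relator u v r)
  then show ?case using word_value_insert[OF f, of u v r] R by blast
qed simp_all

text \<open>A representing word is chosen for each element; \<open>word_value_eq\<close> makes the
  value independent of the choice when the relators have value \<open>1\<close>.\<close>

definition presented_hom :: "('b, 'c) monoid_scheme \<Rightarrow> 'a set \<Rightarrow> ('a \<times> bool) list set \<Rightarrow> ('a \<Rightarrow> 'b) \<Rightarrow> ('a \<times> bool) list set \<Rightarrow> 'b" where
  "presented_hom G I R f = (\<lambda>P\<in>carrier (presented_group I R). word_value G f (SOME w. w \<in> lists (I \<times> UNIV) \<and> P = word_class I R w))"

lemma word_class_closed: "w \<in> lists (I \<times> UNIV) \<Longrightarrow> word_class I R w \<in> carrier (presented_group I R)"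
  by (simp add: presented_group_def)

lemma (in group) presented_hom_class:
  assumes f: "f \<in> I \<rightarrow> carrier G" and R: "\<forall>r\<in>R \<inter> lists (I \<times> UNIV). word_value G f r = \<one>"
    and w: "w \<in> lists (I \<times> UNIV)"
  shows "presented_hom G I R f (word_class I R w) = word_value G f w"
proof -
  define w' where "w' = (SOME v. v \<in> lists (I \<times> UNIV) \<and> word_class I R w = word_class I R v)"
  have w': "w' \<in> lists (I \<times> UNIV) \<and> word_class I R w = word_class I R w'"
    unfolding w'_def by (rule someI[of _ w]) (use w in simp)
  then have "w' \<in> word_class I R w" using word_class_self[of w' I R] by metis
  then have "word_eq I R w w'" unfolding word_class_def by simp
  then have "word_value G f w = word_value G f w'" by (rule word_value_eq[OF f R])
  then show ?thesis using word_class_closed[OF w, of R] by (simp add: presented_hom_def w'_def)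
qed

lemma (in group) presented_hom_hom:
  assumes f: "f \<in> I \<rightarrow> carrier G" and R: "\<forall>r\<in>R \<inter> lists (I \<times> UNIV). word_value G f r = \<one>"
  shows "presented_hom G I R f \<in> hom (presented_group I R) G \<inter> extensional (carrier (presented_group I R))"
proof
  have val: "presented_hom G I R f (word_class I R w) = word_value G f w" if "w \<in> lists (I \<times> UNIV)" for w
    using f R that by (rule presented_hom_class)
  show "presented_hom G I R f \<in> hom (presented_group I R) G"
  proof (rule homI)
    fix P assume "P \<in> carrier (presented_group I R)"
    then obtain u where u: "u \<in> lists (I \<times> UNIV)" "P = word_class I R u" by (auto simp: presented_group_def)
    show "presented_hom G I R f P \<in> carrier G"
      unfolding u(2) val[OF u(1)] using f u(1) by (rule word_value_closed)
    fix Q assume "Q \<in> carrier (presented_group I R)"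
    then obtain v where v: "v \<in> lists (I \<times> UNIV)" "Q = word_class I R v" by (auto simp: presented_group_def)
    have uv: "u @ v \<in> lists (I \<times> UNIV)" using u v by simp
    show "presented_hom G I R f (P \<otimes>\<^bsub>presented_group I R\<^esub> Q) = presented_hom G I R f P \<otimes> presented_hom G I R f Q"
      unfolding u(2) v(2) presented_mult[OF u(1) v(1)] val[OF uv] val[OF u(1)] val[OF v(1)]
      using f u(1) v(1) by (rule word_value_append)
  qed
qed (simp add: presented_hom_def)

lemma (in group) hom_word_value:
  assumes \<phi>: "\<phi> \<in> hom (presented_group I R) G" and w: "w \<in> lists (I \<times> UNIV)"
  shows "\<phi> (word_class I R w) = word_value G (\<lambda>a. \<phi> (word_class I R [(a, True)])) w"
proof -
  have mult: "\<phi> (word_class I R (u @ v)) = \<phi> (word_class I R u) \<otimes> \<phi> (word_class I R v)"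
    if "u \<in> lists (I \<times> UNIV)" "v \<in> lists (I \<times> UNIV)" for u v
    using hom_mult[OF \<phi> word_class_closed[OF that(1)] word_class_closed[OF that(2)]]
    unfolding presented_mult[OF that] .
  have cl: "\<phi> (word_class I R u) \<in> carrier G" if "u \<in> lists (I \<times> UNIV)" for u
    by (rule hom_in_carrier[OF \<phi> word_class_closed[OF that]])
  have one: "\<phi> (word_class I R []) = \<one>"
    using mult[of "[]" "[]"] cl[of "[]"] by simp
  have inv: "\<phi> (word_class I R [(a, False)]) = inv (\<phi> (word_class I R [(a, True)]))" if a: "a \<in> I" for a
  proof -
    have l: "[(a, c)] \<in> lists (I \<times> UNIV)" for c using a by simp
    have "word_class I R ([(a, False)] @ [(a, True)]) = word_class I R []"
      using word_eq.cancel[of "[]" I "[]" a R False] a by (intro word_class_eqI) simp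
    then have "\<phi> (word_class I R [(a, False)]) \<otimes> \<phi> (word_class I R [(a, True)]) = \<one>"
      using mult[OF l[of False] l[of True]] one by simp
    then show ?thesis using cl[OF l] by (metis inv_equality)
  qed
  show ?thesis
    using w
  proof (induction w)
    case Nil
    then show ?case using one by simp
  next
    case (Cons x w)
    obtain a c where x: "x = (a, c)" by (cases x)
    have a: "a \<in> I" "w \<in> lists (I \<times> UNIV)" using Cons x by auto
    have "\<phi> (word_class I R ([(a, c)] @ w)) = \<phi> (word_class I R [(a, c)]) \<otimes> \<phi> (word_class I R w)"
      by (rule mult) (use a in auto)
    then show ?case using Cons.IH a inv[OF a(1)] x by (cases c) simp_all
  qed
qed

section \<open>Type-preserving representations as configurations\<close>

lemma inv_psl_tmat: "inv\<^bsub>PSL2R\<^esub> (psl (tmat s \<nu>)) = psl (tmat (- s) \<nu>)"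
proof -
  interpret group PSL2R by (rule group_PSL2R)
  have "tmat (- s) \<nu> ** tmat s \<nu> = mat 1"
    by (rule act_inject) (simp add: act_mult act_tmat)
  then show ?thesis
    by (intro inv_equality) (simp_all add: psl_mult tmat_SL2R psl_one psl_closed)
qed

definition gens :: "nat \<Rightarrow> (nat \<Rightarrow> real) \<Rightarrow> (nat \<Rightarrow> complex) \<Rightarrow> nat \<Rightarrow> (real^2^2) set" where
  "gens p S \<nu> i = psl (tmat (S (p - i)) (\<nu> (p - i)))"

definition sphere_hom :: "nat \<Rightarrow> (nat \<Rightarrow> real) \<Rightarrow> (nat \<Rightarrow> complex) \<Rightarrow> (nat \<times> bool) list set \<Rightarrow> (real^2^2) set" where
  "sphere_hom p S \<nu> = presented_hom PSL2R {1..p} (sphere_relators p) (gens p S \<nu>)"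

lemma gens_closed: "gens p S \<nu> i \<in> carrier PSL2R"
  by (simp add: gens_def psl_closed tmat_SL2R)

lemma word_value_psl:
  assumes "\<And>i. A i \<in> carrier SL2R"
  shows "foldr (**) (map A is) (mat 1) \<in> carrier SL2R \<and>
    word_value PSL2R (\<lambda>i. psl (A i)) (map (\<lambda>i. (i, True)) is) = psl (foldr (**) (map A is) (mat 1))"
  by (induction "is") (simp_all add: psl_one SL2R_closed assms psl_mult)

text \<open>Being trivial in the quotient group means being \<open>\<plusminus>1\<close> as a
  matrix, so only the parity of \<open>n\<close> is seen.\<close>

lemma relator_value:
  "(word_value PSL2R (gens p S \<nu>) (map (\<lambda>i. (i, True)) [1..<p + 1]) = \<one>\<^bsub>PSL2R\<^esub>) \<longleftrightarrow>
    (\<exists>n. \<forall>x. orb S \<nu> p x = of_real (sgn_int n) * x)"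
proof -
  define M where "M = foldr (**) (map (\<lambda>i. tmat (S (p - i)) (\<nu> (p - i))) [1..<p + 1]) (mat 1)"
  have act: "act M x = orb S \<nu> p x" for x
    using act_foldr_tmat[of p p S \<nu> x] by (simp add: M_def)
  have "word_value PSL2R (gens p S \<nu>) (map (\<lambda>i. (i, True)) [1..<p + 1]) = psl M"
    using word_value_psl[of "\<lambda>i. tmat (S (p - i)) (\<nu> (p - i))" "[1..<p + 1]"] tmat_SL2R
    unfolding gens_def M_def by blast
  then have "(word_value PSL2R (gens p S \<nu>) (map (\<lambda>i. (i, True)) [1..<p + 1]) = \<one>\<^bsub>PSL2R\<^esub>) \<longleftrightarrow> M = mat 1 \<or> M = - mat 1"
    by (simp add: psl_one psl_eq_iff)
  also have "\<dots> \<longleftrightarrow> (\<forall>x. act M x = x) \<or> (\<forall>x. act M x = - x)"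
    by (metis act_inject act_mat1 act_uminus)
  also have "\<dots> \<longleftrightarrow> (\<exists>n. \<forall>x. orb S \<nu> p x = of_real (sgn_int n) * x)"
    unfolding act
  proof
    assume "(\<forall>x. orb S \<nu> p x = x) \<or> (\<forall>x. orb S \<nu> p x = - x)"
    then show "\<exists>n. \<forall>x. orb S \<nu> p x = of_real (sgn_int n) * x"
      by (auto simp: sgn_int_def intro: exI[of _ 0] exI[of _ 1])
  qed (auto simp: sgn_int_def)
  finally show ?thesis .
qed

lemma
  assumes "orb S \<nu> p = (\<lambda>x. of_real (sgn_int n) * x)"
  shows sphere_hom_rep: "sphere_hom p S \<nu> \<in> rep_set p"
    and sphere_hom_class: "w \<in> lists ({1..p} \<times> UNIV) \<Longrightarrow>
      sphere_hom p S \<nu> (word_class {1..p} (sphere_relators p) w) = word_value PSL2R (gens p S \<nu>) w"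
proof -
  interpret group PSL2R by (rule group_PSL2R)
  have gens: "gens p S \<nu> \<in> {1..p} \<rightarrow> carrier PSL2R" using gens_closed by blast
  have "word_value PSL2R (gens p S \<nu>) (map (\<lambda>i. (i, True)) [1..<p + 1]) = \<one>\<^bsub>PSL2R\<^esub>"
    unfolding relator_value using assms by auto
  then have rel: "\<forall>r\<in>sphere_relators p \<inter> lists ({1..p} \<times> UNIV). word_value PSL2R (gens p S \<nu>) r = \<one>\<^bsub>PSL2R\<^esub>"
    by (auto simp: sphere_relators_def)
  show "sphere_hom p S \<nu> \<in> rep_set p"
    unfolding rep_set_def sphere_hom_def sphere_pi1_def by (rule presented_hom_hom[OF gens rel])
  show "w \<in> lists ({1..p} \<times> UNIV) \<Longrightarrow>
      sphere_hom p S \<nu> (word_class {1..p} (sphere_relators p) w) = word_value PSL2R (gens p S \<nu>) w"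
    unfolding sphere_hom_def by (rule presented_hom_class[OF gens rel])
qed

lemma sphere_hom_peripheral:
  assumes "orb S \<nu> p = (\<lambda>x. of_real (sgn_int n) * x)" "i \<in> {1..p}"
  shows "sphere_hom p S \<nu> (peripheral p i) = gens p S \<nu> i"
proof -
  interpret group PSL2R by (rule group_PSL2R)
  show ?thesis
    unfolding peripheral_def using sphere_hom_class[OF assms(1), of "[(i, True)]"] assms(2) gens_closed by simp
qed

lemma rep_set_eqI:
  assumes "\<phi> \<in> rep_set p" "\<psi> \<in> rep_set p" "\<And>i. i \<in> {1..p} \<Longrightarrow> \<phi> (peripheral p i) = \<psi> (peripheral p i)"
  shows "\<phi> = \<psi>"
proof -
  interpret group PSL2R by (rule group_PSL2R)
  have "\<phi> P = \<psi> P" if P: "P \<in> carrier (sphere_pi1 p)" for P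
  proof -
    obtain w where w: "w \<in> lists ({1..p} \<times> UNIV)" "P = word_class {1..p} (sphere_relators p) w"
      using P by (auto simp: sphere_pi1_def presented_group_def)
    have eq: "word_value PSL2R f w = word_value PSL2R g w" if "\<forall>i\<in>{1..p}. f i = g i" for f g
      using w(1) that by (induction w) auto
    have hom: "\<phi> \<in> hom (presented_group {1..p} (sphere_relators p)) PSL2R"
        "\<psi> \<in> hom (presented_group {1..p} (sphere_relators p)) PSL2R"
      using assms(1,2) unfolding rep_set_def sphere_pi1_def by blast+
    have "\<forall>i\<in>{1..p}. \<phi> (word_class {1..p} (sphere_relators p) [(i, True)]) = \<psi> (word_class {1..p} (sphere_relators p) [(i, True)])"
      using assms(3) unfolding peripheral_def by blast
    from eq[OF this] show ?thesis
      unfolding w(2) hom_word_value[OF hom(1) w(1)] hom_word_value[OF hom(2) w(1)] .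
  qed
  then show ?thesis
    using assms(1,2) unfolding rep_set_def
    by (intro extensionalityI[of \<phi> "carrier (sphere_pi1 p)"]) blast+
qed

lemma rep_set_relator:
  assumes "\<phi> \<in> rep_set p"
  shows "word_value PSL2R (\<lambda>i. \<phi> (peripheral p i)) (map (\<lambda>i. (i, True)) [1..<p + 1]) = \<one>\<^bsub>PSL2R\<^esub>"
proof -
  interpret group PSL2R by (rule group_PSL2R)
  have \<phi>: "\<phi> \<in> hom (presented_group {1..p} (sphere_relators p)) PSL2R"
    using assms by (simp add: rep_set_def sphere_pi1_def)
  define r where "r = map (\<lambda>i. (i, True)) [1..<p + 1]"
  have r: "r \<in> lists ({1..p} \<times> UNIV)" by (auto simp: r_def)
  have "word_eq {1..p} (sphere_relators p) ([] @ r @ []) ([] @ [])"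
    by (rule word_eq.relator) (use r in \<open>simp_all add: sphere_relators_def r_def\<close>)
  then have "word_class {1..p} (sphere_relators p) r = word_class {1..p} (sphere_relators p) []"
    by (intro word_class_eqI) simp
  then show ?thesis
    using hom_word_value[OF \<phi> r] hom_word_value[OF \<phi>, of "[]"] by (simp add: peripheral_def r_def)
qed

lemma continuous_on_word_value:
  "continuous_map (top_of_set C) PSL2R_topology (\<lambda>\<nu>. word_value PSL2R (gens p S \<nu>) w)"
proof (induction w)
  case Nil
  then show ?case
    using psl_closed[OF SL2R_closed(2)] by (simp add: psl_one topspace_PSL2R_topology)
next
  case (Cons x w)
  define e where "e = (if snd x then S (p - fst x) else - S (p - fst x))"
  have "continuous_on C (\<lambda>\<nu>. tmat e (\<nu> (p - fst x)))"
    by (intro continuous_on_tmat continuous_on_subset[OF continuous_on_product_coordinates]) simp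
  then have "continuous_map (top_of_set C) PSL2R_topology (\<lambda>\<nu>. psl (tmat e (\<nu> (p - fst x))))"
    by (rule continuous_map_psl_comp) (rule tmat_SL2R)
  from continuous_map_compose[OF continuous_map_pairedI[OF this Cons] continuous_map_PSL2R_mult]
  show ?case by (cases "snd x") (simp_all add: o_def e_def gens_def inv_psl_tmat)
qed

text \<open>Continuity is pointwise on the fundamental group, and each value is a fixed word in
  generators depending continuously on the tuple.\<close>

lemma continuous_map_sphere_hom:
  "continuous_map (top_of_set (configs p S n)) (rep_topology p) (sphere_hom p S)"
proof -
  have C: "orb S \<nu> p = (\<lambda>x. of_real (sgn_int n) * x)" if "\<nu> \<in> configs p S n" for \<nu>
    using that by (auto simp: configs_def)
  have rep: "sphere_hom p S \<nu> \<in> rep_set p" if "\<nu> \<in> configs p S n" for \<nu>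
    using sphere_hom_rep[OF C[OF that]] .
  have "continuous_map (top_of_set (configs p S n)) PSL2R_topology (\<lambda>\<nu>. sphere_hom p S \<nu> P)"
    if P: "P \<in> carrier (sphere_pi1 p)" for P
  proof -
    obtain w where w: "w \<in> lists ({1..p} \<times> UNIV)" "P = word_class {1..p} (sphere_relators p) w"
      using P by (auto simp: sphere_pi1_def presented_group_def)
    show ?thesis
      by (rule continuous_map_eq[OF continuous_on_word_value[where w = w and p = p and S = S]])
        (simp only: w(2) topspace_euclidean_subtopology sphere_hom_class[OF C w(1)])
  qed
  moreover have "sphere_hom p S \<in> configs p S n \<rightarrow> extensional (carrier (sphere_pi1 p))"
    using rep by (auto simp: rep_set_def)
  ultimately show ?thesis
    unfolding rep_topology_def continuous_map_in_subtopology continuous_map_componentwise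
    using rep by auto
qed

text \<open>Conversely to \<open>sphere_hom\<close>, the tuple of a representation consists of the
  parameters of the trace \<open>2\<close> lifts of its peripheral values; the relation between the
  generators closes its orbits up to sign.\<close>

lemma rep_space_eq_image:
  assumes s: "s \<in> {1..p} \<rightarrow>\<^sub>E {1, - 1}" and S: "\<And>k. k < p \<Longrightarrow> S k = real_of_int (s (p - k))" "\<And>k. S k * S k = 1"
  shows "rep_space p n s = sphere_hom p S ` configs p S n"
proof (intro equalityI subsetI)
  have S': "S (p - i) = real_of_int (s i)" if "i \<in> {1..p}" for i
    using S(1)[of "p - i"] that by auto
  {
    fix \<phi> assume "\<phi> \<in> sphere_hom p S ` configs p S n"
    then obtain \<nu> where \<nu>: "\<nu> \<in> configs p S n" and \<phi>: "\<phi> = sphere_hom p S \<nu>" by blast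
    have orb: "orb S \<nu> p = (\<lambda>x. of_real (sgn_int n) * x)" and nz: "\<And>k. k < p \<Longrightarrow> \<nu> k \<noteq> 0"
      and turn: "turning p S \<nu> 1 = of_int n * pi"
      using \<nu> by (auto simp: configs_def)
    have per: "\<phi> (peripheral p i) = psl (tmat (S (p - i)) (\<nu> (p - i)))" if "i \<in> {1..p}" for i
      using sphere_hom_peripheral[OF orb that] by (simp add: \<phi> gens_def)
    have sgn: "S (p - i) = 1 \<or> S (p - i) = - 1" for i using sign_cases[OF S(2)] .
    have "rel_euler_class p \<phi> = n"
      by (rule rel_euler_class_eq[where s = S and \<nu> = \<nu>]) (use S(2) nz orb turn per in auto)
    moreover have "parabolic (\<phi> (peripheral p i))" if "i \<in> {1..p}" for i
      unfolding per[OF that] parabolic_iff using sgn nz[of "p - i"] that by auto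
    moreover have "rep_sign p \<phi> = s"
    proof (rule extensionalityI[of _ "{1..p}"])
      show "rep_sign p \<phi> \<in> extensional {1..p}" by (simp add: rep_sign_def)
      show "s \<in> extensional {1..p}" using s by (simp add: PiE_def)
      fix i assume i: "i \<in> {1..p}"
      then have "real_of_int (rep_sign p \<phi> i) = S (p - i)"
        using parabolic_sign_tmat[OF sgn nz[of "p - i"]] by (simp add: rep_sign_def per)
      then show "rep_sign p \<phi> i = s i" using S'[OF i] by simp
    qed
    ultimately show "\<phi> \<in> rep_space p n s"
      using sphere_hom_rep[OF orb] by (simp add: rep_space_def type_preserving_def \<phi>)
  }
  fix \<phi> assume \<phi>: "\<phi> \<in> rep_space p n s"
  then have rep: "\<phi> \<in> rep_set p" by (simp add: rep_space_def type_preserving_def)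
  have "\<exists>w. w \<noteq> 0 \<and> \<phi> (peripheral p i) = psl (tmat (S (p - i)) w)" if i: "i \<in> {1..p}" for i
  proof -
    have "parabolic (\<phi> (peripheral p i))" using \<phi> i by (simp add: rep_space_def type_preserving_def)
    then obtain e w where w: "e = 1 \<or> e = - 1" "w \<noteq> 0" "\<phi> (peripheral p i) = psl (tmat e w)"
      unfolding parabolic_iff by blast
    have "rep_sign p \<phi> i = s i" using \<phi> by (simp add: rep_space_def)
    then have "e = S (p - i)"
      using parabolic_sign_tmat[OF w(1,2)] i S'[OF i] by (simp add: rep_sign_def w(3))
    then show ?thesis using w by blast
  qed
  then obtain w where w: "\<And>i. i \<in> {1..p} \<Longrightarrow> w i \<noteq> 0 \<and> \<phi> (peripheral p i) = psl (tmat (S (p - i)) (w i))"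
    by metis
  define \<nu> where "\<nu> k = (if k < p then w (p - k) else 0)" for k
  have nz: "\<nu> k \<noteq> 0" if "k < p" for k
    using w[of "p - k"] that by (simp add: \<nu>_def)
  have per: "\<phi> (peripheral p i) = gens p S \<nu> i" if "i \<in> {1..p}" for i
    using w[OF that] that by (simp add: gens_def \<nu>_def)
  have "word_value PSL2R (gens p S \<nu>) (map (\<lambda>i. (i, True)) is) =
      word_value PSL2R (\<lambda>i. \<phi> (peripheral p i)) (map (\<lambda>i. (i, True)) is)" if "set is \<subseteq> {1..p}" for "is"
    using that by (induction "is") (simp_all add: per)
  from this[of "[1..<p + 1]"]
  have "word_value PSL2R (gens p S \<nu>) (map (\<lambda>i. (i, True)) [1..<p + 1]) = \<one>\<^bsub>PSL2R\<^esub>"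
    unfolding rep_set_relator[OF rep] by fastforce
  then obtain n' where n': "\<And>x. orb S \<nu> p x = of_real (sgn_int n') * x"
    unfolding relator_value by blast
  \<comment> \<open>The relator determines only a parity. The turning supplies an integer
    \<open>m\<close> of this parity, which is then recognised as the Euler class.\<close>
  obtain m where m: "turning p S \<nu> 1 = of_int m * pi" "even m \<longleftrightarrow> even n'"
    using turning_int[OF n', of 1] by auto
  have orb: "orb S \<nu> p x = of_real (sgn_int m) * x" for x
    using n' m(2) by (simp add: sgn_int_def)
  have "rel_euler_class p \<phi> = m"
    by (rule rel_euler_class_eq[where s = S and \<nu> = \<nu>]) (use S(2) nz orb m(1) per in \<open>auto simp: gens_def\<close>)
  then have "m = n" using \<phi> by (simp add: rep_space_def)
  have "\<nu> \<in> configs p S n"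
    by (rule configsI[where x = 1]) (use nz orb m(1) S(2) in \<open>auto simp: \<nu>_def \<open>m = n\<close>\<close>)
  moreover have "\<phi> = sphere_hom p S \<nu>"
  proof (rule rep_set_eqI[OF rep])
    have o: "orb S \<nu> p = (\<lambda>x. of_real (sgn_int m) * x)" using orb by blast
    show "sphere_hom p S \<nu> \<in> rep_set p" by (rule sphere_hom_rep[OF o])
    show "\<phi> (peripheral p i) = sphere_hom p S \<nu> (peripheral p i)" if "i \<in> {1..p}" for i
      using per[OF that] sphere_hom_peripheral[OF o that] by simp
  qed
  ultimately show "\<phi> \<in> sphere_hom p S ` configs p S n" by blast
qed

lemma card_reverse_index:
  fixes p :: nat
  shows "card {i \<in> {1..p}. P i} = card {k. k < p \<and> P (p - k)}"
  by (rule bij_betw_same_card[of "\<lambda>i. p - i"], rule bij_betw_byWitness[where f' = "\<lambda>i. p - i"]) auto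

theorem theorem1p2:
  fixes p :: nat and n :: int and s :: "nat \<Rightarrow> int"
  assumes "p \<ge> 3"
    and "s \<in> {1..p} \<rightarrow>\<^sub>E {1, - 1}"
  shows "(rep_space p n s \<noteq> {} \<longleftrightarrow>
            (sphere_euler_char p + int (p_plus p s) \<le> n \<and>
               n \<le> - sphere_euler_char p - int (p_minus p s))
          \<or> (n = 0 \<and> (p_minus p s = 1 \<or> p_plus p s = 1))
          \<or> (n = 1 \<and> p_minus p s = 0 \<or> n = - 1 \<and> p_plus p s = 0))
       \<and> (rep_space p n s \<noteq> {} \<longrightarrow> connectedin (rep_topology p) (rep_space p n s))"
proof -
  \<comment> \<open>The index is reversed because matrices act from the left; the value
    \<open>1\<close> from \<open>p\<close> on makes \<open>S k * S k = 1\<close> true for every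
    \<open>k\<close>.\<close>
  define S where "S k = (if k < p then real_of_int (s (p - k)) else 1)" for k
  have sgn: "s i = 1 \<or> s i = - 1" if "i \<in> {1..p}" for i using assms(2) that by auto
  have S2: "S k * S k = 1" for k
  proof (cases "k < p")
    case True
    then have "p - k \<in> {1..p}" by auto
    with True show ?thesis using sgn[of "p - k"] by (auto simp: S_def)
  qed (simp add: S_def)
  have eq: "rep_space p n s = sphere_hom p S ` configs p S n"
    by (rule rep_space_eq_image) (use assms(2) S2 in \<open>simp_all add: S_def\<close>)
  have "{k. k < p \<and> S k = real_of_int a} = {k. k < p \<and> s (p - k) = a}" for a
    by (auto simp: S_def)
  from this[of 1] this[of "- 1"] have cnt: "p_plus p s = pos_count p S" "p_minus p s = neg_count p S"
    unfolding p_plus_def p_minus_def pos_count_def neg_count_def card_reverse_index by simp_all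
  have "connectedin (top_of_set (configs p S n)) (configs p S n)"
    using configs_main(1)[OF S2 assms(1)] by (simp add: connectedin_subtopology)
  from connectedin_continuous_map_image[OF continuous_map_sphere_hom this]
  have "connectedin (rep_topology p) (rep_space p n s)" unfolding eq .
  moreover have "rep_space p n s \<noteq> {} \<longleftrightarrow> admissible p S n"
    using configs_main(2)[OF S2 assms(1)] by (simp add: eq)
  ultimately show ?thesis
    unfolding cnt sphere_euler_char_def admissible_def by auto
qed

end
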